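(* Assume $\zeta=0$. Let $(\sigma_0,\sigma_1)\in(0,\infty)\times(1,\infty)$. There exist $\epsilon_0>0$ and $C>0$ such that for all $\epsilon<\epsilon_0$ the following is true. Suppose $(\chi_0,\chi_1,N_0)$ is a set of classical shock front initial data with initial shock front $\sigma_0$ such that there exists $r>0$ such that $$B:=\sup_{s\in[\sigma_0,\infty)}\Bigl[|\chi_0'(s)-\tau|+s^{r+1}|\chi_0''(s)|+|\chi_1(s)-\sigma_1(N_1-\tau)|+s^{r+1}|\chi_1'(s)|\Bigr]<\epsilon.$$ Then the unique classical shock solution $(\chi,N)$ with initial data $(\chi_0,\chi_1,N_0)$, with shock front $\sigma$, has final time of existence $T_+=\infty$, and the state variables and shock speed remain close to and asymptotically approach those of a piece-wise constant stretched motion as $t\to\infty$: there exists $\sigma_1^\infty\in(1,\infty)$ such that $\bigl|\frac{\sigma_1^\infty}{\sigma_1}-1\bigr|\le C\epsilon$ and for all $t\in[0,\infty)$: $$\sup_{s\in[\sigma(t),\infty)}s^{r+1}\bigl[|\chi_{ss}(s,t)|+|\chi_{st}(s,t)|\bigr]\le CB,$$ $$\sup_{s\in[\sigma(t),\infty)}\Bigl[|\chi_s(s,t)-\tau|+|\chi_t(s,t)-\sigma_1^\infty(N_1-\tau)|\Bigr]\le CB(1+t)^{-r},$$ $$\Bigl|\frac{\sigma'(t)}{\sigma_1^\infty}-1\Bigr|\le CB(1+t)^{-r},$$ $$\sup_{s\in[0,\sigma(t)]}\Bigl|N(s,t)\bigl(\tau+(\sigma_1^\infty)^2(N_1-\tau)\bigr)^{-1}-1\Bigr|\le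 CB(1+t)^{-r}.$$
   Context: Standing constants (units chosen so that mass density and elastic modulus equal $1$): $N_1>1$, $0<\eta<N_1$, $\tau\in(\eta,N_1)$, $\zeta\ge 0$ are fixed. Here $\chi(s,t)$ is the position at time $t$ of the particle $s\in[0,\infty)$ of a string and $N(s,t)$ its tension. For a function $g$, $g(\infty)$ means $\lim_{s\to\infty}g(s)$; likewise $g(\infty,t)=\lim_{s\to\infty}g(s,t)$. A superscript $+$ as in $g(\sigma^+,t)$ denotes the limit from the right in $s$. At the interface between two regions, values are understood as one-sided limits from the region in question (so suprema over $[\sigma(t),\infty)$ use values from $\mathcal E_\sigma$ and suprema over $[0,\sigma(t)]$ use values from $\mathcal I_\sigma$, both defined below). Classical shock front initial data: a triple $(\chi_0,\chi_1,N_0)$ of real-valued functions in $C([0,\infty))\times L^\infty([0,\infty))\times L^\infty([0,\infty))$ for which there is a unique $\sigma_0\in(0,\infty)$ (the initial shock front) such that (1) $\chi_0\in C^2([\sigma_0,\infty))$, $\chi_1\in C^1([\sigma_0,\infty))$, $N_0\in C^1([\sigma_0,\infty))$; (2) for all $s\in[\sigma_0,\infty)$, $N_0(s)=\chi_0'(s)$ and $\eta<N_0(s)<N_1$; (3) $\chi_0'(\infty)=\tau$, $\chi_1'(\infty)=\zeta$, $\chi_0(\sigma_0)=N_1\sigma_0$; (4) $v_0:=\dfrac{\chi_1(\sigma_0^+)}{N_1-\chi_0'(\sigma_0^+)}>1$; (5) for all $s\in[0,\sigma_0]$: $\chi_0(s)=N_1 s$, $\chi_1(s)=0$, $N_0(s)=N_0(\sigma_0^+)+v_0^2\,(N_1-N_0(\sigma_0^+))>N_1$.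 Classical shock solution on $[0,T]$ with initial data $(\chi_0,\chi_1,N_0)$: a pair $(\chi,N)$ with $\chi\in C([0,\infty)\times[0,T])$, $N\in L^\infty([0,\infty)\times[0,T])$, $\partial_t\chi\in L^\infty([0,\infty)\times[0,T])$, for which there is a unique curve $\sigma\in C^2([0,T];[\sigma_0,\infty))$ (the shock front) with $\sigma(0)=\sigma_0$ such that, with $\mathcal E_\sigma=\{(s,t):t\in[0,T],\ s\in[\sigma(t),\infty)\}$ and $\mathcal I_\sigma=\{(s,t):t\in[0,T],\ s\in[0,\sigma(t)]\}$ (writing $\sigma=\sigma(t)$), (1) $\chi\in C^2(\mathcal E_\sigma)$ and $N\in C^1(\mathcal E_\sigma)$; (2) on $\mathcal E_\sigma$: $N=\chi_s$ and $\eta<N<N_1$; (3) $\chi(\sigma^+,t)=N_1\sigma$; (4) $\sigma'(t)=\dfrac{\chi_t(\sigma^+,t)}{N_1-N(\sigma^+,t)}>1$; (5) on $\mathcal I_\sigma$: $\chi(s,t)=N_1 s$ and $N(s,t)=N(\sigma^+,t)+(\sigma')^2(N_1-N(\sigma^+,t))>N_1$; (6) on $\mathcal E_\sigma$: $\chi_{tt}=\chi_{ss}$, $\chi_s(\infty,t)=\zeta t+\tau$, and $\chi(s,0)=\chi_0(s)$, $\chi_t(s,0)=\chi_1(s)$ for $s\ge\sigma_0$. A shock solution on a half-open interval $[0,T)$ is a pair that is a classical shock solution on $[0,T']$ for every $T'<T$. For given initial data the classical shock solution is unique on any interval on which it exists; its final time of existence $T_+\in(0,\infty]$ is the largest time such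 that it is a shock solution on $[0,T_+)$. "The unique classical shock solution with given initial data" means the one on $[0,T_+)$. Piece-wise constant stretched motion (case $\zeta=0$) with parameters $(a,b)\in(0,\infty)\times(1,\infty)$: the shock solution with shock front $\sigma(t)=a+bt$ and, for $s\ge\sigma(t)$, $\chi(s,t)=N_1a+\tau(s-a)+b(N_1-\tau)t$, $N(s,t)=\tau$, extended to $s\in[0,\sigma(t)]$ by (5).
   Formalization: The constant C is allowed to depend on r (while ε₀ is not), because no C independent of r exists: for χ₀'=τ+δs^{-r}, χ₁=σ₁(N₁−τ), σ₀≥1, the bound on s^{r+1}|χ_ss| at the front forces C to grow like (σ₁/(σ₁−1))^{r+1}. *)

theory Defs
  imports "HOL-Analysis.Analysis"
begin

section \<open>Functions on regions with values taken from inside the region\<close>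

text \<open>
  The functions below jump across the shock front, and some of them are only elements of
  \<open>L\<^sup>\<infinity>\<close>.  Hence every value on a closed region (the closure of its interior) is the limit
  from the interior of that region.  For a function that is continuous up to the
  boundary this is its continuous extension, see \<open>region_value_eq\<close>.
\<close>

definition region_value :: "'a::topological_space set \<Rightarrow> ('a \<Rightarrow> real) \<Rightarrow> 'a \<Rightarrow> real" where
  "region_value S f p = Lim (at p within interior S) f"

lemma region_value_eq:
  fixes S :: "'a::perfect_space set"
  assumes "continuous_on S g" "\<And>q. q \<in> interior S \<Longrightarrow> f q = g q"
    and "p \<in> S" "p \<in> closure (interior S)"
  shows "region_value S f p = g p"
proof -
  have "p islimpt interior S"
    using assms(4) interior_limit_point[of p "interior S"] by (auto simp: closure_def)
  hence nontriv: "\<not> trivial_limit (at p within interior S)"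
    by (simp add: trivial_limit_within)
  have "(g \<longlongrightarrow> g p) (at p within interior S)"
    using assms(1,3) interior_subset[of S] by (auto simp: continuous_on_def intro: tendsto_within_subset)
  moreover have "eventually (\<lambda>q. g q = f q) (at p within interior S)"
    using assms(2) by (auto simp: eventually_at_filter)
  ultimately have "(f \<longlongrightarrow> g p) (at p within interior S)"
    using tendsto_cong by blast
  with nontriv show ?thesis
    unfolding region_value_def by (rule tendsto_Lim)
qed

definition partial_s :: "(real \<times> real \<Rightarrow> real) \<Rightarrow> real \<times> real \<Rightarrow> real" where
  "partial_s f = (\<lambda>(s, t). deriv (\<lambda>x. f (x, t)) s)"

definition partial_t :: "(real \<times> real \<Rightarrow> real) \<Rightarrow> real \<times> real \<Rightarrow> real" where
  "partial_t f = (\<lambda>(s, t). deriv (\<lambda>x. f (s, x)) t)"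

text \<open>
  \<open>C\<^sup>k\<close> on a closed region: all derivatives of order at most \<open>k\<close> exist in the interior and
  extend continuously to the region.
\<close>

definition extends_continuously :: "'a::topological_space set \<Rightarrow> ('a \<Rightarrow> real) \<Rightarrow> bool" where
  "extends_continuously S f \<longleftrightarrow> (\<exists>g. continuous_on S g \<and> (\<forall>p\<in>interior S. f p = g p))"

primrec Ck_line :: "nat \<Rightarrow> real set \<Rightarrow> (real \<Rightarrow> real) \<Rightarrow> bool" where
  "Ck_line 0 S f \<longleftrightarrow> extends_continuously S f"
| "Ck_line (Suc k) S f \<longleftrightarrow>
     extends_continuously S f \<and> (\<forall>x\<in>interior S. f differentiable (at x)) \<and> Ck_line k S (deriv f)"

primrec Ck_plane :: "nat \<Rightarrow> (real \<times> real) set \<Rightarrow> (real \<times> real \<Rightarrow> real) \<Rightarrow> bool" where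
  "Ck_plane 0 S f \<longleftrightarrow> extends_continuously S f"
| "Ck_plane (Suc k) S f \<longleftrightarrow>
     extends_continuously S f \<and> (\<forall>p\<in>interior S. f differentiable (at p)) \<and>
     Ck_plane k S (partial_s f) \<and> Ck_plane k S (partial_t f)"

definition L_infinity :: "'a::euclidean_space set \<Rightarrow> ('a \<Rightarrow> real) \<Rightarrow> bool" where
  "L_infinity S f \<longleftrightarrow>
     f \<in> borel_measurable (lebesgue_on S) \<and> (\<exists>M. AE x in lebesgue_on S. \<bar>f x\<bar> \<le> M)"


section \<open>Classical shock front initial data\<close>

text \<open>
  The motion is written \<open>chi\<close>, since the Greek letter is binder syntax of HOL-Analysis.
  Values with superscript \<open>+\<close> at \<open>\<sigma>\<^sub>0\<close> are values taken from \<open>[\<sigma>\<^sub>0, \<infinity>)\<close>.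
\<close>

definition initial_shock_front ::
    "real \<Rightarrow> real \<Rightarrow> real \<Rightarrow> real \<Rightarrow> (real \<Rightarrow> real) \<Rightarrow> (real \<Rightarrow> real) \<Rightarrow> (real \<Rightarrow> real) \<Rightarrow> real \<Rightarrow> bool" where
  "initial_shock_front N\<^sub>1 \<eta> \<tau> \<zeta> chi\<^sub>0 chi\<^sub>1 N\<^sub>0 \<sigma>\<^sub>0 \<longleftrightarrow> \<sigma>\<^sub>0 > 0 \<and>
    (let E = {\<sigma>\<^sub>0..}; I = {0..\<sigma>\<^sub>0};
         N\<^sub>p = region_value E N\<^sub>0 \<sigma>\<^sub>0;
         v\<^sub>0 = region_value E chi\<^sub>1 \<sigma>\<^sub>0 / (N\<^sub>1 - region_value E (deriv chi\<^sub>0) \<sigma>\<^sub>0)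
     in Ck_line 2 E chi\<^sub>0 \<and> Ck_line 1 E chi\<^sub>1 \<and> Ck_line 1 E N\<^sub>0 \<and>
        (\<forall>s\<in>E. region_value E N\<^sub>0 s = region_value E (deriv chi\<^sub>0) s \<and>
               \<eta> < region_value E N\<^sub>0 s \<and> region_value E N\<^sub>0 s < N\<^sub>1) \<and>
        (deriv chi\<^sub>0 \<longlongrightarrow> \<tau>) at_top \<and> (deriv chi\<^sub>1 \<longlongrightarrow> \<zeta>) at_top \<and> chi\<^sub>0 \<sigma>\<^sub>0 = N\<^sub>1 * \<sigma>\<^sub>0 \<and>
        v\<^sub>0 > 1 \<and>
        Ck_line 0 I chi\<^sub>1 \<and> Ck_line 0 I N\<^sub>0 \<and>
        (\<forall>s\<in>I. chi\<^sub>0 s = N\<^sub>1 * s \<and> region_value I chi\<^sub>1 s = 0 \<and>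
               region_value I N\<^sub>0 s = N\<^sub>p + v\<^sub>0\<^sup>2 * (N\<^sub>1 - N\<^sub>p) \<and> region_value I N\<^sub>0 s > N\<^sub>1))"

definition classical_shock_data ::
    "real \<Rightarrow> real \<Rightarrow> real \<Rightarrow> real \<Rightarrow> (real \<Rightarrow> real) \<Rightarrow> (real \<Rightarrow> real) \<Rightarrow> (real \<Rightarrow> real) \<Rightarrow> bool" where
  "classical_shock_data N\<^sub>1 \<eta> \<tau> \<zeta> chi\<^sub>0 chi\<^sub>1 N\<^sub>0 \<longleftrightarrow>
     continuous_on {0..} chi\<^sub>0 \<and> L_infinity {0..} chi\<^sub>1 \<and> L_infinity {0..} N\<^sub>0 \<and>
     (\<exists>!\<sigma>\<^sub>0. initial_shock_front N\<^sub>1 \<eta> \<tau> \<zeta> chi\<^sub>0 chi\<^sub>1 N\<^sub>0 \<sigma>\<^sub>0)"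


section \<open>Classical shock solutions\<close>

text \<open>The regions \<open>\<E>\<^sub>\<sigma>\<close> and \<open>\<I>\<^sub>\<sigma>\<close>, with \<open>J\<close> the time interval.\<close>

definition region_E :: "real set \<Rightarrow> (real \<Rightarrow> real) \<Rightarrow> (real \<times> real) set" where
  "region_E J \<sigma> = {(s, t). t \<in> J \<and> \<sigma> t \<le> s}"

definition region_I :: "real set \<Rightarrow> (real \<Rightarrow> real) \<Rightarrow> (real \<times> real) set" where
  "region_I J \<sigma> = {(s, t). t \<in> J \<and> 0 \<le> s \<and> s \<le> \<sigma> t}"

text \<open>
  The initial front \<open>\<sigma>\<^sub>0\<close> enters as \<open>\<sigma> 0\<close>.  A value \<open>g(\<sigma>\<^sup>+, t)\<close> is the value of \<open>g\<close> at
  \<open>(\<sigma> t, t)\<close> taken from \<open>\<E>\<^sub>\<sigma>\<close>.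
\<close>

definition shock_front ::
    "real \<Rightarrow> real \<Rightarrow> real \<Rightarrow> real \<Rightarrow> (real \<Rightarrow> real) \<Rightarrow> (real \<Rightarrow> real) \<Rightarrow> (real \<Rightarrow> real) \<Rightarrow> real \<Rightarrow>
     (real \<times> real \<Rightarrow> real) \<Rightarrow> (real \<times> real \<Rightarrow> real) \<Rightarrow> (real \<Rightarrow> real) \<Rightarrow> bool" where
  "shock_front N\<^sub>1 \<eta> \<tau> \<zeta> chi\<^sub>0 chi\<^sub>1 N\<^sub>0 T chi N \<sigma> \<longleftrightarrow>
    (let J = {0..T}; E = region_E J \<sigma>; I = region_I J \<sigma>;
         \<sigma>' = region_value J (deriv \<sigma>);
         N\<^sub>p = (\<lambda>t. region_value E N (\<sigma> t, t))
     in initial_shock_front N\<^sub>1 \<eta> \<tau> \<zeta> chi\<^sub>0 chi\<^sub>1 N\<^sub>0 (\<sigma> 0) \<and>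
        continuous_on J \<sigma> \<and> Ck_line 2 J \<sigma> \<and> (\<forall>t\<in>J. \<sigma> 0 \<le> \<sigma> t) \<and>
        Ck_plane 2 E chi \<and> Ck_plane 1 E N \<and>
        (\<forall>p\<in>E. region_value E N p = region_value E (partial_s chi) p \<and>
               \<eta> < region_value E N p \<and> region_value E N p < N\<^sub>1) \<and>
        (\<forall>t\<in>J. region_value E chi (\<sigma> t, t) = N\<^sub>1 * \<sigma> t) \<and>
        (\<forall>t\<in>J. \<sigma>' t = region_value E (partial_t chi) (\<sigma> t, t) / (N\<^sub>1 - N\<^sub>p t) \<and> \<sigma>' t > 1) \<and>
        Ck_plane 0 I N \<and>
        (\<forall>(s, t)\<in>I. chi (s, t) = N\<^sub>1 * s \<and>
               region_value I N (s, t) = N\<^sub>p t + (\<sigma>' t)\<^sup>2 * (N\<^sub>1 - N\<^sub>p t) \<and>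
               region_value I N (s, t) > N\<^sub>1) \<and>
        (\<forall>p\<in>E. region_value E (partial_t (partial_t chi)) p
              = region_value E (partial_s (partial_s chi)) p) \<and>
        (\<forall>t\<in>J. ((\<lambda>s. region_value E (partial_s chi) (s, t)) \<longlongrightarrow> \<zeta> * t + \<tau>) at_top) \<and>
        (\<forall>s\<in>{\<sigma> 0..}. region_value E chi (s, 0) = chi\<^sub>0 s \<and>
               region_value E (partial_t chi) (s, 0) = region_value {\<sigma> 0..} chi\<^sub>1 s))"

text \<open>
  \<open>\<partial>\<^sub>tchi\<close> is taken as the pointwise derivative almost everywhere.  For the functions \<open>chi\<close> at hand,
  continuous and \<open>C\<^sup>1\<close> up to the boundary on both sides of the front, it is the
  distributional derivative.
\<close>

definition classical_shock_solution ::
    "real \<Rightarrow> real \<Rightarrow> real \<Rightarrow> real \<Rightarrow> (real \<Rightarrow> real) \<Rightarrow> (real \<Rightarrow> real) \<Rightarrow> (real \<Rightarrow> real) \<Rightarrow> real \<Rightarrow>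
     (real \<times> real \<Rightarrow> real) \<Rightarrow> (real \<times> real \<Rightarrow> real) \<Rightarrow> bool" where
  "classical_shock_solution N\<^sub>1 \<eta> \<tau> \<zeta> chi\<^sub>0 chi\<^sub>1 N\<^sub>0 T chi N \<longleftrightarrow>
    (let Q = {0..} \<times> {0..T}
     in continuous_on Q chi \<and> L_infinity Q N \<and>
        (\<exists>chi\<^sub>t. L_infinity Q chi\<^sub>t \<and>
           (AE p in lebesgue_on Q.
              ((\<lambda>x. chi (fst p, x)) has_real_derivative chi\<^sub>t p) (at (snd p)))) \<and>
        (\<exists>\<sigma>. shock_front N\<^sub>1 \<eta> \<tau> \<zeta> chi\<^sub>0 chi\<^sub>1 N\<^sub>0 T chi N \<sigma> \<and>
           (\<forall>\<rho>. shock_front N\<^sub>1 \<eta> \<tau> \<zeta> chi\<^sub>0 chi\<^sub>1 N\<^sub>0 T chi N \<rho> \<longrightarrow> (\<forall>t\<in>{0..T}. \<rho> t = \<sigma> t))))"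

text \<open>\<open>(chi, N)\<close> is a shock solution on \<open>[0, T)\<close> with shock front \<open>\<sigma>\<close>; \<open>T = \<infinity>\<close> is allowed.\<close>

definition shock_solution_before ::
    "real \<Rightarrow> real \<Rightarrow> real \<Rightarrow> real \<Rightarrow> (real \<Rightarrow> real) \<Rightarrow> (real \<Rightarrow> real) \<Rightarrow> (real \<Rightarrow> real) \<Rightarrow> ereal \<Rightarrow>
     (real \<times> real \<Rightarrow> real) \<Rightarrow> (real \<times> real \<Rightarrow> real) \<Rightarrow> (real \<Rightarrow> real) \<Rightarrow> bool" where
  "shock_solution_before N\<^sub>1 \<eta> \<tau> \<zeta> chi\<^sub>0 chi\<^sub>1 N\<^sub>0 T chi N \<sigma> \<longleftrightarrow>
     (\<forall>T'>0. ereal T' < T \<longrightarrow>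
        classical_shock_solution N\<^sub>1 \<eta> \<tau> \<zeta> chi\<^sub>0 chi\<^sub>1 N\<^sub>0 T' chi N \<and>
        shock_front N\<^sub>1 \<eta> \<tau> \<zeta> chi\<^sub>0 chi\<^sub>1 N\<^sub>0 T' chi N \<sigma>)"

text \<open>
  \<open>(chi, N)\<close>, with shock front \<open>\<sigma>\<close>, is the classical shock solution with the given initial data
  and \<open>T\<close> is its final time of existence.
\<close>

definition maximal_shock_solution ::
    "real \<Rightarrow> real \<Rightarrow> real \<Rightarrow> real \<Rightarrow> (real \<Rightarrow> real) \<Rightarrow> (real \<Rightarrow> real) \<Rightarrow> (real \<Rightarrow> real) \<Rightarrow> ereal \<Rightarrow>
     (real \<times> real \<Rightarrow> real) \<Rightarrow> (real \<times> real \<Rightarrow> real) \<Rightarrow> (real \<Rightarrow> real) \<Rightarrow> bool" where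
  "maximal_shock_solution N\<^sub>1 \<eta> \<tau> \<zeta> chi\<^sub>0 chi\<^sub>1 N\<^sub>0 T chi N \<sigma> \<longleftrightarrow>
     T > 0 \<and> shock_solution_before N\<^sub>1 \<eta> \<tau> \<zeta> chi\<^sub>0 chi\<^sub>1 N\<^sub>0 T chi N \<sigma> \<and>
     (\<forall>T' chi' N' \<sigma>'. shock_solution_before N\<^sub>1 \<eta> \<tau> \<zeta> chi\<^sub>0 chi\<^sub>1 N\<^sub>0 T' chi' N' \<sigma>' \<longrightarrow> T' \<le> T)"

end

theory Submission
  imports Defs
begin

text \<open>
  The front moves faster than the waves, \<open>\<sigma>' > 1\<close>, so the characteristics through a point ahead of it
  meet the initial line ahead of \<open>\<sigma>\<^sub>0\<close>. Hence the motion ahead of the front is given by d'Alembert's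
  formula \<open>chi (s, t) = P (s + t) + Q (s - t)\<close>, with \<open>P' = F = (chi\<^sub>0' + chi\<^sub>1) / 2\<close> and
  \<open>Q' = G = (chi\<^sub>0' - chi\<^sub>1) / 2\<close>, and the front is the unique root \<open>s \<ge> \<sigma>\<^sub>0 + t\<close> of
  \<open>N\<^sub>1 * s = P (s + t) + Q (s - t)\<close>. For small data the difference of the two sides is
  nonpositive at \<open>s = \<sigma>\<^sub>0 + t\<close> and its slope in \<open>s\<close> is bounded below by a positive constant, so this
  root exists for all times. If \<open>\<sigma>' \<ge> b > 1\<close>, then \<open>s - t\<close> is at least a fixed
  fraction of \<open>s\<close> and of \<open>1 + t\<close> ahead of the front, and the decay of \<open>F\<close> and \<open>G\<close> at infinity becomes
  decay in \<open>s\<close> and \<open>t\<close>.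
\<close>

section \<open>Values on closed regions\<close>

text \<open>The estimates are claimed for every maximal solution, not just for the one constructed.
  They are therefore proved for an arbitrary solution that exists for all times
  (\<open>solution_estimates\<close>); the construction provides existence and forces the final time
  to be infinite. The difficulty with an arbitrary solution is the boundary: it is differentiable
  only inside its region, so the initial values of chi_s and all values on the front have to be
  reached by limits.

  The bound \<sigma>' \<ge> b takes two rounds. The definition of a solution gives only \<sigma>' >
  1, which keeps the arguments of F and G in the half-line where the data are within B of constants.
  There the formula for the speed improves the bound 1 to b = (1 + \<open>\<sigma>\<^sub>1\<close>)
  / 2.

  F and G have limits at infinity because their derivatives are O(x^-(r+1)). The asymptotic speed is
  the limit of F - G divided by \<open>N\<^sub>1 - \<tau>\<close>; the limit of F + G is \<tau>.
  Integrating the decay costs a factor 1/r, so the constant in the estimates depends on r, while the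
  smallness threshold does not.\<close>

lemma region_value_local:
  fixes S S' :: "'a::perfect_space set"
  assumes "open U" "p \<in> U" "S \<inter> U = S' \<inter> U"
  shows "region_value S f p = region_value S' f p"
proof -
  have "interior S \<inter> U = interior S' \<inter> U"
    using arg_cong[OF assms(3), of interior] assms(1) by (simp add: interior_open)
  hence "at p within interior S = at p within interior S'"
    using assms(1,2) by (intro at_within_nhd[of p U]) auto
  thus ?thesis by (simp add: region_value_def)
qed

lemma region_value_interior:
  assumes "p \<in> interior S"
  shows "region_value S f p = Lim (at p) f"
  unfolding region_value_def at_within_open[OF assms open_interior] ..

lemma region_value_half_line:
  fixes f g :: "real \<Rightarrow> real"
  assumes "continuous_on {a..} g" "\<And>x. x > a \<Longrightarrow> f x = g x" "x \<ge> a"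
  shows "region_value {a..} f x = g x"
proof (rule region_value_eq)
  show "x \<in> closure (interior {a..})" using assms(3) by simp
qed (use assms in auto)

lemma region_value_interval:
  fixes f g :: "real \<Rightarrow> real"
  assumes "continuous_on {a..b} g" "\<And>x. a < x \<Longrightarrow> x < b \<Longrightarrow> f x = g x" "a < b" "x \<in> {a..b}"
  shows "region_value {a..b} f x = g x"
proof (rule region_value_eq)
  show "x \<in> closure (interior {a..b})" using assms(3,4) by simp
qed (use assms in auto)

text \<open>An open set inside the region contains an open rectangle around each of its points. The
  sides of the rectangle are open subsets of \<open>{\<sigma> t..}\<close> and
  \<open>{0..T}\<close>, which excludes the boundary values of s and t.\<close>

lemma interior_region_E:
  assumes "continuous_on {0..T} \<sigma>"
  shows "interior (region_E {0..T} \<sigma>) = {(s, t). 0 < t \<and> t < T \<and> \<sigma> t < s}" (is "_ = ?O")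
proof (rule interior_unique)
  show "?O \<subseteq> region_E {0..T} \<sigma>" by (auto simp: region_E_def)
  have c: "continuous_on (UNIV \<times> {0<..<T}) (\<lambda>p. fst p - \<sigma> (snd p))"
    by (intro continuous_intros continuous_on_compose2[OF assms]) auto
  have "open ((\<lambda>p::real\<times>real. fst p - \<sigma> (snd p)) -` {0<..} \<inter> UNIV \<times> {0<..<T})"
    using continuous_open_preimage[OF c, of "{0<..}"] by (simp add: open_Times Int_commute)
  moreover have "(\<lambda>p::real\<times>real. fst p - \<sigma> (snd p)) -` {0<..} \<inter> UNIV \<times> {0<..<T} = ?O" by auto
  ultimately show "open ?O" by simp
next
  fix V assume V: "V \<subseteq> region_E {0..T} \<sigma>" "open V"
  show "V \<subseteq> ?O"
  proof (clarify)
    fix s t assume p: "(s, t) \<in> V"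
    obtain A B where AB: "open A" "open B" "(s, t) \<in> A \<times> B" "A \<times> B \<subseteq> V"
      by (rule open_prod_elim[OF V(2) p])
    have AV: "(x, y) \<in> region_E {0..T} \<sigma>" if "x \<in> A" "y \<in> B" for x y
      using that AB(4) V(1) by blast
    have "A \<subseteq> {\<sigma> t..}" using AV AB(3) by (auto simp: region_E_def)
    hence "A \<subseteq> {\<sigma> t<..}" using AB(1) interior_maximal[of A "{\<sigma> t..}"] by simp
    moreover have "B \<subseteq> {0..T}" using AV AB(3) by (auto simp: region_E_def)
    hence "B \<subseteq> {0<..<T}" using AB(2) interior_maximal[of B "{0..T}"] by simp
    ultimately show "0 < t \<and> t < T \<and> \<sigma> t < s" using AB by auto
  qed
qed

lemma interior_region_I:
  assumes "continuous_on {0..T} \<sigma>"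
  shows "interior (region_I {0..T} \<sigma>) = {(s, t). 0 < t \<and> t < T \<and> 0 < s \<and> s < \<sigma> t}" (is "_ = ?O")
proof (rule interior_unique)
  show "?O \<subseteq> region_I {0..T} \<sigma>" by (auto simp: region_I_def)
  have c: "continuous_on (UNIV \<times> {0<..<T}) (\<lambda>p. \<sigma> (snd p) - fst p)"
    by (intro continuous_intros continuous_on_compose2[OF assms]) auto
  have "open ((\<lambda>p::real\<times>real. \<sigma> (snd p) - fst p) -` {0<..} \<inter> UNIV \<times> {0<..<T})"
    using continuous_open_preimage[OF c, of "{0<..}"] by (simp add: open_Times Int_commute)
  hence "open (((\<lambda>p::real\<times>real. \<sigma> (snd p) - fst p) -` {0<..} \<inter> UNIV \<times> {0<..<T}) \<inter> ({0<..} \<times> UNIV))"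
    by (rule open_Int[OF _ open_Times[OF open_greaterThan open_UNIV]])
  moreover have "((\<lambda>p::real\<times>real. \<sigma> (snd p) - fst p) -` {0<..} \<inter> UNIV \<times> {0<..<T}) \<inter> ({0<..} \<times> UNIV) = ?O"
    by auto
  ultimately show "open ?O" by simp
next
  fix V assume V: "V \<subseteq> region_I {0..T} \<sigma>" "open V"
  show "V \<subseteq> ?O"
  proof (clarify)
    fix s t assume p: "(s, t) \<in> V"
    obtain A B where AB: "open A" "open B" "(s, t) \<in> A \<times> B" "A \<times> B \<subseteq> V"
      by (rule open_prod_elim[OF V(2) p])
    have AV: "(x, y) \<in> region_I {0..T} \<sigma>" if "x \<in> A" "y \<in> B" for x y
      using that AB(4) V(1) by blast
    have "A \<subseteq> {0..\<sigma> t}" using AV AB(3) by (auto simp: region_I_def)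
    hence "A \<subseteq> {0<..<\<sigma> t}" using AB(1) interior_maximal[of A "{0..\<sigma> t}"] by simp
    moreover have "B \<subseteq> {0..T}" using AV AB(3) by (auto simp: region_I_def)
    hence "B \<subseteq> {0<..<T}" using AB(2) interior_maximal[of B "{0..T}"] by simp
    ultimately show "0 < t \<and> t < T \<and> 0 < s \<and> s < \<sigma> t" using AB by auto
  qed
qed

text \<open>Moves the end times 0 and \<open>T\<close> into the open interval at the price of an
  arbitrarily small change of the front.\<close>

lemma near_front_time:
  assumes "continuous_on {0..T} \<sigma>" "T > 0" "t \<in> {0..T}" "e > (0::real)"
  obtains t' where "0 < t'" "t' < T" "\<bar>t' - t\<bar> < e" "\<bar>\<sigma> t' - \<sigma> t\<bar> < (e::real)"
proof -
  obtain d where d: "d > 0" "\<And>x. x \<in> {0..T} \<Longrightarrow> dist x t < d \<Longrightarrow> dist (\<sigma> x) (\<sigma> t) < e"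
    using assms(1,3,4) unfolding continuous_on_iff by blast
  have "t \<in> closure {0<..<T}" using assms(2,3) by simp
  then obtain t' where "t' \<in> {0<..<T}" "dist t' t < min d e"
    using d(1) assms(4) by (meson closure_approachable min_less_iff_conj)
  thus ?thesis using that[of t'] d(2)[of t'] by (auto simp: dist_real_def)
qed

text \<open>When the time is moved inward, the front shifts by less than e/4; moving s to the right
  by e/4 makes up for this.\<close>

lemma closure_interior_region_E:
  assumes "continuous_on {0..T} \<sigma>" "T > 0" "p \<in> region_E {0..T} \<sigma>"
  shows "p \<in> closure (interior (region_E {0..T} \<sigma>))"
  unfolding closure_approachable
proof (intro allI impI)
  fix e :: real assume e: "e > 0"
  obtain s t where p: "p = (s, t)" "t \<in> {0..T}" "\<sigma> t \<le> s"
    using assms(3) by (auto simp: region_E_def)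
  obtain t' where t': "0 < t'" "t' < T" "\<bar>t' - t\<bar> < e/4" "\<bar>\<sigma> t' - \<sigma> t\<bar> < e/4"
    using near_front_time[OF assms(1,2) p(2), of "e/4"] e by auto
  have "dist (s + e/4, t') p \<le> \<bar>e/4\<bar> + \<bar>t' - t\<bar>"
    unfolding p(1) dist_Pair_Pair dist_real_def
    using sqrt_sum_squares_le_sum_abs[of "e/4" "t' - t"] by (simp add: power_divide)
  also have "\<dots> < e" using t' e by simp
  finally have "dist (s + e/4, t') p < e" .
  moreover have "\<sigma> t' < s + e/4" using t'(4) p(3) by linarith
  hence "(s + e/4, t') \<in> interior (region_E {0..T} \<sigma>)"
    using t' p by (simp add: interior_region_E[OF assms(1)])
  ultimately show "\<exists>y\<in>interior (region_E {0..T} \<sigma>). dist y p < e" by blast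
qed

text \<open>Here the room is limited on both sides. First s is moved into the open interval behind
  the front, then the time by so little that the front stays beyond the new position
  \<open>s'\<close>.\<close>

lemma closure_interior_region_I:
  assumes "continuous_on {0..T} \<sigma>" "T > 0" "p \<in> region_I {0..T} \<sigma>" "\<And>t. t \<in> {0..T} \<Longrightarrow> \<sigma> t > 0"
  shows "p \<in> closure (interior (region_I {0..T} \<sigma>))"
  unfolding closure_approachable
proof (intro allI impI)
  fix e :: real assume e: "e > 0"
  obtain s t where p: "p = (s, t)" "t \<in> {0..T}" "0 \<le> s" "s \<le> \<sigma> t"
    using assms(3) by (auto simp: region_I_def)
  have "s \<in> closure {0<..<\<sigma> t}" using p assms(4)[OF p(2)] by simp
  then obtain s' where s': "0 < s'" "s' < \<sigma> t" "\<bar>s' - s\<bar> < e/2"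
    using e by (metis closure_approachable dist_real_def greaterThanLessThan_iff half_gt_zero)
  obtain t' where t': "0 < t'" "t' < T" "\<bar>t' - t\<bar> < min (e/2) (\<sigma> t - s')" "\<bar>\<sigma> t' - \<sigma> t\<bar> < min (e/2) (\<sigma> t - s')"
    using near_front_time[OF assms(1,2) p(2), of "min (e/2) (\<sigma> t - s')"] e s' by auto
  have "dist (s', t') p \<le> \<bar>s' - s\<bar> + \<bar>t' - t\<bar>"
    unfolding p(1) dist_Pair_Pair dist_real_def
    using sqrt_sum_squares_le_sum_abs[of "s' - s" "t' - t"] by simp
  also have "\<dots> < e" using s' t' by simp
  finally show "\<exists>y\<in>interior (region_I {0..T} \<sigma>). dist y p < e"
    using t' s' by (intro bexI[where x = "(s', t')"]) (auto simp: interior_region_I[OF assms(1)])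
qed

lemma region_value_E:
  assumes "continuous_on {0..T} \<sigma>" "T > 0" "continuous_on (region_E {0..T} \<sigma>) g"
    and "\<And>s t. 0 < t \<Longrightarrow> t < T \<Longrightarrow> \<sigma> t < s \<Longrightarrow> f (s, t) = g (s, t)"
    and "p \<in> region_E {0..T} \<sigma>"
  shows "region_value (region_E {0..T} \<sigma>) f p = g p"
  by (rule region_value_eq[OF assms(3) _ assms(5) closure_interior_region_E[OF assms(1,2,5)]])
    (use assms(4) in \<open>auto simp: interior_region_E[OF assms(1)]\<close>)


section \<open>Continuously differentiable functions up to the boundary\<close>

lemma has_derivative_partials:
  fixes f :: "real \<times> real \<Rightarrow> real"
  assumes "f differentiable (at (s, t))"
  shows "(f has_derivative (\<lambda>(h, k). partial_s f (s, t) * h + partial_t f (s, t) * k)) (at (s, t))"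
proof -
  obtain D where D: "(f has_derivative D) (at (s, t))" using assms by (auto simp: differentiable_def)
  interpret D: bounded_linear D by (rule has_derivative_bounded_linear[OF D])
  have "((\<lambda>x. f (x, t)) has_derivative (\<lambda>h. D (h, 0))) (at s)"
    by (rule has_derivative_compose[OF has_derivative_Pair[OF has_derivative_ident has_derivative_const] D])
  moreover have "(\<lambda>h. D (h, 0)) = (*) (D (1, 0))"
  proof
    fix h
    have "D (h, 0) = D (h *\<^sub>R (1, 0))" by simp
    thus "D (h, 0) = D (1, 0) * h" by (simp only: D.scaleR) simp
  qed
  ultimately have 1: "((\<lambda>x. f (x, t)) has_real_derivative D (1, 0)) (at s)"
    by (simp add: has_field_derivative_def)
  have "((\<lambda>x. f (s, x)) has_derivative (\<lambda>h. D (0, h))) (at t)"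
    by (rule has_derivative_compose[OF has_derivative_Pair[OF has_derivative_const has_derivative_ident] D])
  moreover have "(\<lambda>h. D (0, h)) = (*) (D (0, 1))"
  proof
    fix h
    have "D (0, h) = D (h *\<^sub>R (0, 1))" by simp
    thus "D (0, h) = D (0, 1) * h" by (simp only: D.scaleR) simp
  qed
  ultimately have 2: "((\<lambda>x. f (s, x)) has_real_derivative D (0, 1)) (at t)"
    by (simp add: has_field_derivative_def)
  have lin: "D (h, k) = D (1, 0) * h + D (0, 1) * k" for h k
  proof -
    have "D (h, k) = D (h *\<^sub>R (1, 0) + k *\<^sub>R (0, 1))" by simp
    thus ?thesis by (simp only: D.add D.scaleR) simp
  qed
  have pd: "partial_s f (s, t) = D (1, 0)" "partial_t f (s, t) = D (0, 1)"
    using DERIV_imp_deriv[OF 1] DERIV_imp_deriv[OF 2] by (simp_all add: partial_s_def partial_t_def)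
  have "(\<lambda>(h, k). partial_s f (s, t) * h + partial_t f (s, t) * k) = D"
  proof
    fix x show "(case x of (h, k) \<Rightarrow> partial_s f (s, t) * h + partial_t f (s, t) * k) = D x"
      using lin[of "fst x" "snd x"] by (simp add: case_prod_beta pd)
  qed
  with D show ?thesis by (simp only:)
qed

lemma has_real_derivative_along_curve:
  fixes f :: "real \<times> real \<Rightarrow> real"
  assumes "f differentiable (at (x z, y z))"
    and "(x has_real_derivative x') (at z)" "(y has_real_derivative y') (at z)"
  shows "((\<lambda>z. f (x z, y z)) has_real_derivative
           partial_s f (x z, y z) * x' + partial_t f (x z, y z) * y') (at z)"
proof -
  have "((\<lambda>z. (x z, y z)) has_derivative (\<lambda>h. (x' * h, y' * h))) (at z)"
    using assms(2,3) by (auto simp: has_field_derivative_def intro!: has_derivative_Pair)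
  from has_derivative_compose[OF this has_derivative_partials[OF assms(1)]]
  have "((\<lambda>z. f (x z, y z)) has_derivative
     (\<lambda>h. partial_s f (x z, y z) * (x' * h) + partial_t f (x z, y z) * (y' * h))) (at z)" by simp
  thus ?thesis unfolding has_field_derivative_def
    by (rule has_derivative_eq_rhs) (auto simp: algebra_simps)
qed

lemma partials_cong:
  assumes "open U" "\<And>p. p \<in> U \<Longrightarrow> f p = g p" "p \<in> U"
  shows "partial_s f p = partial_s g p" "partial_t f p = partial_t g p"
proof -
  obtain s t where p: "p = (s, t)" by (cases p)
  have "open ((\<lambda>x. (x, t)) -` U)" "open ((\<lambda>x. (s, x)) -` U)"
    by (intro open_vimage assms(1) continuous_intros)+
  hence "eventually (\<lambda>x. f (x, t) = g (x, t)) (nhds s)" "eventually (\<lambda>x. f (s, x) = g (s, x)) (nhds t)"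
    using assms(2,3) p unfolding eventually_nhds by (metis vimageE vimageI2)+
  thus "partial_s f p = partial_s g p" "partial_t f p = partial_t g p"
    by (simp_all add: p partial_s_def partial_t_def deriv_cong_ev)
qed

lemma extends_continuously_cong:
  assumes "\<And>p. p \<in> interior S \<Longrightarrow> f p = g p"
  shows "extends_continuously S f \<longleftrightarrow> extends_continuously S g"
  using assms by (simp add: extends_continuously_def)

lemma extends_continuouslyI: "continuous_on S f \<Longrightarrow> extends_continuously S f"
  by (auto simp: extends_continuously_def)

lemma differentiable_cong_open:
  assumes "open U" "\<And>p. p \<in> U \<Longrightarrow> f p = g p" "p \<in> U"
  shows "f differentiable (at p) \<longleftrightarrow> g differentiable (at p)"
proof -
  have "f differentiable (at p)" if "g differentiable (at p)" "\<And>p. p \<in> U \<Longrightarrow> f p = g p" for f g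
    using that assms(1,3) has_derivative_transform_within_open[of g _ p UNIV U f]
    unfolding differentiable_def by fastforce
  thus ?thesis using assms(2) by metis
qed

text \<open>Lets the piecewise defined \<open>motion\<close> and \<open>stress\<close> inherit their
  regularity from the d'Alembert formulas. The induction runs over all \<open>f\<close> and
  \<open>g\<close> because it passes to their partial derivatives.\<close>

lemma Ck_plane_cong:
  assumes "\<And>p. p \<in> interior S \<Longrightarrow> f p = g p"
  shows "Ck_plane k S f \<longleftrightarrow> Ck_plane k S g"
  using assms
proof (induction k arbitrary: f g)
  case 0
  thus ?case using extends_continuously_cong[of S f g] by simp
next
  case (Suc k)
  have "extends_continuously S f \<longleftrightarrow> extends_continuously S g"
    by (rule extends_continuously_cong[OF Suc.prems])
  moreover have "Ck_plane k S (partial_s f) \<longleftrightarrow> Ck_plane k S (partial_s g)"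
    using partials_cong(1)[OF open_interior] Suc.prems by (intro Suc.IH) blast
  moreover have "Ck_plane k S (partial_t f) \<longleftrightarrow> Ck_plane k S (partial_t g)"
    using partials_cong(2)[OF open_interior] Suc.prems by (intro Suc.IH) blast
  moreover have "(\<forall>p\<in>interior S. f differentiable (at p)) \<longleftrightarrow> (\<forall>p\<in>interior S. g differentiable (at p))"
    using differentiable_cong_open[OF open_interior] Suc.prems by blast
  ultimately show ?case by simp
qed

lemma antiderivative_exists:
  fixes f :: "real \<Rightarrow> real"
  assumes "continuous_on UNIV f"
  shows "\<exists>F. \<forall>x. (F has_real_derivative f x) (at x)"
  using einterval_antiderivative[of "-\<infinity>" \<infinity> f] assms
  by (auto simp: continuous_on_eq_continuous_at has_real_derivative_iff_has_vector_derivative)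

lemma continuous_max_const:
  assumes "continuous_on {a..} (e :: real \<Rightarrow> real)"
  shows "continuous_on UNIV (\<lambda>x. e (max a x))"
  by (intro continuous_on_compose2[OF assms] continuous_intros) auto

text \<open>
  Prolonging the data to the left of \<open>a\<close> makes one-sided derivatives at the front ordinary ones.
\<close>

lemma Ck_line_1_extension:
  assumes "Ck_line 1 {a..} f"
  obtains g g' where "\<And>x. (g has_real_derivative g' x) (at x)" "continuous_on UNIV g'"
    "\<And>x. x > a \<Longrightarrow> f x = g x" "\<And>x. x > a \<Longrightarrow> deriv f x = g' x"
proof -
  have diff: "f differentiable (at x)" if "x > a" for x using assms that by simp
  obtain e where e: "continuous_on {a..} e" "\<And>x. x > a \<Longrightarrow> deriv f x = e x"
    using assms by (auto simp: extends_continuously_def)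
  \<comment> \<open>To the left of \<open>a\<close> the derivative is frozen at its limit value at
    \<open>a\<close>.\<close>
  define g' where "g' = (\<lambda>x. e (max a x))"
  have g': "continuous_on UNIV g'" unfolding g'_def by (rule continuous_max_const[OF e(1)])
  obtain G where G: "\<And>x. (G has_real_derivative g' x) (at x)"
    using antiderivative_exists[OF g'] by blast
  have df: "(f has_real_derivative g' x) (at x)" if "x > a" for x
  proof -
    have "(f has_real_derivative deriv f x) (at x)"
      using diff[OF that] by (simp add: DERIV_deriv_iff_real_differentiable)
    moreover have "deriv f x = g' x" using e(2)[OF that] that by (simp add: g'_def max_def)
    ultimately show ?thesis by (simp only:)
  qed
  have "((\<lambda>x. f x - G x) has_real_derivative 0) (at x within {a<..})" if "x \<in> {a<..}" for x
    using DERIV_diff[OF df G] that by (auto intro: has_field_derivative_at_within)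
  hence "\<exists>c. \<forall>x\<in>{a<..}. f x - G x = c"
    by (intro has_field_derivative_zero_constant) auto
  then obtain c where c: "\<And>x. x > a \<Longrightarrow> f x - G x = c" by auto
  show ?thesis
  proof (rule that[of "\<lambda>x. G x + c" g'])
    show "((\<lambda>x. G x + c) has_real_derivative g' x) (at x)" for x
      by (auto intro!: derivative_eq_intros G)
    show "f x = G x + c" if "x > a" for x using c[OF that] by simp
    show "deriv f x = g' x" if "x > a" for x using df[OF that] by (rule DERIV_imp_deriv)
  qed (rule g')
qed

section \<open>The wave equation ahead of the front\<close>

lemma DERIV_partial_s:
  assumes "f differentiable (at (s, t))"
  shows "((\<lambda>x. f (x, t)) has_real_derivative partial_s f (s, t)) (at s)"
  using has_real_derivative_along_curve[OF _ DERIV_ident DERIV_const, of f s t] assms by simp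

lemma DERIV_partial_t:
  assumes "f differentiable (at (s, t))"
  shows "((\<lambda>x. f (s, x)) has_real_derivative partial_t f (s, t)) (at t)"
  using has_real_derivative_along_curve[OF _ DERIV_const DERIV_ident, of f s t] assms by simp

text \<open>The mean value theorem is applied first in s and then in t. The opposite order yields
  the other mixed derivative for the same second difference, and comparing the two is the proof of
  symmetry.\<close>

lemma mixed_difference_mvt:
  assumes "h > 0" "\<And>x y. x \<in> {s..s+h} \<Longrightarrow> y \<in> {t..t+h} \<Longrightarrow> (x, y) \<in> U"
    and "\<And>p. p \<in> U \<Longrightarrow> f differentiable (at p)"
    and "\<And>p. p \<in> U \<Longrightarrow> partial_s f differentiable (at p)"
  obtains x y where "x \<in> {s..s+h}" "y \<in> {t..t+h}"
    "f (s+h, t+h) - f (s+h, t) - f (s, t+h) + f (s, t) = h\<^sup>2 * partial_t (partial_s f) (x, y)"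
proof -
  have "((\<lambda>x. f (x, t+h) - f (x, t)) has_real_derivative
      partial_s f (x, t+h) - partial_s f (x, t)) (at x)" if "s \<le> x" "x \<le> s+h" for x
    using that assms(1,2) by (intro DERIV_diff DERIV_partial_s assms(3)) auto
  from MVT2[of s "s+h", OF _ this] assms(1) obtain x where x: "s < x" "x < s+h"
    "f (s+h, t+h) - f (s+h, t) - (f (s, t+h) - f (s, t)) = h * (partial_s f (x, t+h) - partial_s f (x, t))"
    by auto
  have "((\<lambda>y. partial_s f (x, y)) has_real_derivative partial_t (partial_s f) (x, y)) (at y)"
    if "t \<le> y" "y \<le> t+h" for y
    using that x assms(1,2) by (intro DERIV_partial_t assms(4)) auto
  from MVT2[of t "t+h", OF _ this] assms(1) obtain y where y: "t < y" "y < t+h"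
    "partial_s f (x, t+h) - partial_s f (x, t) = h * partial_t (partial_s f) (x, y)"
    by auto
  show ?thesis
    using x y by (intro that[of x y]) (auto simp: power2_eq_square)
qed

lemma mixed_difference_mvt':
  assumes "h > 0" "\<And>x y. x \<in> {s..s+h} \<Longrightarrow> y \<in> {t..t+h} \<Longrightarrow> (x, y) \<in> U"
    and "\<And>p. p \<in> U \<Longrightarrow> f differentiable (at p)"
    and "\<And>p. p \<in> U \<Longrightarrow> partial_t f differentiable (at p)"
  obtains x y where "x \<in> {s..s+h}" "y \<in> {t..t+h}"
    "f (s+h, t+h) - f (s+h, t) - f (s, t+h) + f (s, t) = h\<^sup>2 * partial_s (partial_t f) (x, y)"
proof -
  have "((\<lambda>y. f (s+h, y) - f (s, y)) has_real_derivative
      partial_t f (s+h, y) - partial_t f (s, y)) (at y)" if "t \<le> y" "y \<le> t+h" for y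
    using that assms(1,2) by (intro DERIV_diff DERIV_partial_t assms(3)) auto
  from MVT2[of t "t+h", OF _ this] assms(1) obtain y where y: "t < y" "y < t+h"
    "f (s+h, t+h) - f (s, t+h) - (f (s+h, t) - f (s, t)) = h * (partial_t f (s+h, y) - partial_t f (s, y))"
    by auto
  have "((\<lambda>x. partial_t f (x, y)) has_real_derivative partial_s (partial_t f) (x, y)) (at x)"
    if "s \<le> x" "x \<le> s+h" for x
    using that y assms(1,2) by (intro DERIV_partial_s assms(4)) auto
  from MVT2[of s "s+h", OF _ this] assms(1) obtain x where x: "s < x" "x < s+h"
    "partial_t f (s+h, y) - partial_t f (s, y) = h * partial_s (partial_t f) (x, y)"
    by auto
  show ?thesis
    using x y by (intro that[of x y]) (auto simp: power2_eq_square)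
qed

text \<open>\<open>Ck_plane\<close> contains both mixed derivatives without relating them, but the
  argument along characteristics needs them equal. If they differed at \<open>p\<close>, continuity
  would keep them apart on a small square, against the two expressions for one second
  difference.\<close>

lemma mixed_partials_eq:
  assumes U: "open U" "p \<in> U"
    and f: "\<And>p. p \<in> U \<Longrightarrow> f differentiable (at p)"
      "\<And>p. p \<in> U \<Longrightarrow> partial_s f differentiable (at p)"
      "\<And>p. p \<in> U \<Longrightarrow> partial_t f differentiable (at p)"
    and c: "continuous_on U (partial_t (partial_s f))" "continuous_on U (partial_s (partial_t f))"
  shows "partial_t (partial_s f) p = partial_s (partial_t f) p"
proof (rule ccontr)
  define a b where ab: "a = partial_t (partial_s f) p" "b = partial_s (partial_t f) p"
  assume "partial_t (partial_s f) p \<noteq> partial_s (partial_t f) p"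
  hence e: "\<bar>a - b\<bar> / 2 > 0" by (simp add: ab)
  obtain s t where p: "p = (s, t)" by (cases p)
  obtain d0 where d0: "d0 > 0" "ball p d0 \<subseteq> U" using U open_contains_ball by blast
  obtain d1 where d1: "d1 > 0" "\<And>q. q \<in> U \<Longrightarrow> dist q p < d1 \<Longrightarrow> dist (partial_t (partial_s f) q) a < \<bar>a - b\<bar> / 2"
    using c(1) U(2) e unfolding continuous_on_iff ab by meson
  obtain d2 where d2: "d2 > 0" "\<And>q. q \<in> U \<Longrightarrow> dist q p < d2 \<Longrightarrow> dist (partial_s (partial_t f) q) b < \<bar>a - b\<bar> / 2"
    using c(2) U(2) e unfolding continuous_on_iff ab by meson
  \<comment> \<open>A square of side \<open>h\<close> with corner \<open>p\<close> lies within
    distance 2 h of \<open>p\<close>, hence in the ball of radius 3 h, where all three conditions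
    hold.\<close>
  define h where "h = min d0 (min d1 d2) / 3"
  have h: "h > 0" "3 * h \<le> d0" "3 * h \<le> d1" "3 * h \<le> d2" using d0 d1 d2 by (auto simp: h_def)
  have near: "dist (x, y) p < 3 * h" if "x \<in> {s..s+h}" "y \<in> {t..t+h}" for x y
  proof -
    have "dist (x, y) p \<le> \<bar>x - s\<bar> + \<bar>y - t\<bar>"
      unfolding p dist_Pair_Pair dist_real_def
      using sqrt_sum_squares_le_sum_abs[of "x - s" "y - t"] by simp
    also have "\<dots> < 3 * h" using that h(1) by auto
    finally show ?thesis .
  qed
  have inU: "(x, y) \<in> U" if "x \<in> {s..s+h}" "y \<in> {t..t+h}" for x y
    using near[OF that] h(2) d0(2) by (auto simp: dist_commute)
  obtain x y where 1: "x \<in> {s..s+h}" "y \<in> {t..t+h}"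
    "f (s+h, t+h) - f (s+h, t) - f (s, t+h) + f (s, t) = h\<^sup>2 * partial_t (partial_s f) (x, y)"
    using mixed_difference_mvt[of h s t U f] h(1) inU f(1,2) by metis
  obtain x' y' where 2: "x' \<in> {s..s+h}" "y' \<in> {t..t+h}"
    "f (s+h, t+h) - f (s+h, t) - f (s, t+h) + f (s, t) = h\<^sup>2 * partial_s (partial_t f) (x', y')"
    using mixed_difference_mvt'[of h s t U f] h(1) inU f(1,3) by metis
  have "partial_t (partial_s f) (x, y) = partial_s (partial_t f) (x', y')"
    using 1(3) 2(3) h(1) by simp
  moreover have "dist (partial_t (partial_s f) (x, y)) a < \<bar>a - b\<bar> / 2"
    using near[OF 1(1,2)] inU[OF 1(1,2)] h by (intro d1(2)) auto
  moreover have "dist (partial_s (partial_t f) (x', y')) b < \<bar>a - b\<bar> / 2"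
    using near[OF 2(1,2)] inU[OF 2(1,2)] h by (intro d2(2)) auto
  ultimately show False by (auto simp: dist_real_def abs_if split: if_splits)
qed

lemma Ck_plane_2D:
  assumes "Ck_plane 2 S f"
  shows "extends_continuously S f" "extends_continuously S (partial_s f)" "extends_continuously S (partial_t f)"
    and "\<And>p. p \<in> interior S \<Longrightarrow> f differentiable (at p)"
    and "\<And>p. p \<in> interior S \<Longrightarrow> partial_s f differentiable (at p)"
    and "\<And>p. p \<in> interior S \<Longrightarrow> partial_t f differentiable (at p)"
    and "\<And>p. p \<in> interior S \<Longrightarrow> partial_t (partial_s f) p = partial_s (partial_t f) p"
proof -
  have C: "extends_continuously S f" "extends_continuously S (partial_s f)" "extends_continuously S (partial_t f)"
    "extends_continuously S (partial_t (partial_s f))" "extends_continuously S (partial_s (partial_t f))"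
    and D: "\<forall>p\<in>interior S. f differentiable (at p)"
    "\<forall>p\<in>interior S. partial_s f differentiable (at p)"
    "\<forall>p\<in>interior S. partial_t f differentiable (at p)"
    using assms by (simp_all add: numeral_2_eq_2)
  have cont: "continuous_on (interior S) g" if "extends_continuously S g" for g
  proof -
    from that[unfolded extends_continuously_def]
    obtain h where h: "continuous_on S h \<and> (\<forall>p\<in>interior S. g p = h p)" ..
    have "continuous_on (interior S) h"
      by (rule continuous_on_subset[OF conjunct1[OF h] interior_subset])
    thus ?thesis using conjunct2[OF h] continuous_on_cong[of "interior S" "interior S" g h] by simp
  qed
  show "partial_t (partial_s f) p = partial_s (partial_t f) p" if "p \<in> interior S" for p
    using D by (intro mixed_partials_eq[OF open_interior that] cont C) auto
qed (use assms in \<open>simp_all add: numeral_2_eq_2\<close>)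

text \<open>By the wave equation and the symmetry of second derivatives, chi_s + e chi_t has
  derivative 0 along the lines on which s + e t is constant. Followed backwards in time, such a line
  stays ahead of a front of speed at least 1. It ends on the boundary t = 0, where the continuous
  extensions \<open>gs\<close> and \<open>gt\<close> take over.\<close>

lemma wave_invariant:
  assumes \<sigma>: "continuous_on {0..T} \<sigma>" "\<And>u v. 0 \<le> u \<Longrightarrow> u \<le> v \<Longrightarrow> v \<le> T \<Longrightarrow> v - u \<le> \<sigma> v - \<sigma> u"
    and C: "Ck_plane 2 (region_E {0..T} \<sigma>) chi"
    and wave: "\<And>p. p \<in> interior (region_E {0..T} \<sigma>) \<Longrightarrow>
        partial_t (partial_t chi) p = partial_s (partial_s chi) p"
    and gs: "continuous_on (region_E {0..T} \<sigma>) gs"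
      "\<And>p. p \<in> interior (region_E {0..T} \<sigma>) \<Longrightarrow> partial_s chi p = gs p"
    and gt: "continuous_on (region_E {0..T} \<sigma>) gt"
      "\<And>p. p \<in> interior (region_E {0..T} \<sigma>) \<Longrightarrow> partial_t chi p = gt p"
    and p: "0 < t" "t < T" "\<sigma> t < s" and e: "e = 1 \<or> e = -1"
  shows "gs (s, t) + e * gt (s, t) = gs (s + e * t, 0) + e * gt (s + e * t, 0)"
proof -
  let ?E = "region_E {0..T} \<sigma>"
  define c where "c z = (s + e * (t - z), z)" for z
  define h where "h z = gs (c z) + e * gt (c z)" for z
  have cE: "c z \<in> ?E" if "z \<in> {0..t}" for z
    using that p e \<sigma>(2)[of z t] by (auto simp: c_def region_E_def)
  have cI: "c z \<in> interior ?E" if "0 < z" "z \<le> t" for z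
    using that p e \<sigma>(2)[of z t] by (auto simp: c_def interior_region_E[OF \<sigma>(1)])
  have "continuous_on {0..t} h" unfolding h_def c_def
    using cE by (intro continuous_intros continuous_on_compose2[OF gs(1)] continuous_on_compose2[OF gt(1)])
      (auto simp: c_def)
  moreover have "(h has_real_derivative 0) (at z)" if "0 < z" "z < t" for z
  proof -
    have cz: "c z \<in> interior ?E" using cI that by simp
    have d: "((\<lambda>z. s + e * (t - z)) has_real_derivative -e) (at z)" "((\<lambda>z. z) has_real_derivative 1) (at z)"
      by (auto intro!: derivative_eq_intros)
    have "((\<lambda>z. partial_s chi (c z)) has_real_derivative
        partial_s (partial_s chi) (c z) * -e + partial_t (partial_s chi) (c z) * 1) (at z)"
      using Ck_plane_2D(5)[OF C cz] unfolding c_def by (intro has_real_derivative_along_curve d)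
    moreover have "((\<lambda>z. partial_t chi (c z)) has_real_derivative
        partial_s (partial_t chi) (c z) * -e + partial_t (partial_t chi) (c z) * 1) (at z)"
      using Ck_plane_2D(6)[OF C cz] unfolding c_def by (intro has_real_derivative_along_curve d)
    ultimately have "((\<lambda>z. partial_s chi (c z) + e * partial_t chi (c z)) has_real_derivative
        (partial_s (partial_s chi) (c z) * -e + partial_t (partial_s chi) (c z) * 1) +
        e * (partial_s (partial_t chi) (c z) * -e + partial_t (partial_t chi) (c z) * 1)) (at z)"
      by (intro DERIV_add DERIV_cmult)
    moreover have "(partial_s (partial_s chi) (c z) * -e + partial_t (partial_s chi) (c z) * 1) +
        e * (partial_s (partial_t chi) (c z) * -e + partial_t (partial_t chi) (c z) * 1) = 0"
      using e wave[OF cz] Ck_plane_2D(7)[OF C cz] by auto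
    ultimately have "((\<lambda>z. partial_s chi (c z) + e * partial_t chi (c z)) has_real_derivative 0) (at z)"
      by metis
    moreover have "partial_s chi (c z) + e * partial_t chi (c z) = h z" if "z \<in> {0<..<t}" for z
      using that cI[of z] gs(2)[of "c z"] gt(2)[of "c z"] by (simp add: h_def)
    ultimately show ?thesis
      using that has_field_derivative_transform_within_open[of _ 0 z "{0<..<t}" h] by auto
  qed
  ultimately have "h t = h 0"
    using DERIV_isconst_end[of 0 t h] p(1) by blast
  thus ?thesis by (simp add: h_def c_def)
qed

text \<open>The mean value inequality for \<open>f z - m * z\<close>, in a form that survives the
  limit t -> 0 in \<open>initial_slope\<close>.\<close>

lemma DERIV_error_bound:
  fixes f :: "real \<Rightarrow> real"
  assumes "\<And>z. z \<in> closed_segment x y \<Longrightarrow> (f has_real_derivative f' z) (at z)"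
    and "\<And>z. z \<in> closed_segment x y \<Longrightarrow> \<bar>f' z - m\<bar> \<le> e"
  shows "\<bar>f y - f x - m * (y - x)\<bar> \<le> e * \<bar>y - x\<bar>"
proof -
  have "norm ((f y - m * y) - (f x - m * x)) \<le> e * norm (y - x)"
  proof (rule field_differentiable_bound[of "closed_segment x y" "\<lambda>z. f z - m * z" "\<lambda>z. f' z - m"])
    fix z assume "z \<in> closed_segment x y"
    thus "((\<lambda>z. f z - m * z) has_real_derivative f' z - m) (at z within closed_segment x y)"
      by (auto intro!: derivative_eq_intros assms(1) intro: has_field_derivative_at_within)
  qed (use assms(2) in auto)
  thus ?thesis by (simp add: algebra_simps)
qed

text \<open>The initial condition prescribes chi but not chi_s. For small t > 0 the increments of
  chi in s are close to those of a line of slope \<open>gs (x, 0)\<close>, by continuity of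
  \<open>gs\<close>; letting t tend to 0 carries this over to \<phi>.\<close>

lemma initial_slope:
  assumes \<sigma>: "continuous_on {0..T} \<sigma>" "T > 0"
    and g: "continuous_on (region_E {0..T} \<sigma>) g" "continuous_on (region_E {0..T} \<sigma>) gs"
      "\<And>p. p \<in> interior (region_E {0..T} \<sigma>) \<Longrightarrow> chi differentiable (at p)"
      "\<And>p. p \<in> interior (region_E {0..T} \<sigma>) \<Longrightarrow> chi p = g p"
      "\<And>p. p \<in> interior (region_E {0..T} \<sigma>) \<Longrightarrow> partial_s chi p = gs p"
    and init: "\<And>y. y \<ge> \<sigma> 0 \<Longrightarrow> g (y, 0) = \<phi> y" and x: "x > \<sigma> 0"
  shows "(\<phi> has_real_derivative gs (x, 0)) (at x)"
  unfolding has_field_derivative_def has_derivative_at_alt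
proof (intro conjI allI impI)
  let ?E = "region_E {0..T} \<sigma>"
  show "bounded_linear ((*) (gs (x, 0)))" by (rule bounded_linear_mult_right)
  fix e :: real assume e: "e > 0"
  have "(x, 0) \<in> ?E" using x \<sigma>(2) by (simp add: region_E_def)
  then obtain d0 where d0: "d0 > 0" "\<And>q. q \<in> ?E \<Longrightarrow> dist q (x, 0) < d0 \<Longrightarrow> dist (gs q) (gs (x, 0)) < e"
    using g(2) e unfolding continuous_on_iff by meson
  define d1 where "d1 = (x - \<sigma> 0) / 2"
  have d1: "d1 > 0" using x by (simp add: d1_def)
  have "0 \<in> {0..T}" using \<sigma>(2) by simp
  then obtain t0 where t0: "t0 > 0" "\<And>z. z \<in> {0..T} \<Longrightarrow> dist z 0 < t0 \<Longrightarrow> dist (\<sigma> z) (\<sigma> 0) < d1"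
    using \<sigma>(1) d1 unfolding continuous_on_iff by meson
  \<comment> \<open>The rectangle |z - x| < d, 0 \<le> t \<le> t1 has to lie within time
    \<open>T\<close>, within distance \<open>d0\<close> of (x, 0), and ahead of the moving front.
    For these times the front stays left of the midpoint between \<open>\<sigma> 0\<close> and
    \<open>x\<close>.\<close>
  define d where "d = min (d0/2) d1"
  define t1 where "t1 = min (t0/2) (min (d0/2) (T/2))"
  have pos: "d > 0" "t1 > 0" using d0 d1 t0 \<sigma>(2) by (auto simp: d_def t1_def)
  have in_E: "(z, t) \<in> ?E" "0 < t \<Longrightarrow> (z, t) \<in> interior ?E" if "\<bar>z - x\<bar> < d" "0 \<le> t" "t \<le> t1" for z t
  proof -
    have "\<sigma> t < \<sigma> 0 + d1" using t0(2)[of t] that t0(1) \<sigma>(2) by (auto simp: t1_def dist_real_def min_def split: if_splits)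
    moreover have "\<sigma> 0 + d1 < z" using that(1) by (auto simp: d_def d1_def abs_if field_simps split: if_splits)
    moreover have "t < T" using that \<sigma>(2) by (auto simp: t1_def)
    ultimately show "(z, t) \<in> ?E" "0 < t \<Longrightarrow> (z, t) \<in> interior ?E"
      using that(2) by (simp_all add: interior_region_E[OF \<sigma>(1)]) (simp add: region_E_def)
  qed
  have "norm (\<phi> y - \<phi> x - gs (x, 0) * (y - x)) \<le> e * norm (y - x)" if y: "norm (y - x) < d" for y
  proof -
    have seg: "\<bar>z - x\<bar> < d" if "z \<in> closed_segment x y" for z
      using that y by (auto simp: closed_segment_eq_real_ivl split: if_splits)
    have "\<bar>g (y, t) - g (x, t) - gs (x, 0) * (y - x)\<bar> \<le> e * \<bar>y - x\<bar>" if t: "t \<in> {0<..t1}" for t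
    proof -
      have "\<bar>chi (y, t) - chi (x, t) - gs (x, 0) * (y - x)\<bar> \<le> e * \<bar>y - x\<bar>"
      proof (rule DERIV_error_bound[of x y "\<lambda>z. chi (z, t)" "\<lambda>z. partial_s chi (z, t)"])
        fix z assume z: "z \<in> closed_segment x y"
        have i: "(z, t) \<in> interior ?E" "(z, t) \<in> ?E" using in_E[OF seg[OF z], of t] t by auto
        show "((\<lambda>z. chi (z, t)) has_real_derivative partial_s chi (z, t)) (at z)"
          by (rule DERIV_partial_s[OF g(3)[OF i(1)]])
        have "dist (z, t) (x, 0) \<le> \<bar>z - x\<bar> + \<bar>t\<bar>"
          unfolding dist_Pair_Pair dist_real_def
          using sqrt_sum_squares_le_sum_abs[of "z - x" t] by simp
        also have "\<dots> < d0" using seg[OF z] t by (auto simp: d_def t1_def)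
        finally show "\<bar>partial_s chi (z, t) - gs (x, 0)\<bar> \<le> e"
          using d0(2)[OF i(2)] g(5)[OF i(1)] by (simp add: dist_real_def)
      qed
      moreover have "chi (y, t) = g (y, t)" "chi (x, t) = g (x, t)"
        using in_E(2)[of y t] in_E(2)[of x t] y t pos by (auto intro!: g(4))
      ultimately show ?thesis by simp
    qed
    moreover have "continuous_on {0..t1} (\<lambda>t. \<bar>g (y, t) - g (x, t) - gs (x, 0) * (y - x)\<bar>)"
      using in_E(1)[of y] in_E(1)[of x] y pos
      by (intro continuous_intros continuous_on_compose2[OF g(1)]) auto
    ultimately have "\<bar>g (y, 0) - g (x, 0) - gs (x, 0) * (y - x)\<bar> \<le> e * \<bar>y - x\<bar>"
      using continuous_le_on_closure[of "{0<..t1}" "\<lambda>t. \<bar>g (y, t) - g (x, t) - gs (x, 0) * (y - x)\<bar>" 0] pos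
      by auto
    moreover have "y \<ge> \<sigma> 0" using y by (auto simp: d_def d1_def abs_if field_simps split: if_splits)
    ultimately show ?thesis using init x by simp
  qed
  thus "\<exists>d>0. \<forall>y. norm (y - x) < d \<longrightarrow> norm (\<phi> y - \<phi> x - gs (x, 0) * (y - x)) \<le> e * norm (y - x)"
    using pos(1) by blast
qed

text \<open>Used with c = 1, from the definition of a shock front, and later with c =
  \<open>b\<close>, from the smallness of the data.\<close>

lemma front_growth:
  assumes "continuous_on {0..T} \<sigma>" "Ck_line 2 {0..T} \<sigma>"
    and "\<And>t. t \<in> {0..T} \<Longrightarrow> c \<le> region_value {0..T} (deriv \<sigma>) t"
    and "0 \<le> u" "u \<le> v" "v \<le> T"
  shows "c * (v - u) \<le> \<sigma> v - \<sigma> u"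
proof (cases "u = v")
  case False
  hence uv: "u < v" using assms by simp
  obtain e where e: "continuous_on {0..T} e" "\<And>x. 0 < x \<Longrightarrow> x < T \<Longrightarrow> deriv \<sigma> x = e x"
    and diff: "\<And>x. 0 < x \<Longrightarrow> x < T \<Longrightarrow> \<sigma> differentiable (at x)"
    using assms(2) by (auto simp: numeral_2_eq_2 extends_continuously_def)
  have "(\<sigma> has_derivative (*) (deriv \<sigma> x)) (at x)" if "u < x" "x < v" for x
    using diff[of x] that assms by (simp add: DERIV_deriv_iff_real_differentiable flip: has_field_derivative_def)
  moreover have "continuous_on {u..v} \<sigma>" using assms by (auto intro: continuous_on_subset)
  ultimately obtain x where x: "u < x" "x < v" "\<sigma> v - \<sigma> u = deriv \<sigma> x * (v - u)"
    using mvt[of u v \<sigma> "\<lambda>x. (*) (deriv \<sigma> x)"] uv by metis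
  have "region_value {0..T} (deriv \<sigma>) x = e x"
    using e x assms by (intro region_value_interval) auto
  hence "c \<le> deriv \<sigma> x" using assms(3)[of x] e(2)[of x] x assms by auto
  thus ?thesis using x uv by (simp add: mult_right_mono)
qed simp

section \<open>Uniqueness of the front\<close>

lemma shock_frontD:
  assumes "shock_front N\<^sub>1 \<eta> \<tau> \<zeta> chi\<^sub>0 chi\<^sub>1 N\<^sub>0 T chi N \<sigma>"
  defines "E \<equiv> region_E {0..T} \<sigma>" and "I \<equiv> region_I {0..T} \<sigma>"
  shows "initial_shock_front N\<^sub>1 \<eta> \<tau> \<zeta> chi\<^sub>0 chi\<^sub>1 N\<^sub>0 (\<sigma> 0)"
    and "continuous_on {0..T} \<sigma>" and "Ck_line 2 {0..T} \<sigma>" and "\<And>t. t \<in> {0..T} \<Longrightarrow> \<sigma> 0 \<le> \<sigma> t"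
    and "Ck_plane 2 E chi"
    and "\<And>p. p \<in> E \<Longrightarrow> region_value E N p = region_value E (partial_s chi) p"
    and "\<And>p. p \<in> E \<Longrightarrow> region_value E N p < N\<^sub>1"
    and "\<And>t. t \<in> {0..T} \<Longrightarrow> region_value {0..T} (deriv \<sigma>) t =
           region_value E (partial_t chi) (\<sigma> t, t) / (N\<^sub>1 - region_value E N (\<sigma> t, t))"
    and "\<And>t. t \<in> {0..T} \<Longrightarrow> 1 < region_value {0..T} (deriv \<sigma>) t"
    and "\<And>s t. (s, t) \<in> I \<Longrightarrow> region_value I N (s, t) =
           region_value E N (\<sigma> t, t) +
           (region_value {0..T} (deriv \<sigma>) t)\<^sup>2 * (N\<^sub>1 - region_value E N (\<sigma> t, t))"
    and "\<And>s t. (s, t) \<in> I \<Longrightarrow> N\<^sub>1 < region_value I N (s, t)"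
    and "\<And>p. p \<in> E \<Longrightarrow> region_value E (partial_t (partial_t chi)) p = region_value E (partial_s (partial_s chi)) p"
    and "\<And>s. \<sigma> 0 \<le> s \<Longrightarrow> region_value E chi (s, 0) = chi\<^sub>0 s"
    and "\<And>s. \<sigma> 0 \<le> s \<Longrightarrow> region_value E (partial_t chi) (s, 0) = region_value {\<sigma> 0..} chi\<^sub>1 s"
  using assms(1) unfolding shock_front_def Let_def E_def[symmetric] I_def[symmetric] by (blast | fast)+

lemma initial_shock_front_pos:
  "initial_shock_front N\<^sub>1 \<eta> \<tau> \<zeta> chi\<^sub>0 chi\<^sub>1 N\<^sub>0 s \<Longrightarrow> s > 0"
  by (simp add: initial_shock_front_def)

text \<open>Between two different fronts there is a point interior both to the region behind one
  front and to the region ahead of the other. The first fact puts the tension above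
  \<open>N\<^sub>1\<close>, the second below, while at an interior point of both regions the two
  values are the same limit.\<close>

lemma shock_front_not_less:
  assumes "shock_front N\<^sub>1 \<eta> \<tau> \<zeta> chi\<^sub>0 chi\<^sub>1 N\<^sub>0 T chi N \<sigma>"
    and "shock_front N\<^sub>1 \<eta> \<tau> \<zeta> chi\<^sub>0 chi\<^sub>1 N\<^sub>0 T chi N \<rho>" and "T > 0" "t \<in> {0..T}"
  shows "\<not> \<rho> t < \<sigma> t"
proof
  assume less: "\<rho> t < \<sigma> t"
  note \<sigma> = shock_frontD[OF assms(1)] and \<rho> = shock_frontD[OF assms(2)]
  have "continuous_on {0..T} (\<lambda>t. \<sigma> t - \<rho> t)" by (intro continuous_intros \<sigma>(2) \<rho>(2))
  then obtain t' where t': "0 < t'" "t' < T" "\<bar>(\<sigma> t' - \<rho> t') - (\<sigma> t - \<rho> t)\<bar> < \<sigma> t - \<rho> t"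
    using near_front_time[of T "\<lambda>t. \<sigma> t - \<rho> t" t "\<sigma> t - \<rho> t"] assms(3,4) less by auto
  hence lt: "\<rho> t' < \<sigma> t'" by linarith
  define p where "p = ((\<rho> t' + \<sigma> t') / 2, t')"
  have "\<rho> t' > 0"
    using \<rho>(4)[of t'] initial_shock_front_pos[OF \<rho>(1)] t' by auto
  hence I: "p \<in> interior (region_I {0..T} \<sigma>)"
    using lt t' by (simp add: interior_region_I[OF \<sigma>(2)] p_def)
  have E: "p \<in> interior (region_E {0..T} \<rho>)"
    using lt t' by (simp add: interior_region_E[OF \<rho>(2)] p_def)
  have "N\<^sub>1 < region_value (region_I {0..T} \<sigma>) N p"
    using \<sigma>(11)[of "fst p" "snd p"] subsetD[OF interior_subset I] by simp
  moreover have "region_value (region_E {0..T} \<rho>) N p < N\<^sub>1"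
    using \<rho>(7) subsetD[OF interior_subset E] by simp
  ultimately show False
    by (simp add: region_value_interior[OF I] region_value_interior[OF E])
qed

lemma shock_front_unique:
  assumes "shock_front N\<^sub>1 \<eta> \<tau> \<zeta> chi\<^sub>0 chi\<^sub>1 N\<^sub>0 T chi N \<sigma>"
    and "shock_front N\<^sub>1 \<eta> \<tau> \<zeta> chi\<^sub>0 chi\<^sub>1 N\<^sub>0 T chi N \<rho>" and "T > 0" "t \<in> {0..T}"
  shows "\<rho> t = \<sigma> t"
  using shock_front_not_less[OF assms] shock_front_not_less[OF assms(2,1,3,4)] by linarith

section \<open>D'Alembert's formula for an arbitrary solution\<close>

locale dalembert =
  fixes P Q F G F' G' :: "real \<Rightarrow> real"
  assumes P: "\<And>x. (P has_real_derivative F x) (at x)" and Q: "\<And>x. (Q has_real_derivative G x) (at x)"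
    and F: "\<And>x. (F has_real_derivative F' x) (at x)" and G: "\<And>x. (G has_real_derivative G' x) (at x)"
    and F': "continuous_on UNIV F'" and G': "continuous_on UNIV G'"
begin

lemma continuous: "continuous_on S P" "continuous_on S Q" "continuous_on S F" "continuous_on S G"
  "continuous_on S F'" "continuous_on S G'"
  by (rule DERIV_continuous_on[OF has_field_derivative_at_within[OF P]]
    DERIV_continuous_on[OF has_field_derivative_at_within[OF Q]]
    DERIV_continuous_on[OF has_field_derivative_at_within[OF F]]
    DERIV_continuous_on[OF has_field_derivative_at_within[OF G]]
    continuous_on_subset[OF F' subset_UNIV] continuous_on_subset[OF G' subset_UNIV])+

text \<open>The coefficient \<open>c\<close> makes this form closed under both partial derivatives:
  differentiating in t only changes its sign. One rule thus serves every order.\<close>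

lemma partials_wave:
  fixes c :: real
  assumes "\<And>x. (A has_real_derivative A' x) (at x)" "\<And>x. (B has_real_derivative B' x) (at x)"
  shows "partial_s (\<lambda>(s, t). A (s + t) + c * B (s - t)) = (\<lambda>(s, t). A' (s + t) + c * B' (s - t))"
    and "partial_t (\<lambda>(s, t). A (s + t) + c * B (s - t)) = (\<lambda>(s, t). A' (s + t) + (- c) * B' (s - t))"
    and "(\<lambda>(s, t). A (s + t) + c * B (s - t)) differentiable (at p)"
proof -
  have "((\<lambda>x. A (x + t) + c * B (x - t)) has_real_derivative A' (s + t) * 1 + c * (B' (s - t) * 1)) (at s)" for s t
    by (intro DERIV_add DERIV_cmult DERIV_chain2[OF assms(1)] DERIV_chain2[OF assms(2)])
      (auto intro!: derivative_eq_intros)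
  thus "partial_s (\<lambda>(s, t). A (s + t) + c * B (s - t)) = (\<lambda>(s, t). A' (s + t) + c * B' (s - t))"
    by (auto simp: partial_s_def fun_eq_iff dest: DERIV_imp_deriv)
  have "((\<lambda>x. A (s + x) + c * B (s - x)) has_real_derivative A' (s + t) * 1 + c * (B' (s - t) * (-1))) (at t)" for s t
    by (intro DERIV_add DERIV_cmult DERIV_chain2[OF assms(1)] DERIV_chain2[OF assms(2)])
      (auto intro!: derivative_eq_intros)
  thus "partial_t (\<lambda>(s, t). A (s + t) + c * B (s - t)) = (\<lambda>(s, t). A' (s + t) + (- c) * B' (s - t))"
    by (auto simp: partial_t_def fun_eq_iff dest: DERIV_imp_deriv)
  have "((\<lambda>p. fst p + snd p) has_derivative (\<lambda>h. fst h + snd h)) (at p)"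
    "((\<lambda>p. fst p - snd p) has_derivative (\<lambda>h. fst h - snd h)) (at p)" for p :: "real \<times> real"
    by (auto intro!: derivative_eq_intros)
  from has_derivative_compose[OF this(1) assms(1)[unfolded has_field_derivative_def]]
    has_derivative_compose[OF this(2) assms(2)[unfolded has_field_derivative_def]]
  have "((\<lambda>p. A (fst p + snd p)) differentiable (at p)) \<and> ((\<lambda>p. B (fst p - snd p)) differentiable (at p))"
    unfolding differentiable_def by blast
  thus "(\<lambda>(s, t). A (s + t) + c * B (s - t)) differentiable (at p)"
    unfolding case_prod_unfold by (intro differentiable_add differentiable_mult differentiable_const) auto
qed

lemma continuous_wave:
  fixes A B :: "real \<Rightarrow> real"
  assumes "\<And>S. continuous_on S A" "\<And>S. continuous_on S B"
  shows "continuous_on S (\<lambda>(s, t). A (s + t) + c * B (s - t) :: real)"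
  unfolding case_prod_beta
  by (intro continuous_intros continuous_on_compose2[OF assms(1)[of UNIV]]
    continuous_on_compose2[OF assms(2)[of UNIV]] continuous_on_fst continuous_on_snd subset_UNIV)

text \<open>The invariants chi_s + chi_t and chi_s - chi_t are carried back to time 0, where they
  equal 2 F and 2 G. This gives the first derivatives in the interior, differentiating there gives
  the second ones, and continuity of the waves extends all four formulas to the front and the
  initial line.\<close>

lemma solution_is_dalembert:
  assumes front: "shock_front N\<^sub>1 \<eta> \<tau> \<zeta> chi\<^sub>0 chi\<^sub>1 N\<^sub>0 T chi N \<sigma>" and T: "T > 0"
    and init: "\<And>x. \<sigma> 0 \<le> x \<Longrightarrow> chi\<^sub>0 x = P x + Q x"
      "\<And>x. \<sigma> 0 \<le> x \<Longrightarrow> region_value {\<sigma> 0..} chi\<^sub>1 x = F x - G x"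
    and p: "(s, t) \<in> region_E {0..T} \<sigma>"
  defines "E \<equiv> region_E {0..T} \<sigma>"
  shows "region_value E (partial_s chi) (s, t) = F (s + t) + G (s - t)"
    and "region_value E (partial_t chi) (s, t) = F (s + t) - G (s - t)"
    and "region_value E (partial_s (partial_s chi)) (s, t) = F' (s + t) + G' (s - t)"
    and "region_value E (partial_t (partial_s chi)) (s, t) = F' (s + t) - G' (s - t)"
proof -
  note * = shock_frontD[OF front, folded E_def]
  note int_E = interior_region_E[OF *(2), folded E_def]
  have slope: "v - u \<le> \<sigma> v - \<sigma> u" if "0 \<le> u" "u \<le> v" "v \<le> T" for u v
    using front_growth[OF *(2,3) less_imp_le[OF *(9)] that] by simp
  obtain g gs gt where g: "continuous_on E g" "\<And>p. p \<in> interior E \<Longrightarrow> chi p = g p"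
    and gs: "continuous_on E gs" "\<And>p. p \<in> interior E \<Longrightarrow> partial_s chi p = gs p"
    and gt: "continuous_on E gt" "\<And>p. p \<in> interior E \<Longrightarrow> partial_t chi p = gt p"
    using Ck_plane_2D(1-3)[OF *(5)] unfolding extends_continuously_def by metis
  have rv: "region_value E f q = h q" if "continuous_on E h" "\<And>p. p \<in> interior E \<Longrightarrow> f p = h p" "q \<in> E" for f h q
    using that by (intro region_value_eq closure_interior_region_E[OF *(2) T, folded E_def]) auto
  have wave: "partial_t (partial_t chi) p = partial_s (partial_s chi) p" if i: "p \<in> interior E" for p
  proof -
    have "extends_continuously E (partial_t (partial_t chi))" "extends_continuously E (partial_s (partial_s chi))"
      using *(5) by (simp_all add: numeral_2_eq_2)
    then obtain h k where "continuous_on E h" "\<And>p. p \<in> interior E \<Longrightarrow> partial_t (partial_t chi) p = h p"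
      "continuous_on E k" "\<And>p. p \<in> interior E \<Longrightarrow> partial_s (partial_s chi) p = k p"
      unfolding extends_continuously_def by metis
    thus ?thesis using rv[of h _ p] rv[of k _ p] *(12)[of p] i subsetD[OF interior_subset i] by metis
  qed
  have E0: "(x, 0) \<in> E" if "x \<ge> \<sigma> 0" for x using that T by (simp add: E_def region_E_def)
  \<comment> \<open>At time 0 chi_t is prescribed, but chi_s has to be recovered from the initial
    position. This works strictly ahead of \<open>\<sigma> 0\<close>, which suffices because
    interior points trace back to such positions.\<close>
  have gs0: "gs (x, 0) = F x + G x" if "x > \<sigma> 0" for x
  proof -
    have "((\<lambda>x. P x + Q x) has_real_derivative gs (x, 0)) (at x)"
    proof (rule initial_slope[OF *(2) T, folded E_def, of g gs chi])
      show "g (y, 0) = P y + Q y" if "\<sigma> 0 \<le> y" for y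
        using rv[OF g(1,2) E0[OF that]] *(13)[OF that] init(1)[OF that] by simp
    qed (use g gs Ck_plane_2D(4)[OF *(5)] that in auto)
    thus ?thesis using DERIV_unique DERIV_add[OF P Q] by blast
  qed
  have gt0: "gt (x, 0) = F x - G x" if "x \<ge> \<sigma> 0" for x
    using rv[OF gt(1,2) E0[OF that]] *(14)[OF that] init(2)[OF that] by simp
  have key: "partial_s chi (s, t) = F (s + t) + 1 * G (s - t)"
    "partial_t chi (s, t) = F (s + t) + (-1) * G (s - t)"
    if "0 < t" "t < T" "\<sigma> t < s" for s t
  proof -
    note w = wave_invariant[OF *(2) slope *(5)[unfolded E_def] wave[unfolded E_def] gs[unfolded E_def]
      gt[unfolded E_def] that]
    have s: "s + t > \<sigma> 0" "s - t > \<sigma> 0" using slope[of 0 t] that by auto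
    have "gs (s, t) + gt (s, t) = 2 * F (s + t)" using w[of 1] gs0[OF s(1)] gt0[of "s + t"] s by simp
    moreover have "gs (s, t) - gt (s, t) = 2 * G (s - t)" using w[of "-1"] gs0[OF s(2)] gt0[of "s - t"] s by simp
    moreover have "(s, t) \<in> interior E" using that int_E by simp
    ultimately show "partial_s chi (s, t) = F (s + t) + 1 * G (s - t)"
      "partial_t chi (s, t) = F (s + t) + (-1) * G (s - t)"
      using gs(2) gt(2) by auto
  qed
  note reg = region_value_E[OF *(2) T _ _ p, folded E_def]
  show "region_value E (partial_s chi) (s, t) = F (s + t) + G (s - t)"
    using reg[OF continuous_wave[where A = F and B = G and c = 1], of "partial_s chi"] key(1) continuous by simp
  show "region_value E (partial_t chi) (s, t) = F (s + t) - G (s - t)"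
    using reg[OF continuous_wave[where A = F and B = G and c = "-1"], of "partial_t chi"] key(2) continuous by simp
  have first: "partial_s chi p = (\<lambda>(s, t). F (s + t) + 1 * G (s - t)) p" if "p \<in> interior E" for p
    using key(1) that by (auto simp: int_E)
  have second: "partial_s (partial_s chi) (s, t) = F' (s + t) + 1 * G' (s - t)"
    "partial_t (partial_s chi) (s, t) = F' (s + t) + (-1) * G' (s - t)"
    if "0 < t" "t < T" "\<sigma> t < s" for s t
  proof -
    have "(s, t) \<in> interior E" using that by (simp add: int_E)
    from partials_cong[OF open_interior first this]
    show "partial_s (partial_s chi) (s, t) = F' (s + t) + 1 * G' (s - t)"
      "partial_t (partial_s chi) (s, t) = F' (s + t) + (-1) * G' (s - t)"
      by (simp_all only: partials_wave[OF F G] prod.case)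
  qed
  show "region_value E (partial_s (partial_s chi)) (s, t) = F' (s + t) + G' (s - t)"
    using reg[OF continuous_wave[where A = F' and B = G' and c = 1], of "partial_s (partial_s chi)"] second(1) continuous by simp
  show "region_value E (partial_t (partial_s chi)) (s, t) = F' (s + t) - G' (s - t)"
    using reg[OF continuous_wave[where A = F' and B = G' and c = "-1"], of "partial_t (partial_s chi)"] second(2) continuous by simp
qed

end

section \<open>Construction of the front\<close>

text \<open>The margin \<open>m\<close> makes two strict inequalities uniform. The arguments in
  \<open>tension\<close> are independent because F is taken at s + t and G at s - t. The assumption
  \<open>fast\<close> says that the speed (F - G) / (\<open>N\<^sub>1\<close> - F - G) exceeds 1:
  clearing the denominator cancels G.\<close>

locale front_data = dalembert +
  fixes N\<^sub>1 \<eta> a m :: real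
  assumes a: "a > 0" and m: "m > 0"
    and tension: "\<And>x y. a \<le> x \<Longrightarrow> a \<le> y \<Longrightarrow> \<eta> < F x + G y" "\<And>x y. a \<le> x \<Longrightarrow> a \<le> y \<Longrightarrow> F x + G y \<le> N\<^sub>1 - m"
    and fast: "\<And>x. a \<le> x \<Longrightarrow> N\<^sub>1 + m \<le> 2 * F x"
    and start: "P a + Q a = N\<^sub>1 * a"
begin

definition gap :: "real \<Rightarrow> real \<Rightarrow> real" where
  "gap t s = N\<^sub>1 * s - P (s + t) - Q (s - t)"

text \<open>The s-derivative of the gap is \<open>N\<^sub>1\<close> minus the tension, which is at
  least \<open>m\<close>.\<close>

lemma gap_growth:
  assumes "0 \<le> t" "a + t \<le> s" "s \<le> s'"
  shows "m * (s' - s) \<le> gap t s' - gap t s"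
proof (cases "s = s'")
  case False
  have "(gap t has_real_derivative N\<^sub>1 - F (x + t) - G (x - t)) (at x)" for x
    unfolding gap_def
    by (rule derivative_eq_intros DERIV_chain2[OF P] DERIV_chain2[OF Q] | simp)+
  then obtain z where z: "s < z" "z < s'" "gap t s' - gap t s = (s' - s) * (N\<^sub>1 - F (z + t) - G (z - t))"
    using MVT2[of s s' "gap t"] False assms(3) by force
  have "m \<le> N\<^sub>1 - F (z + t) - G (z - t)" using tension(2)[of "z + t" "z - t"] z assms by simp
  thus ?thesis using z assms(3) by (simp add: mult.commute mult_left_mono)
qed simp

lemma P_growth:
  assumes "a \<le> x" "0 \<le> h"
  shows "(N\<^sub>1 + m) * h \<le> P (x + 2 * h) - P x"
proof (cases "h = 0")
  case False
  then obtain z where z: "x < z" "P (x + 2 * h) - P x = (x + 2 * h - x) * F z"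
    using MVT2[of x "x + 2 * h" P F] P assms by force
  thus ?thesis using fast[of z] mult_right_mono[of "N\<^sub>1 + m" "2 * F z" h] assms by (simp add: mult.commute mult.left_commute)
qed simp

lemma front_exists:
  assumes "0 \<le> t"
  shows "\<exists>!s. a + t \<le> s \<and> gap t s = 0"
proof -
  \<comment> \<open>At s = a + t the argument of Q is \<open>a\<close> for every t, so
    \<open>start\<close> eliminates Q and the rest is controlled by \<open>fast\<close>.\<close>
  have "gap t (a + t) = N\<^sub>1 * t - (P (a + 2 * t) - P a)"
    using start by (simp add: gap_def algebra_simps)
  hence neg: "gap t (a + t) \<le> 0"
    using P_growth[OF order_refl assms] mult_nonneg_nonneg[OF less_imp_le[OF m] assms]
    unfolding distrib_right by linarith
  \<comment> \<open>The zero of the line of slope \<open>m\<close> through the value at a + t; the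
    gap grows at least as fast as this line.\<close>
  define s where "s = a + t - gap t (a + t) / m"
  have s: "a + t \<le> s" using neg m by (simp add: s_def divide_nonpos_pos)
  have "m * (s - (a + t)) = - gap t (a + t)" using m by (simp add: s_def)
  hence "0 \<le> gap t s" using gap_growth[OF assms order_refl s] by simp
  moreover have "continuous_on {a + t..s} (gap t)"
    unfolding gap_def by (intro continuous_intros continuous_on_compose2[OF continuous(1)[of UNIV]]
      continuous_on_compose2[OF continuous(2)[of UNIV]] subset_UNIV)
  ultimately obtain x where x: "a + t \<le> x" "gap t x = 0"
    using IVT'[of "gap t" "a + t" 0 s] neg s by auto
  show ?thesis
  proof (rule ex1I[of _ x])
    fix y assume y: "a + t \<le> y \<and> gap t y = 0"
    have "m * (y - x) \<le> 0 \<or> x > y" "m * (x - y) \<le> 0 \<or> y > x"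
      using gap_growth[OF assms, of x y] gap_growth[OF assms, of y x] x y by auto
    thus "y = x" using m by (auto simp: mult_le_0_iff)
  qed (use x in simp)
qed

text \<open>For t < 0 the front is frozen at its initial position. This makes it continuous on the
  whole line, so that preimages of open sets are open.\<close>

definition front :: "real \<Rightarrow> real" where
  "front t = (THE s. a + max 0 t \<le> s \<and> gap (max 0 t) s = 0)"

lemma front:
  assumes "0 \<le> t"
  shows "a + t \<le> front t" "gap t (front t) = 0"
  using theI'[OF front_exists[OF assms]] assms by (simp_all add: front_def max_def)

lemma front_unique:
  assumes "0 \<le> t" "a + t \<le> s" "gap t s = 0"
  shows "front t = s"
  using front_exists[OF assms(1)] front[OF assms(1)] assms(2,3) by blast

lemma front_0: "front 0 = a"
  using start by (intro front_unique) (auto simp: gap_def)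

definition wave_bound :: real where
  "wave_bound = \<bar>\<eta>\<bar> + \<bar>N\<^sub>1\<bar> + \<bar>G a\<bar> + \<bar>F a\<bar>"

lemma wave_bound_nonneg: "0 \<le> wave_bound"
  by (simp add: wave_bound_def)

text \<open>Setting one of the two arguments in \<open>tension\<close> to \<open>a\<close> bounds F
  and G separately.\<close>

lemma waves_bounded:
  assumes "a \<le> x"
  shows "\<bar>F x\<bar> \<le> wave_bound" "\<bar>G x\<bar> \<le> wave_bound"
  using tension(1)[OF assms order_refl] tension(2)[OF assms order_refl]
    tension(1)[OF order_refl assms] tension(2)[OF order_refl assms] m
  unfolding wave_bound_def by linarith+

text \<open>The old front position is moved along the characteristic s - t = const, which leaves Q
  unchanged. At the point reached, the gap is \<open>N\<^sub>1 * h\<close> minus an increment of P.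
  It is nonpositive, so the new root is not to the left, and its size divided by \<open>m\<close>
  limits the distance to the root. The resulting Lipschitz bound gives continuity of the front, on
  which its differentiability is built.\<close>

lemma front_advance:
  assumes "0 \<le> t" "t \<le> t'"
  shows "t' - t \<le> front t' - front t"
    and "front t' - front t \<le> (1 + 2 * wave_bound / m + \<bar>N\<^sub>1\<bar> / m) * (t' - t)"
proof -
  define h where "h = t' - t"
  have h: "0 \<le> h" using assms by (simp add: h_def)
  note f = front[OF assms(1)] and f' = front[of t'] 
  have t': "0 \<le> t'" using assms by simp
  define x where "x = front t + t"
  have x: "a \<le> x" using f assms by (simp add: x_def)
  have gap_eq: "gap t' (front t + h) = N\<^sub>1 * h - (P (x + 2 * h) - P x)"
    using f(2) by (simp add: gap_def h_def x_def algebra_simps)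
  have le0: "gap t' (front t + h) \<le> 0"
    using gap_eq P_growth[OF x h] mult_nonneg_nonneg[OF less_imp_le[OF m] h]
    unfolding distrib_right by linarith
  have s0: "a + t' \<le> front t + h" using f(1) by (simp add: h_def)
  show 1: "t' - t \<le> front t' - front t"
  proof (rule ccontr)
    assume "\<not> t' - t \<le> front t' - front t"
    hence "front t' < front t + h" by (simp add: h_def)
    moreover from this have "m * (front t + h - front t') \<le> gap t' (front t + h) - gap t' (front t')"
      using f'(1)[OF t'] by (intro gap_growth t') auto
    ultimately have "m * (front t + h - front t') \<le> 0" using le0 f'(2)[OF t'] by simp
    thus False using \<open>front t' < front t + h\<close> m by (simp add: mult_le_0_iff)
  qed
  have "m * (front t' - (front t + h)) \<le> gap t' (front t') - gap t' (front t + h)"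
    using 1 s0 by (intro gap_growth t') (auto simp: h_def)
  hence "m * (front t' - (front t + h)) \<le> (P (x + 2 * h) - P x) - N\<^sub>1 * h"
    using f'(2)[OF t'] gap_eq by simp
  moreover have "P (x + 2 * h) - P x \<le> 2 * h * wave_bound"
  proof (cases "h = 0")
    case False
    then obtain z where z: "x < z" "P (x + 2 * h) - P x = (x + 2 * h - x) * F z"
      using MVT2[of x "x + 2 * h" P F] P h by force
    have "F z \<le> wave_bound" using waves_bounded(1)[of z] z x by simp
    thus ?thesis using z h mult_left_mono[of "F z" wave_bound "2 * h"] by simp
  qed simp
  moreover have "- (N\<^sub>1 * h) \<le> \<bar>N\<^sub>1\<bar> * h" using h mult_right_mono[of "- N\<^sub>1" "\<bar>N\<^sub>1\<bar>" h] by simp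
  ultimately have "m * (front t' - (front t + h)) \<le> (2 * wave_bound + \<bar>N\<^sub>1\<bar>) * h" by (simp add: algebra_simps)
  hence "front t' - (front t + h) \<le> (2 * wave_bound + \<bar>N\<^sub>1\<bar>) * h / m" using m by (simp add: field_simps)
  thus "front t' - front t \<le> (1 + 2 * wave_bound / m + \<bar>N\<^sub>1\<bar> / m) * (t' - t)"
    unfolding h_def[symmetric] by (simp add: add_divide_distrib algebra_simps)
qed

lemma front_max: "front (max 0 t) = front t"
  by (simp add: front_def)

lemma continuous_front: "continuous_on S front"
proof -
  define L where "L = 1 + 2 * wave_bound / m + \<bar>N\<^sub>1\<bar> / m"
  have L: "L \<ge> 0" using m wave_bound_nonneg by (simp add: L_def)
  have 1: "dist (front t) (front t') \<le> L * dist t t'" if "0 \<le> t" "t \<le> t'" for t t'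
    using front_advance[OF that] that by (simp add: dist_real_def L_def)
  have 2: "dist (front t) (front t') \<le> L * dist t t'" if "0 \<le> t" "0 \<le> t'" for t t'
    using 1[of t t'] 1[of t' t] that by (cases "t \<le> t'") (auto simp: dist_commute)
  have "L-lipschitz_on {0..} front" using 2 L by (auto intro: lipschitz_onI)
  hence c: "continuous_on {0..} front" by (rule lipschitz_on_continuous_on)
  have "continuous_on S (\<lambda>t. front (max 0 t))"
    by (intro continuous_on_compose2[OF c] continuous_intros) auto
  thus ?thesis by (simp add: front_max)
qed

definition ahead :: "real \<Rightarrow> real" where "ahead t = F (front t + t) + G (front t - t)"

definition speed :: "real \<Rightarrow> real" where "speed t = (F (front t + t) - G (front t - t)) / (N\<^sub>1 - ahead t)"

definition behind :: "real \<Rightarrow> real" where "behind t = ahead t + (speed t)\<^sup>2 * (N\<^sub>1 - ahead t)"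

lemma ahead: "0 \<le> t \<Longrightarrow> m \<le> N\<^sub>1 - ahead t"
  using tension(2)[of "front t + t" "front t - t"] front(1)[of t] by (simp add: ahead_def)

lemma speed_gt_1: "0 \<le> t \<Longrightarrow> 1 < speed t"
  using ahead[of t] fast[of "front t + t"] front(1)[of t] m
  by (simp add: speed_def ahead_def less_divide_eq)

lemma behind_gt: "0 \<le> t \<Longrightarrow> N\<^sub>1 < behind t"
proof -
  assume t: "0 \<le> t"
  have "1 < (speed t)\<^sup>2" using speed_gt_1[OF t] by (simp add: one_less_power)
  hence "1 * (N\<^sub>1 - ahead t) < (speed t)\<^sup>2 * (N\<^sub>1 - ahead t)"
    using ahead[OF t] m by (intro mult_strict_right_mono) auto
  thus ?thesis by (simp add: behind_def)
qed

text \<open>Implicit differentiation. With Caratheodory's form of the derivatives of P and Q,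
  subtracting the root equations at z and t yields an exact formula for the difference quotient of
  the front. Continuity of the front gives its limit, as the denominator tends to a positive
  number.\<close>

lemma DERIV_front:
  assumes t: "0 < t"
  shows "(front has_real_derivative speed t) (at t)"
proof -
  obtain p where p: "\<And>z. P z - P (front t + t) = p z * (z - (front t + t))" "isCont p (front t + t)" "p (front t + t) = F (front t + t)"
    using P[of "front t + t"] unfolding CARAT_DERIV by blast
  obtain q where q: "\<And>z. Q z - Q (front t - t) = q z * (z - (front t - t))" "isCont q (front t - t)" "q (front t - t) = G (front t - t)"
    using Q[of "front t - t"] unfolding CARAT_DERIV by blast
  define u v where "u z = p (front z + z)" and "v z = q (front z - z)" for z
  have "isCont front t" using continuous_front[of UNIV] by (simp add: continuous_on_eq_continuous_at)
  hence uv: "isCont u t" "isCont v t"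
    unfolding u_def v_def 
    by (intro isCont_o2[where f = "\<lambda>z. front z + z" and g = p]
        isCont_o2[where f = "\<lambda>z. front z - z" and g = q] p(2) q(2) isCont_add isCont_diff continuous_ident; assumption)+
  have at_t: "u t = F (front t + t)" "v t = G (front t - t)" using p q by (simp_all add: u_def v_def)
  have pos: "N\<^sub>1 - u t - v t > 0" using ahead[of t] m t by (simp add: at_t ahead_def)
  have "isCont (\<lambda>z. N\<^sub>1 - u z - v z) t" by (intro continuous_intros uv)
  hence ev: "eventually (\<lambda>z. N\<^sub>1 - u z - v z > 0) (at t)"
    unfolding isCont_def by (rule order_tendstoD(1)[OF _ pos])
  have "((\<lambda>z. (u z - v z) / (N\<^sub>1 - u z - v z)) \<longlongrightarrow> (u t - v t) / (N\<^sub>1 - u t - v t)) (at t)"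
    using uv pos by (intro tendsto_intros) (auto simp: isCont_def)
  moreover have "eventually (\<lambda>z. (u z - v z) / (N\<^sub>1 - u z - v z) = (front z - front t) / (z - t)) (at t)"
  proof -
    have "eventually (\<lambda>z. z > 0) (at t)"
      by (rule order_tendstoD(1)[OF tendsto_ident_at t])
    moreover have "eventually (\<lambda>z. z \<noteq> t) (at t)" by (simp add: eventually_at_filter)
    ultimately show ?thesis using ev
    proof eventually_elim
      case (elim z)
      have "N\<^sub>1 * (front z - front t) = u z * ((front z - front t) + (z - t)) + v z * ((front z - front t) - (z - t))"
        using front(2)[of z] front(2)[of t] elim t p(1)[of "front z + z"] q(1)[of "front z - z"]
        by (simp add: gap_def u_def v_def algebra_simps)
      hence "(front z - front t) * (N\<^sub>1 - u z - v z) = (u z - v z) * (z - t)"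
        by (simp add: algebra_simps)
      thus ?case using elim by (simp add: frac_eq_eq mult.commute)
    qed
  qed
  ultimately have "((\<lambda>z. (front z - front t) / (z - t)) \<longlongrightarrow> (u t - v t) / (N\<^sub>1 - u t - v t)) (at t)"
    by (rule Lim_transform_eventually)
  moreover have "(u t - v t) / (N\<^sub>1 - u t - v t) = speed t" by (simp add: speed_def ahead_def at_t algebra_simps)
  ultimately show ?thesis by (simp add: has_field_derivative_iff)
qed

definition slope_F :: "real \<Rightarrow> real" where "slope_F t = F' (front t + t) * (speed t + 1)"
definition slope_G :: "real \<Rightarrow> real" where "slope_G t = G' (front t - t) * (speed t - 1)"

definition acceleration :: "real \<Rightarrow> real" where
  "acceleration t = ((slope_F t - slope_G t) * (N\<^sub>1 - ahead t)
     + (F (front t + t) - G (front t - t)) * (slope_F t + slope_G t)) / (N\<^sub>1 - ahead t)\<^sup>2"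

lemma DERIV_speed:
  assumes t: "0 < t"
  shows "(speed has_real_derivative acceleration t) (at t)"
proof -
  have x: "((\<lambda>t. F (front t + t)) has_real_derivative slope_F t) (at t)"
    unfolding slope_F_def by (intro DERIV_chain2[OF F] DERIV_add DERIV_front[OF t] DERIV_ident)
  have y: "((\<lambda>t. G (front t - t)) has_real_derivative slope_G t) (at t)"
    unfolding slope_G_def by (intro DERIV_chain2[OF G] DERIV_diff DERIV_front[OF t] DERIV_ident)
  have "N\<^sub>1 - ahead t \<noteq> 0" using ahead[of t] t m by simp
  from DERIV_divide[OF DERIV_diff[OF x y] DERIV_diff[OF DERIV_const DERIV_add[OF x y]] this[unfolded ahead_def]]
  have "((\<lambda>t. (F (front t + t) - G (front t - t)) / (N\<^sub>1 - ahead t)) has_real_derivative acceleration t) (at t)"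
    unfolding ahead_def by (rule DERIV_cong) (simp add: acceleration_def ahead_def power2_eq_square algebra_simps)
  thus ?thesis unfolding speed_def[abs_def] .
qed

text \<open>Being constant before t = 0, \<open>front\<close> has a corner there. The formulas for
  its derivatives are still continuous from the right, as \<open>Ck_line 2\<close> on
  \<open>{0..T}\<close> asks.\<close>

lemma continuous_ahead: "continuous_on {0..} ahead"
  and continuous_speed: "continuous_on {0..} speed"
  and continuous_acceleration: "continuous_on {0..} acceleration"
  and continuous_behind: "continuous_on {0..} behind"
proof -
  have c: "continuous_on {0..} (\<lambda>t. A (front t + t))" "continuous_on {0..} (\<lambda>t. A (front t - t))"
    if "continuous_on UNIV A" for A :: "real \<Rightarrow> real"
    by (intro continuous_on_compose2[OF that] continuous_intros continuous_front subset_UNIV)+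
  note [continuous_intros] = c[OF continuous(3)] c[OF continuous(4)] c[OF continuous(5)] c[OF continuous(6)]
  show 1: "continuous_on {0..} ahead" unfolding ahead_def by (intro continuous_intros)
  have nz: "\<forall>t\<in>{0..}. N\<^sub>1 - ahead t \<noteq> 0" using ahead m by fastforce
  show 2: "continuous_on {0..} speed" unfolding speed_def by (intro continuous_intros 1 nz)
  show "continuous_on {0..} acceleration"
    unfolding acceleration_def slope_F_def slope_G_def
    using nz by (intro continuous_intros 1 2) auto
  show "continuous_on {0..} behind" unfolding behind_def by (intro continuous_intros 1 2)
qed

end

lemma Ck_line_2I:
  assumes "continuous_on S f" "continuous_on S f1" "continuous_on S f2"
    and "\<And>x. x \<in> interior S \<Longrightarrow> (f has_real_derivative f1 x) (at x)"
    and "\<And>x. x \<in> interior S \<Longrightarrow> (f1 has_real_derivative f2 x) (at x)"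
  shows "Ck_line 2 S f"
proof -
  have 1: "deriv f x = f1 x" if "x \<in> interior S" for x
    using assms(4)[OF that] by (rule DERIV_imp_deriv)
  have 2: "(deriv f has_real_derivative f2 x) (at x)" if "x \<in> interior S" for x
    using has_field_derivative_transform_within_open[OF assms(5)[OF that] open_interior that] 1 by metis
  have "deriv (deriv f) x = f2 x" if "x \<in> interior S" for x
    using 2[OF that] by (rule DERIV_imp_deriv)
  hence "extends_continuously S f" "extends_continuously S (deriv f)" "extends_continuously S (deriv (deriv f))"
    using assms(1-3) 1 by (auto simp: extends_continuously_def)
  moreover have "f differentiable (at x)" "deriv f differentiable (at x)" if "x \<in> interior S" for x
    using assms(4)[OF that] 2[OF that] by (auto simp: real_differentiable_def)
  ultimately show ?thesis by (simp add: numeral_2_eq_2)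
qed

lemma L_infinity_If:
  fixes f g h k :: "'a::euclidean_space \<Rightarrow> real"
  assumes S: "S \<in> sets lebesgue"
    and c: "continuous_on S f" "continuous_on S g" "continuous_on S h" "continuous_on S k"
    and b: "\<And>p. p \<in> S \<Longrightarrow> h p \<le> k p \<Longrightarrow> \<bar>f p\<bar> \<le> M" "\<And>p. p \<in> S \<Longrightarrow> k p < h p \<Longrightarrow> \<bar>g p\<bar> \<le> M"
  shows "L_infinity S (\<lambda>p. if h p \<le> k p then f p else g p)"
  unfolding L_infinity_def
proof
  note meas = c[THEN continuous_imp_measurable_on_sets_lebesgue, OF S]
  show "(\<lambda>p. if h p \<le> k p then f p else g p) \<in> borel_measurable (lebesgue_on S)"
    by (intro measurable_If meas(1,2) borel_measurable_le meas(3,4))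
  have "AE p in lebesgue_on S. \<bar>if h p \<le> k p then f p else g p\<bar> \<le> M"
    using b by (intro AE_I2) auto
  thus "\<exists>M. AE p in lebesgue_on S. \<bar>if h p \<le> k p then f p else g p\<bar> \<le> M" ..
qed

section \<open>The constructed solution\<close>

context front_data
begin

text \<open>The front itself belongs to the part at rest, since a shock front requires chi (s, t) =
  \<open>N\<^sub>1 * s\<close> at every point of the closed region behind it.\<close>

definition motion :: "real \<times> real \<Rightarrow> real" where
  "motion = (\<lambda>p. if fst p \<le> front (snd p) then N\<^sub>1 * fst p else P (fst p + snd p) + Q (fst p - snd p))"

definition motion_t :: "real \<times> real \<Rightarrow> real" where
  "motion_t = (\<lambda>p. if fst p \<le> front (snd p) then 0 else F (fst p + snd p) - G (fst p - snd p))"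

definition stress :: "real \<times> real \<Rightarrow> real" where
  "stress = (\<lambda>p. if fst p \<le> front (snd p) then behind (snd p) else F (fst p + snd p) + G (fst p - snd p))"

lemma continuous_compose_wave:
  "continuous_on UNIV A \<Longrightarrow> continuous_on S (\<lambda>p::real \<times> real. A (fst p + snd p) :: real)"
  "continuous_on UNIV A \<Longrightarrow> continuous_on S (\<lambda>p::real \<times> real. A (fst p - snd p) :: real)"
  "continuous_on S (\<lambda>p::real \<times> real. front (snd p))"
  by (rule continuous_on_compose2, assumption | intro continuous_intros subset_UNIV continuous_on_compose2[OF continuous_front[of UNIV]])+

lemma strip_measurable: "{0..} \<times> {0..T} \<in> sets (lebesgue :: (real \<times> real) measure)"
  by (intro sets_completionI_sets) (auto intro!: borel_closed closed_Times)

lemma front_pos: "0 \<le> t \<Longrightarrow> front t > 0"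
  using front(1)[of t] a by linarith

lemma continuous_motion: "continuous_on ({0..} \<times> {0..T}) motion"
proof -
  \<comment> \<open>Continuity across the front is the root equation of the gap.\<close>
  have jump: "N\<^sub>1 * fst p = P (fst p + snd p) + Q (fst p - snd p)"
    if "0 \<le> snd p" "fst p = front (snd p)" for p :: "real \<times> real"
    using front(2)[OF that(1)] that(2) by (simp add: gap_def)
  have "continuous_on ({0..} \<times> {0..T}) (\<lambda>p. if fst p - front (snd p) \<le> 0 then N\<^sub>1 * fst p
      else P (fst p + snd p) + Q (fst p - snd p))"
  proof (rule continuous_on_cases_le)
    show "continuous_on {p \<in> {0..} \<times> {0..T}. 0 \<le> fst p - front (snd p)} (\<lambda>p. P (fst p + snd p) + Q (fst p - snd p))"
      by (intro continuous_on_add continuous_compose_wave continuous)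
    show "continuous_on ({0..} \<times> {0..T}) (\<lambda>p. fst p - front (snd p))"
      by (intro continuous_on_diff continuous_on_fst continuous_on_id continuous_compose_wave)
  qed (use jump in \<open>auto intro!: continuous_intros\<close>)
  thus ?thesis by (simp add: motion_def)
qed

lemma ahead_strip:
  assumes "p \<in> {0..} \<times> {0..T}" "front (snd p) < fst p"
  shows "a \<le> fst p + snd p" "a \<le> fst p - snd p"
  using assms front(1)[of "snd p"] by auto

lemma L_infinity_motion_t: "L_infinity ({0..} \<times> {0..T}) motion_t"
  unfolding motion_t_def
proof (rule L_infinity_If)
  show "\<bar>F (fst p + snd p) - G (fst p - snd p)\<bar> \<le> 2 * wave_bound"
    if "p \<in> {0..} \<times> {0..T}" "front (snd p) < fst p" for p
    using waves_bounded(1)[OF ahead_strip(1)[OF that]] waves_bounded(2)[OF ahead_strip(2)[OF that]] by linarith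
qed (use wave_bound_nonneg in \<open>auto intro!: strip_measurable continuous_intros continuous_compose_wave continuous\<close>)

lemma L_infinity_stress: "L_infinity ({0..} \<times> {0..T}) stress"
proof -
  have "compact (behind ` {0..T})"
    by (intro compact_continuous_image continuous_on_subset[OF continuous_behind]) auto
  then obtain M where M: "\<And>t. t \<in> {0..T} \<Longrightarrow> \<bar>behind t\<bar> \<le> M"
    using compact_imp_bounded[of "behind ` {0..T}"] unfolding bounded_iff by fastforce
  show ?thesis unfolding stress_def
  proof (rule L_infinity_If)
    show "\<bar>behind (snd p)\<bar> \<le> max M (2 * wave_bound)" if "p \<in> {0..} \<times> {0..T}" for p
      using M[of "snd p"] that by auto
    show "\<bar>F (fst p + snd p) + G (fst p - snd p)\<bar> \<le> max M (2 * wave_bound)"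
      if "p \<in> {0..} \<times> {0..T}" "front (snd p) < fst p" for p
      using waves_bounded(1)[OF ahead_strip(1)[OF that]] waves_bounded(2)[OF ahead_strip(2)[OF that]] by linarith
    show "continuous_on ({0..} \<times> {0..T}) (\<lambda>p. behind (snd p))"
      by (intro continuous_on_compose2[OF continuous_behind] continuous_intros) auto
  qed (auto intro!: strip_measurable continuous_intros continuous_compose_wave continuous)
qed

lemma DERIV_motion_t:
  assumes "fst p \<noteq> front (snd p)"
  shows "((\<lambda>x. motion (fst p, x)) has_real_derivative motion_t p) (at (snd p))"
proof (cases "fst p < front (snd p)")
  case True
  show ?thesis
  proof (rule has_field_derivative_transform_within_open[of "\<lambda>x. N\<^sub>1 * fst p" _ _ "front -` {fst p<..}"])
    show "open (front -` {fst p<..})" by (intro open_vimage continuous_front) simp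
  qed (use True in \<open>auto simp: motion_def motion_t_def\<close>)
next
  case False
  show ?thesis
  proof (rule has_field_derivative_transform_within_open[of "\<lambda>x. P (fst p + x) + Q (fst p - x)" _ _ "front -` {..<fst p}"])
    show "open (front -` {..<fst p})" by (intro open_vimage continuous_front) simp
    have "((\<lambda>x. P (fst p + x) + Q (fst p - x)) has_real_derivative F (fst p + snd p) * 1 + G (fst p - snd p) * (-1)) (at (snd p))"
      by (intro DERIV_add DERIV_chain2[OF P] DERIV_chain2[OF Q]) (auto intro!: derivative_eq_intros)
    thus "((\<lambda>x. P (fst p + x) + Q (fst p - x)) has_real_derivative motion_t p) (at (snd p))"
      using False assms by (simp add: motion_t_def)
  qed (use False assms in \<open>auto simp: motion_def\<close>)
qed

text \<open>Over t > 0 the graph is a differentiable image of a null set, the half-line s = 0. At t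
  = 0 differentiability fails, and that time is covered by the null line t = 0.\<close>

lemma negligible_front: "negligible {p. 0 \<le> snd p \<and> fst p = front (snd p)}"
proof -
  let ?f = "\<lambda>p::real\<times>real. (front (snd p), snd p)"
  let ?A = "{p::real\<times>real. p \<bullet> (1, 0) = 0} \<inter> {p. 0 < snd p}"
  have basis: "(1, 0) \<in> (Basis :: (real\<times>real) set)" "(0, 1) \<in> (Basis :: (real\<times>real) set)"
    by (auto simp: Basis_prod_def)
  have "?f differentiable_on ?A"
    unfolding differentiable_on_def
  proof
    fix p assume "p \<in> ?A"
    hence "(front has_derivative (*) (speed (snd p))) (at (snd p))"
      using DERIV_front[of "snd p"] by (simp add: has_field_derivative_def)
    from has_derivative_compose[OF has_derivative_snd[OF has_derivative_ident] this]
    have "((\<lambda>p. front (snd p)) has_derivative (\<lambda>h. speed (snd p) * snd h)) (at p)" by simp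
    hence "(?f has_derivative (\<lambda>h. (speed (snd p) * snd h, snd h))) (at p)"
      by (intro has_derivative_Pair has_derivative_snd has_derivative_ident)
    thus "?f differentiable (at p within ?A)"
      unfolding differentiable_def by (blast intro: has_derivative_at_withinI)
  qed
  moreover have "negligible ?A"
    by (rule negligible_subset[OF negligible_standard_hyperplane[OF basis(1), of 0]]) auto
  ultimately have "negligible (?f ` ?A)"
    by (intro negligible_differentiable_image_negligible) auto
  moreover have "negligible {p::real\<times>real. p \<bullet> (0, 1) = 0}"
    by (rule negligible_standard_hyperplane[OF basis(2)])
  ultimately have "negligible (?f ` ?A \<union> {p. p \<bullet> (0, 1) = 0})" by (rule negligible_Un)
  moreover have "{p. 0 \<le> snd p \<and> fst p = front (snd p)} \<subseteq> ?f ` ?A \<union> {p. p \<bullet> (0, 1) = 0}"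
  proof
    fix p assume p: "p \<in> {p. 0 \<le> snd p \<and> fst p = front (snd p)}"
    show "p \<in> ?f ` ?A \<union> {p. p \<bullet> (0, 1) = 0}"
    proof (cases "snd p = 0")
      case False
      have "p = ?f (0, snd p)" using p by (simp add: prod_eq_iff)
      moreover have "(0, snd p) \<in> ?A" using False p by simp
      ultimately show ?thesis by blast
    qed (simp add: inner_prod_def)
  qed
  ultimately show ?thesis by (rule negligible_subset)
qed

lemma AE_DERIV_motion:
  "AE p in lebesgue_on ({0..} \<times> {0..T}). ((\<lambda>x. motion (fst p, x)) has_real_derivative motion_t p) (at (snd p))"
proof -
  have "AE p in lebesgue. p \<notin> {p. 0 \<le> snd p \<and> fst p = front (snd p)}"
    using negligible_front unfolding negligible_iff_null_sets by (rule AE_not_in)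
  hence "AE p in lebesgue. p \<in> {0..} \<times> {0..T} \<longrightarrow>
      ((\<lambda>x. motion (fst p, x)) has_real_derivative motion_t p) (at (snd p))"
    by (rule AE_mp) (auto intro!: AE_I2 DERIV_motion_t)
  moreover have "{0..} \<times> {0..T} \<inter> space lebesgue \<in> sets (lebesgue :: (real \<times> real) measure)"
    using strip_measurable by simp
  ultimately show ?thesis by (simp add: AE_restrict_space_iff)
qed

lemma shock_front_motion:
  assumes T: "T > 0" and init: "initial_shock_front N\<^sub>1 \<eta> \<tau> 0 chi\<^sub>0 chi\<^sub>1 N\<^sub>0 a"
    "\<And>x. a \<le> x \<Longrightarrow> chi\<^sub>0 x = P x + Q x" "\<And>x. a \<le> x \<Longrightarrow> region_value {a..} chi\<^sub>1 x = F x - G x"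
    and lim: "\<And>t. ((\<lambda>s. F (s + t) + G (s - t)) \<longlongrightarrow> \<tau>) at_top"
  shows "shock_front N\<^sub>1 \<eta> \<tau> 0 chi\<^sub>0 chi\<^sub>1 N\<^sub>0 T motion stress front"
proof -
  let ?J = "{0..T}" and ?E = "region_E {0..T} front" and ?I = "region_I {0..T} front"
  note cf = continuous_front[of ?J]
  note int_E = interior_region_E[OF cf]
  \<comment> \<open>The coefficients 1 and -1 are written out here and below so that the expressions
    have the shape required by \<open>partials_wave\<close>.\<close>
  have chi: "motion p = (\<lambda>(s, t). P (s + t) + 1 * Q (s - t)) p" if "p \<in> interior ?E" for p
    using that by (auto simp: int_E motion_def)
  have N: "stress p = (\<lambda>(s, t). F (s + t) + 1 * G (s - t)) p" if "p \<in> interior ?E" for p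
    using that by (auto simp: int_E stress_def)
  have d1: "partial_s motion p = (\<lambda>(s, t). F (s + t) + 1 * G (s - t)) p"
    "partial_t motion p = (\<lambda>(s, t). F (s + t) + (- 1) * G (s - t)) p" if "p \<in> interior ?E" for p
    using partials_cong[OF open_interior chi that] by (simp_all only: partials_wave[OF P Q])
  have d2: "partial_s (partial_s motion) p = (\<lambda>(s, t). F' (s + t) + 1 * G' (s - t)) p"
    "partial_t (partial_t motion) p = (\<lambda>(s, t). F' (s + t) + (- (- 1)) * G' (s - t)) p"
    if "p \<in> interior ?E" for p
    using partials_cong(1)[OF open_interior d1(1) that] partials_cong(2)[OF open_interior d1(2) that]
    by (simp_all only: partials_wave[OF F G])
  have ext: "extends_continuously ?E (\<lambda>(s, t). A (s + t) + c * B (s - t))"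
    if "\<And>S. continuous_on S A" "\<And>S. continuous_on S B" for A B :: "real \<Rightarrow> real" and c
    by (intro extends_continuouslyI continuous_wave that)
  have "Ck_plane 2 ?E (\<lambda>(s, t). P (s + t) + 1 * Q (s - t))" "Ck_plane 1 ?E (\<lambda>(s, t). F (s + t) + 1 * G (s - t))"
    unfolding numeral_2_eq_2 One_nat_def Ck_plane.simps partials_wave[OF P Q] partials_wave[OF F G]
    by (intro conjI ballI ext continuous partials_wave(3)[OF P Q] partials_wave(3)[OF F G])+
  hence C: "Ck_plane 2 ?E motion" "Ck_plane 1 ?E stress"
    by (simp_all only: Ck_plane_cong[of ?E motion, OF chi] Ck_plane_cong[of ?E stress, OF N])
  have rv: "region_value ?E f p = (\<lambda>(s, t). A (s + t) + c * B (s - t)) p"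
    if "\<And>p. p \<in> interior ?E \<Longrightarrow> f p = (\<lambda>(s, t). A (s + t) + c * B (s - t)) p" "p \<in> ?E"
      "\<And>S. continuous_on S A" "\<And>S. continuous_on S B" for f A B c p
    using that by (intro region_value_eq continuous_wave closure_interior_region_E[OF cf T]) auto
  have rv_chi: "region_value ?E motion (s, t) = P (s + t) + Q (s - t)" if "(s, t) \<in> ?E" for s t
    using rv[where f = "motion" and A = P and B = Q and c = "1", OF _ that continuous(1,2)] chi by simp
  have rv_N: "region_value ?E stress (s, t) = F (s + t) + G (s - t)" if "(s, t) \<in> ?E" for s t
    using rv[where f = "stress" and A = F and B = G and c = "1", OF _ that continuous(3,4)] N by simp
  have rv_s: "region_value ?E (partial_s motion) (s, t) = F (s + t) + G (s - t)" if "(s, t) \<in> ?E" for s t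
    using rv[where f = "partial_s motion" and A = F and B = G and c = "1", OF _ that continuous(3,4)] d1(1) by simp
  have rv_t: "region_value ?E (partial_t motion) (s, t) = F (s + t) - G (s - t)" if "(s, t) \<in> ?E" for s t
    using rv[where f = "partial_t motion" and A = F and B = G and c = "- 1", OF _ that continuous(3,4)] d1(2) by simp
  have rv_ss: "region_value ?E (partial_s (partial_s motion)) (s, t) = F' (s + t) + G' (s - t)" if "(s, t) \<in> ?E" for s t
    using rv[where f = "partial_s (partial_s motion)" and A = F' and B = G' and c = "1", OF _ that continuous(5,6)] d2(1) by simp
  have rv_tt: "region_value ?E (partial_t (partial_t motion)) (s, t) = F' (s + t) + G' (s - t)" if "(s, t) \<in> ?E" for s t
    using rv[where f = "partial_t (partial_t motion)" and A = F' and B = G' and c = "1", OF _ that continuous(5,6)] d2(2) by simp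
  have on_front: "(front t, t) \<in> ?E" if "t \<in> ?J" for t using that by (simp add: region_E_def)
  have waves_E: "a \<le> s + t" "a \<le> s - t" if "(s, t) \<in> ?E" for s t
    using that front(1)[of t] by (auto simp: region_E_def)
  have sp: "region_value ?J (deriv front) t = speed t" if "t \<in> ?J" for t
    using that T by (intro region_value_interval continuous_on_subset[OF continuous_speed] DERIV_imp_deriv DERIV_front) auto
  have np: "region_value ?E stress (front t, t) = ahead t" if "t \<in> ?J" for t
    using rv_N[OF on_front[OF that]] by (simp add: ahead_def)
  have cb: "continuous_on ?I (\<lambda>p. behind (snd p))"
    by (intro continuous_on_compose2[OF continuous_behind] continuous_intros) (auto simp: region_I_def)
  have fpos: "0 < front t" if "t \<in> ?J" for t using front_pos that by simp
  have stress_I: "stress p = behind (snd p)" if "p \<in> ?I" for p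
    using that by (auto simp: stress_def region_I_def)
  have rv_I: "region_value ?I stress p = behind (snd p)" if "p \<in> ?I" for p
    by (rule region_value_eq[OF cb _ that closure_interior_region_I[OF cf T that fpos]])
      (use stress_I interior_subset in blast)+
  have 1: "initial_shock_front N\<^sub>1 \<eta> \<tau> 0 chi\<^sub>0 chi\<^sub>1 N\<^sub>0 (front 0)" using init(1) by (simp add: front_0)
  have 2: "Ck_line 2 ?J front"
    by (rule Ck_line_2I[OF cf continuous_on_subset[OF continuous_speed] continuous_on_subset[OF continuous_acceleration]])
      (use DERIV_front DERIV_speed in auto)
  have 3: "\<forall>t\<in>?J. front 0 \<le> front t" using front(1) by (force simp: front_0)
  have 4: "\<forall>p\<in>?E. region_value ?E stress p = region_value ?E (partial_s motion) p \<and>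
      \<eta> < region_value ?E stress p \<and> region_value ?E stress p < N\<^sub>1"
  proof
    fix p assume "p \<in> ?E"
    then obtain s t where p: "p = (s, t)" "(s, t) \<in> ?E" by (cases p) auto
    show "region_value ?E stress p = region_value ?E (partial_s motion) p \<and>
        \<eta> < region_value ?E stress p \<and> region_value ?E stress p < N\<^sub>1"
      using tension[OF waves_E[OF p(2)]] m by (simp add: p rv_N[OF p(2)] rv_s[OF p(2)])
  qed
  have 5: "\<forall>t\<in>?J. region_value ?E motion (front t, t) = N\<^sub>1 * front t"
    using front(2) by (auto simp: rv_chi on_front gap_def algebra_simps)
  have 6: "\<forall>t\<in>?J. region_value ?J (deriv front) t =
      region_value ?E (partial_t motion) (front t, t) / (N\<^sub>1 - region_value ?E stress (front t, t)) \<and>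
      1 < region_value ?J (deriv front) t"
    using speed_gt_1 by (simp add: sp np rv_t on_front speed_def)
  have "\<forall>p\<in>interior ?I. stress p = behind (snd p)" using stress_I interior_subset by blast
  with cb have 7: "Ck_plane 0 ?I stress"
    unfolding Ck_plane.simps extends_continuously_def by (intro exI[of _ "\<lambda>p. behind (snd p)"] conjI)
  have 8: "\<forall>(s, t)\<in>?I. motion (s, t) = N\<^sub>1 * s \<and>
      region_value ?I stress (s, t) = region_value ?E stress (front t, t) +
        (region_value ?J (deriv front) t)\<^sup>2 * (N\<^sub>1 - region_value ?E stress (front t, t)) \<and>
      N\<^sub>1 < region_value ?I stress (s, t)"
    using behind_gt by (auto simp: rv_I) (auto simp: region_I_def motion_def behind_def sp np)
  have 9: "\<forall>p\<in>?E. region_value ?E (partial_t (partial_t motion)) p = region_value ?E (partial_s (partial_s motion)) p"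
    by (auto simp: rv_tt rv_ss)
  have 10: "\<forall>t\<in>?J. ((\<lambda>s. region_value ?E (partial_s motion) (s, t)) \<longlongrightarrow> 0 * t + \<tau>) at_top"
  proof
    fix t assume t: "t \<in> ?J"
    have in_E: "(s, t) \<in> ?E" if "front t \<le> s" for s using that t by (simp add: region_E_def)
    have "\<forall>\<^sub>F s in at_top. F (s + t) + G (s - t) = region_value ?E (partial_s motion) (s, t)"
      using eventually_ge_at_top[of "front t"] by eventually_elim (simp add: rv_s[OF in_E])
    with lim[of t] show "((\<lambda>s. region_value ?E (partial_s motion) (s, t)) \<longlongrightarrow> 0 * t + \<tau>) at_top"
      using Lim_transform_eventually by fastforce
  qed
  have "(s, 0) \<in> ?E" if "s \<in> {front 0..}" for s using that T by (simp add: region_E_def)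
  hence 11: "\<forall>s\<in>{front 0..}. region_value ?E motion (s, 0) = chi\<^sub>0 s \<and>
      region_value ?E (partial_t motion) (s, 0) = region_value {front 0..} chi\<^sub>1 s"
    using init(2,3) by (simp add: rv_chi rv_t front_0)
  show ?thesis unfolding shock_front_def Let_def
    by (intro conjI 1 cf 2 3 C 4 5 6 7 8 9 10 11)
qed

text \<open>A solution on every bounded time interval is enough: \<infinity> is the top of
  \<open>ereal\<close>, so maximality is immediate.\<close>

lemma maximal_shock_solution_motion:
  assumes init: "initial_shock_front N\<^sub>1 \<eta> \<tau> 0 chi\<^sub>0 chi\<^sub>1 N\<^sub>0 a"
    "\<And>x. a \<le> x \<Longrightarrow> chi\<^sub>0 x = P x + Q x" "\<And>x. a \<le> x \<Longrightarrow> region_value {a..} chi\<^sub>1 x = F x - G x"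
    and lim: "\<And>t. ((\<lambda>s. F (s + t) + G (s - t)) \<longlongrightarrow> \<tau>) at_top"
  shows "maximal_shock_solution N\<^sub>1 \<eta> \<tau> 0 chi\<^sub>0 chi\<^sub>1 N\<^sub>0 \<infinity> motion stress front"
proof -
  have "classical_shock_solution N\<^sub>1 \<eta> \<tau> 0 chi\<^sub>0 chi\<^sub>1 N\<^sub>0 T motion stress"
    "shock_front N\<^sub>1 \<eta> \<tau> 0 chi\<^sub>0 chi\<^sub>1 N\<^sub>0 T motion stress front" if T: "T > 0" for T
  proof -
    show *: "shock_front N\<^sub>1 \<eta> \<tau> 0 chi\<^sub>0 chi\<^sub>1 N\<^sub>0 T motion stress front"
      by (rule shock_front_motion[OF T init lim])
    show "classical_shock_solution N\<^sub>1 \<eta> \<tau> 0 chi\<^sub>0 chi\<^sub>1 N\<^sub>0 T motion stress"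
      unfolding classical_shock_solution_def Let_def
      using continuous_motion L_infinity_stress L_infinity_motion_t AE_DERIV_motion *
        shock_front_unique[OF * _ T] by blast
  qed
  thus ?thesis by (simp add: maximal_shock_solution_def shock_solution_before_def)
qed

end

section \<open>Decay estimates\<close>

text \<open>The function \<open>g\<close> is the tail integral of the bound on the derivative, so f
  - g increases and f + g decreases. Every value of the former is below every value of the latter; a
  number \<open>L\<close> separating them is within \<open>g x\<close> of \<open>f x\<close>, and
  \<open>g\<close> tends to 0.\<close>

lemma limit_of_powr_decay:
  fixes f f' :: "real \<Rightarrow> real"
  assumes f: "\<And>x. (f has_real_derivative f' x) (at x)"
    and decay: "\<And>x. a \<le> x \<Longrightarrow> \<bar>f' x\<bar> \<le> K * x powr (- (r + 1))"
    and "a > 0" "r > 0"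
  obtains L where "(f \<longlongrightarrow> L) at_top" "\<And>x. a \<le> x \<Longrightarrow> \<bar>f x - L\<bar> \<le> K / r * x powr (- r)"
proof -
  define g where "g x = K / r * x powr (- r)" for x
  have K: "0 \<le> K" using decay[of a] assms(3) zero_le_mult_iff[of K "a powr (- (r+1))"] by auto
  have g_pos: "0 \<le> g x" for x using K assms(4) by (simp add: g_def)
  have g: "(g has_real_derivative - (K * x powr (- (r + 1)))) (at x)" if "a \<le> x" for x
  proof -
    have "((\<lambda>x. K / r * x powr (- r)) has_real_derivative K / r * (- r * x powr (- r - 1))) (at x)"
      using that assms(3) by (intro DERIV_cmult has_real_derivative_powr) auto
    moreover have e: "- r - 1 = - (r + 1)" by simp
    have "K / r * (- r * x powr (- r - 1)) = - (K * x powr (- (r + 1)))"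
      unfolding e using assms(4) by simp
    ultimately show ?thesis unfolding g_def by (simp only:)
  qed
  have up: "f x - g x \<le> f y - g y" if "a \<le> x" "x \<le> y" for x y
    using that
  proof (intro DERIV_nonneg_imp_nondecreasing[of x y "\<lambda>x. f x - g x"])
    fix z assume z: "x \<le> z" "z \<le> y"
    show "\<exists>D. ((\<lambda>x. f x - g x) has_real_derivative D) (at z) \<and> 0 \<le> D"
      using DERIV_diff[OF f g[of z]] decay[of z] that z by (intro exI conjI) auto
  qed
  have down: "f y + g y \<le> f x + g x" if "a \<le> x" "x \<le> y" for x y
    using that
  proof (intro DERIV_nonpos_imp_nonincreasing[of x y "\<lambda>x. f x + g x"])
    fix z assume z: "x \<le> z" "z \<le> y"
    show "\<exists>D. ((\<lambda>x. f x + g x) has_real_derivative D) (at z) \<and> D \<le> 0"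
      using DERIV_add[OF f g[of z]] decay[of z] that z by (intro exI conjI) auto
  qed
  define L where "L = Sup ((\<lambda>x. f x - g x) ` {a..})"
  have le: "f y - g y \<le> f x + g x" if "a \<le> x" "a \<le> y" for x y
    using up[of y "max x y"] down[of x "max x y"] g_pos[of "max x y"] that by simp
  have "f x - g x \<le> L" if "a \<le> x" for x
    unfolding L_def using that le[of a] by (intro cSup_upper bdd_aboveI2[of _ _ "f a + g a"]) auto
  moreover have "L \<le> f x + g x" if "a \<le> x" for x
    unfolding L_def using le that by (intro cSup_least) auto
  ultimately have bound: "\<bar>f x - L\<bar> \<le> g x" if "a \<le> x" for x using that by (force simp: abs_le_iff)
  have "(g \<longlongrightarrow> K / r * 0) at_top"
    unfolding g_def using assms(4)
    by (intro tendsto_mult tendsto_const tendsto_neg_powr filterlim_ident) auto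
  hence "(g \<longlongrightarrow> 0) at_top" by simp
  moreover have "\<forall>\<^sub>F x in at_top. norm (f x - L) \<le> g x"
    using eventually_ge_at_top[of a] by eventually_elim (simp add: bound)
  ultimately have "((\<lambda>x. f x - L) \<longlongrightarrow> 0) at_top" by (rule Lim_null_comparison[rotated])
  hence "(f \<longlongrightarrow> L) at_top" by (simp add: LIM_zero_iff)
  thus ?thesis using that bound by (auto simp: g_def)
qed

text \<open>In the application d = \<open>N\<^sub>1 - \<tau>\<close>, S and V are the tension and
  chi_t on the front, and q is the limit of V, so that q / d is the asymptotic speed. The bound on S
  keeps the denominator \<open>N\<^sub>1 - S\<close> at least d / 2, and d \<le> q allows q to be
  factored out and cancelled.\<close>

lemma speed_error:
  fixes d q S V :: real
  assumes "d > 0" "d \<le> q" "\<bar>S - (N\<^sub>1 - d)\<bar> \<le> d / 2"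
  shows "\<bar>V / (N\<^sub>1 - S) / (q / d) - 1\<bar> \<le> 2 / d * (\<bar>S - (N\<^sub>1 - d)\<bar> + \<bar>V - q\<bar>)"
proof -
  define u v where "u = S - (N\<^sub>1 - d)" and "v = V - q"
  have pos: "d / 2 \<le> d - u" using abs_le_D1[OF assms(3)] by (simp add: u_def)
  have q: "q > 0" using assms by simp
  have "V / (N\<^sub>1 - S) / (q / d) - 1 = (d * v + q * u) / (q * (d - u))"
    using pos q assms(1) by (simp add: u_def v_def field_simps)
  also have "\<bar>\<dots>\<bar> = \<bar>d * v + q * u\<bar> / (q * (d - u))"
    using pos q assms(1) by (simp add: abs_mult)
  also have "\<dots> \<le> (q * (\<bar>u\<bar> + \<bar>v\<bar>)) / (q * (d / 2))"
  proof (rule frac_le)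
    have "\<bar>d * v + q * u\<bar> \<le> d * \<bar>v\<bar> + q * \<bar>u\<bar>"
      using abs_triangle_ineq[of "d * v" "q * u"] assms(1) q by (simp add: abs_mult)
    also have "\<dots> \<le> q * \<bar>v\<bar> + q * \<bar>u\<bar>" using assms(2) by (intro add_right_mono mult_right_mono) auto
    finally show "\<bar>d * v + q * u\<bar> \<le> q * (\<bar>u\<bar> + \<bar>v\<bar>)" by (simp add: algebra_simps)
    show "q * (d / 2) \<le> q * (d - u)" using pos q by (intro mult_left_mono) auto
  qed (use q assms(1) in auto)
  also have "\<dots> = 2 / d * (\<bar>u\<bar> + \<bar>v\<bar>)" using q assms(1) by (simp add: field_simps)
  finally show ?thesis by (simp add: u_def v_def)
qed

text \<open>The difference of the two tensions splits into a part with the error u of S and a part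
  with the relative error w of the speed. Both are bounded by multiples of c^2, and the denominator
  is at least c^2 d because \<open>N\<^sub>1 - d\<close> is positive; hence the constant is
  independent of the asymptotic speed c.\<close>

lemma stress_error:
  fixes d q S V :: real
  assumes "d > 0" "d \<le> q" "\<bar>S - (N\<^sub>1 - d)\<bar> \<le> d / 2" "\<bar>V - q\<bar> \<le> d" "0 < N\<^sub>1 - d"
  shows "\<bar>(S + (V / (N\<^sub>1 - S))\<^sup>2 * (N\<^sub>1 - S)) * inverse ((N\<^sub>1 - d) + (q / d)\<^sup>2 * d) - 1\<bar>
    \<le> 27 / d * (\<bar>S - (N\<^sub>1 - d)\<bar> + \<bar>V - q\<bar>)"
proof -
  define u \<delta> c where "u = S - (N\<^sub>1 - d)" and "\<delta> = \<bar>S - (N\<^sub>1 - d)\<bar> + \<bar>V - q\<bar>" and "c = q / d"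
  define w where "w = V / (N\<^sub>1 - S) / c - 1"
  have c: "1 \<le> c" using assms(1,2) by (simp add: c_def)
  hence c2: "1 \<le> c\<^sup>2" by (simp add: one_le_power)
  have w1: "\<bar>w\<bar> \<le> 2 / d * \<delta>" using speed_error[OF assms(1-3), of V] by (simp add: w_def \<delta>_def c_def)
  have "\<delta> \<le> 3 / 2 * d" using assms(3,4) by (simp add: \<delta>_def)
  hence "2 / d * \<delta> \<le> 3" using assms(1) by (simp add: field_simps)
  hence w3: "\<bar>w\<bar> \<le> 3" using w1 by linarith
  have V: "V / (N\<^sub>1 - S) = c * (1 + w)" using c by (simp add: w_def)
  let ?n = "(N\<^sub>1 - d) + c\<^sup>2 * d"
  have n: "c\<^sup>2 * d \<le> ?n" "0 < c\<^sup>2 * d" using assms(1,5) less_le_trans[OF zero_less_one c2] by auto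
  have "(S + (V / (N\<^sub>1 - S))\<^sup>2 * (N\<^sub>1 - S)) - ?n = u * (1 - c\<^sup>2 * (1 + w)\<^sup>2) + c\<^sup>2 * d * (w * (2 + w))"
    unfolding V by (simp add: u_def power2_eq_square algebra_simps)
  \<comment> \<open>From |w| \<le> 3 come (1 + w)^2 \<le> 16 and |2 + w| \<le> 5. Together with d
    |w| \<le> 2 \<delta> below, the total is 17 + 2 * 5 = 27.\<close>
  also have "\<bar>\<dots>\<bar> \<le> \<bar>u\<bar> * (17 * c\<^sup>2) + c\<^sup>2 * d * (\<bar>w\<bar> * 5)"
  proof -
    have "(1 + w)\<^sup>2 \<le> 4\<^sup>2" using w3 by (intro power2_le_iff_abs_le[THEN iffD2]) auto
    hence "c\<^sup>2 * (1 + w)\<^sup>2 \<le> c\<^sup>2 * 16" by (intro mult_left_mono) auto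
    moreover have "0 \<le> c\<^sup>2 * (1 + w)\<^sup>2" by simp
    ultimately have "\<bar>1 - c\<^sup>2 * (1 + w)\<^sup>2\<bar> \<le> 17 * c\<^sup>2" using c2 by linarith
    hence "\<bar>u * (1 - c\<^sup>2 * (1 + w)\<^sup>2)\<bar> \<le> \<bar>u\<bar> * (17 * c\<^sup>2)" unfolding abs_mult by (intro mult_left_mono) auto
    moreover have "\<bar>2 + w\<bar> \<le> 5" using w3 by linarith
    hence "\<bar>c\<^sup>2 * d * (w * (2 + w))\<bar> \<le> c\<^sup>2 * d * (\<bar>w\<bar> * 5)"
      using assms(1) by (simp add: abs_mult mult_left_mono)
    ultimately show ?thesis by linarith
  qed
  also have "\<dots> \<le> c\<^sup>2 * (27 * \<delta>)"
  proof -
    have "d * \<bar>w\<bar> \<le> 2 * \<delta>" using w1 assms(1) by (simp add: field_simps)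
    moreover have "\<bar>u\<bar> \<le> \<delta>" by (simp add: u_def \<delta>_def)
    ultimately have "\<bar>u\<bar> * 17 + d * \<bar>w\<bar> * 5 \<le> 27 * \<delta>" by linarith
    hence "c\<^sup>2 * (\<bar>u\<bar> * 17 + d * \<bar>w\<bar> * 5) \<le> c\<^sup>2 * (27 * \<delta>)" by (intro mult_left_mono) auto
    thus ?thesis by (simp add: algebra_simps)
  qed
  finally have "\<bar>(S + (V / (N\<^sub>1 - S))\<^sup>2 * (N\<^sub>1 - S)) - ?n\<bar> \<le> c\<^sup>2 * (27 * \<delta>)" .
  moreover have "0 \<le> c\<^sup>2 * (27 * \<delta>)" by (intro mult_nonneg_nonneg) (auto simp: \<delta>_def)
  ultimately have "\<bar>(S + (V / (N\<^sub>1 - S))\<^sup>2 * (N\<^sub>1 - S)) - ?n\<bar> / ?n \<le> (c\<^sup>2 * (27 * \<delta>)) / (c\<^sup>2 * d)"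
    using n by (intro frac_le)
  also have "\<dots> = 27 / d * \<delta>" using c assms(1) by simp
  also have "\<bar>(S + (V / (N\<^sub>1 - S))\<^sup>2 * (N\<^sub>1 - S)) - ?n\<bar> / ?n = \<bar>((S + (V / (N\<^sub>1 - S))\<^sup>2 * (N\<^sub>1 - S)) - ?n) / ?n\<bar>"
    using n by simp
  also have "((S + (V / (N\<^sub>1 - S))\<^sup>2 * (N\<^sub>1 - S)) - ?n) / ?n = (S + (V / (N\<^sub>1 - S))\<^sup>2 * (N\<^sub>1 - S)) * inverse ?n - 1"
    using n by (simp add: field_simps)
  finally show ?thesis by (simp add: c_def \<delta>_def)
qed

section \<open>Splitting the initial data into two waves\<close>

lemma initial_data_decomposition:
  assumes "continuous_on {0..} chi\<^sub>0" and "initial_shock_front N\<^sub>1 \<eta> \<tau> \<zeta> chi\<^sub>0 chi\<^sub>1 N\<^sub>0 a"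
  obtains P Q F G F' G' where "dalembert P Q F G F' G'"
    "\<And>x. a \<le> x \<Longrightarrow> chi\<^sub>0 x = P x + Q x"
    "\<And>x. a \<le> x \<Longrightarrow> region_value {a..} (deriv chi\<^sub>0) x = F x + G x"
    "\<And>x. a \<le> x \<Longrightarrow> region_value {a..} (deriv (deriv chi\<^sub>0)) x = F' x + G' x"
    "\<And>x. a \<le> x \<Longrightarrow> region_value {a..} chi\<^sub>1 x = F x - G x"
    "\<And>x. a \<le> x \<Longrightarrow> region_value {a..} (deriv chi\<^sub>1) x = F' x - G' x"
    "((\<lambda>x. F x + G x) \<longlongrightarrow> \<tau>) at_top"
    "P a + Q a = N\<^sub>1 * a"
proof -
  have a: "a > 0" and C: "Ck_line 2 {a..} chi\<^sub>0" "Ck_line 1 {a..} chi\<^sub>1"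
    and lim: "(deriv chi\<^sub>0 \<longlongrightarrow> \<tau>) at_top" and start: "chi\<^sub>0 a = N\<^sub>1 * a"
    using assms(2) by (auto simp: initial_shock_front_def Let_def)
  have "Ck_line 1 {a..} (deriv chi\<^sub>0)" and diff: "\<And>x. x > a \<Longrightarrow> chi\<^sub>0 differentiable (at x)"
    using C(1) by (auto simp: numeral_2_eq_2)
  from Ck_line_1_extension[OF this(1)] obtain p p' where p: "\<And>x. (p has_real_derivative p' x) (at x)"
    "continuous_on UNIV p'" "\<And>x. x > a \<Longrightarrow> deriv chi\<^sub>0 x = p x" "\<And>x. x > a \<Longrightarrow> deriv (deriv chi\<^sub>0) x = p' x"
    by metis
  from Ck_line_1_extension[OF C(2)] obtain q q' where q: "\<And>x. (q has_real_derivative q' x) (at x)"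
    "continuous_on UNIV q'" "\<And>x. x > a \<Longrightarrow> chi\<^sub>1 x = q x" "\<And>x. x > a \<Longrightarrow> deriv chi\<^sub>1 x = q' x"
    by metis
  define F G F' G' where "F x = (p x + q x) / 2" and "G x = (p x - q x) / 2"
    and "F' x = (p' x + q' x) / 2" and "G' x = (p' x - q' x) / 2" for x
  have F: "(F has_real_derivative F' x) (at x)" and G: "(G has_real_derivative G' x) (at x)" for x
    unfolding F_def G_def F'_def G'_def by (auto intro!: derivative_eq_intros p q)
  have F': "continuous_on UNIV F'" and G': "continuous_on UNIV G'"
    unfolding F'_def G'_def by (intro continuous_intros p q; simp)+
  have "continuous_on UNIV F" "continuous_on UNIV G"
    using F G by (auto intro: DERIV_continuous_on has_field_derivative_at_within)
  then obtain P Q0 where P: "\<And>x. (P has_real_derivative F x) (at x)" and Q0: "\<And>x. (Q0 has_real_derivative G x) (at x)"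
    using antiderivative_exists by metis
  have "((\<lambda>x. chi\<^sub>0 x - P x - Q0 x) has_real_derivative 0) (at x within {a<..})" if "x \<in> {a<..}" for x
  proof -
    have "(chi\<^sub>0 has_real_derivative deriv chi\<^sub>0 x) (at x)"
      using diff[of x] that by (simp add: DERIV_deriv_iff_real_differentiable)
    moreover have "deriv chi\<^sub>0 x - F x - G x = 0" using p(3)[of x] that by (simp add: F_def G_def field_simps)
    ultimately have "((\<lambda>x. chi\<^sub>0 x - P x - Q0 x) has_real_derivative 0) (at x)"
      using DERIV_diff[OF DERIV_diff[OF _ P] Q0, of chi\<^sub>0 "deriv chi\<^sub>0 x" x] by simp
    thus ?thesis by (rule has_field_derivative_at_within)
  qed
  \<comment> \<open>Adding the constant of integration \<open>c\<close> to \<open>Q0\<close> makes P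
    + Q equal to \<open>chi\<^sub>0\<close> itself.\<close>
  then obtain c where c: "\<forall>x\<in>{a<..}. chi\<^sub>0 x - P x - Q0 x = c"
    using has_field_derivative_zero_constant[of "{a<..}" "\<lambda>x. chi\<^sub>0 x - P x - Q0 x"] by auto
  \<comment> \<open>Derivatives are compared only beyond \<open>a\<close>; continuity of
    \<open>chi\<^sub>0\<close> carries the identity to \<open>a\<close>, where the front
    starts.\<close>
  have "continuous_on (closure {a<..}) (\<lambda>x. chi\<^sub>0 x - P x - Q0 x)"
    using a P Q0 by (intro continuous_intros continuous_on_subset[OF assms(1)])
      (auto intro: DERIV_continuous_on has_field_derivative_at_within)
  hence chi0: "chi\<^sub>0 x = P x + (Q0 x + c)" if "a \<le> x" for x
    using continuous_constant_on_closure[of "{a<..}" "\<lambda>x. chi\<^sub>0 x - P x - Q0 x" c x] c that by auto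
  have Q: "((\<lambda>x. Q0 x + c) has_real_derivative G x) (at x)" for x
    by (auto intro!: derivative_eq_intros Q0)
  have D: "dalembert P (\<lambda>x. Q0 x + c) F G F' G'"
    by (intro dalembert.intro P Q F G F' G')
  have cont: "continuous_on {a..} p" "continuous_on {a..} q" "continuous_on {a..} p'" "continuous_on {a..} q'"
    using p(1) q(1) continuous_on_subset[OF p(2)] continuous_on_subset[OF q(2)]
    by (auto intro: DERIV_continuous_on has_field_derivative_at_within)
  show ?thesis
  proof (rule that[OF D chi0])
    show "region_value {a..} (deriv chi\<^sub>0) x = F x + G x" if "a \<le> x" for x
      using region_value_half_line[OF cont(1) p(3) that] by (simp add: F_def G_def field_simps)
    show "region_value {a..} (deriv (deriv chi\<^sub>0)) x = F' x + G' x" if "a \<le> x" for x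
      using region_value_half_line[OF cont(3) p(4) that] by (simp add: F'_def G'_def field_simps)
    show "region_value {a..} chi\<^sub>1 x = F x - G x" if "a \<le> x" for x
      using region_value_half_line[OF cont(2) q(3) that] by (simp add: F_def G_def field_simps)
    show "region_value {a..} (deriv chi\<^sub>1) x = F' x - G' x" if "a \<le> x" for x
      using region_value_half_line[OF cont(4) q(4) that] by (simp add: F'_def G'_def field_simps)
    have "\<forall>\<^sub>F x in at_top. deriv chi\<^sub>0 x = F x + G x"
      using eventually_gt_at_top[of a] by eventually_elim (simp add: p(3) F_def G_def field_simps)
    thus "((\<lambda>x. F x + G x) \<longlongrightarrow> \<tau>) at_top" using lim Lim_transform_eventually by fastforce
    show "P a + (Q0 a + c) = N\<^sub>1 * a" using chi0[of a] start by simp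
  qed
qed

text \<open>\<open>b\<close> is a lower bound of the front speed.\<close>

definition decay_constant :: "real \<Rightarrow> real \<Rightarrow> real \<Rightarrow> real \<Rightarrow> real \<Rightarrow> real" where
  "decay_constant N\<^sub>1 \<tau> a b r =
     2 * (1 - 1 / b) powr (- (r + 1)) + 1 / (N\<^sub>1 - \<tau>)
     + (1 + 27 / (N\<^sub>1 - \<tau>)) * (2 / r * min a (b - 1) powr (- r))"

lemma decay_constant_pos:
  assumes "\<tau> < N\<^sub>1" "r > 0"
  shows "decay_constant N\<^sub>1 \<tau> a b r > 0"
proof -
  have "0 < 1 / (N\<^sub>1 - \<tau>)" "0 \<le> 2 * (1 - 1 / b) powr (- (r + 1))"
    "0 \<le> (1 + 27 / (N\<^sub>1 - \<tau>)) * (2 / r * min a (b - 1) powr (- r))"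
    using assms by (auto intro!: mult_nonneg_nonneg add_nonneg_nonneg)
  thus ?thesis unfolding decay_constant_def by linarith
qed

text \<open>The three conditions \<open>small\<close> respectively keep the tension well below
  \<open>N\<^sub>1\<close>, keep it above \<eta>, and make the front speed at least
  \<open>b\<close>.\<close>

locale small_data = dalembert +
  fixes N\<^sub>1 \<eta> \<tau> \<sigma>\<^sub>1 a r B :: real
  assumes \<tau>: "0 < \<tau>" "\<tau> < N\<^sub>1" and \<sigma>\<^sub>1: "1 < \<sigma>\<^sub>1" and a: "0 < a" and r: "0 < r"
    and small: "B < (N\<^sub>1 - \<tau>) / 2" "B < \<tau> - \<eta>" "(3 + \<sigma>\<^sub>1) * B < (\<sigma>\<^sub>1 - 1) * (N\<^sub>1 - \<tau>)"
    and bound: "\<And>x. a \<le> x \<Longrightarrow>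
        \<bar>F x + G x - \<tau>\<bar> + x powr (r + 1) * \<bar>F' x + G' x\<bar>
      + \<bar>F x - G x - \<sigma>\<^sub>1 * (N\<^sub>1 - \<tau>)\<bar> + x powr (r + 1) * \<bar>F' x - G' x\<bar> \<le> B"
    and start: "P a + Q a = N\<^sub>1 * a"
    and lim: "((\<lambda>x. F x + G x) \<longlongrightarrow> \<tau>) at_top"
begin

definition b :: real where "b = (1 + \<sigma>\<^sub>1) / 2"

lemma b_gt_1: "1 < b"
  using \<sigma>\<^sub>1 by (simp add: b_def)

lemma B_nonneg: "0 \<le> B"
  using bound[of a] by (smt (verit) abs_ge_zero mult_nonneg_nonneg powr_ge_zero)

lemma near_constant:
  assumes "a \<le> x"
  shows "\<bar>2 * F x - (\<tau> + \<sigma>\<^sub>1 * (N\<^sub>1 - \<tau>))\<bar> \<le> B" "\<bar>2 * G x - (\<tau> - \<sigma>\<^sub>1 * (N\<^sub>1 - \<tau>))\<bar> \<le> B"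
proof -
  have "0 \<le> x powr (r + 1) * \<bar>F' x + G' x\<bar>" "0 \<le> x powr (r + 1) * \<bar>F' x - G' x\<bar>" by auto
  hence "\<bar>F x + G x - \<tau>\<bar> + \<bar>F x - G x - \<sigma>\<^sub>1 * (N\<^sub>1 - \<tau>)\<bar> \<le> B" using bound[OF assms] by linarith
  thus "\<bar>2 * F x - (\<tau> + \<sigma>\<^sub>1 * (N\<^sub>1 - \<tau>))\<bar> \<le> B" "\<bar>2 * G x - (\<tau> - \<sigma>\<^sub>1 * (N\<^sub>1 - \<tau>))\<bar> \<le> B"
    by linarith+
qed

text \<open>The bound on the data concerns a single point, but F and G are needed at two different
  ones. Bounding 2 F and 2 G separately, each with error B, gives the mixed sums with error B
  again.\<close>

lemma near_sum:
  assumes "a \<le> x" "a \<le> y"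
  shows "\<bar>F x + G y - \<tau>\<bar> \<le> B" "\<bar>F x - G y - \<sigma>\<^sub>1 * (N\<^sub>1 - \<tau>)\<bar> \<le> B"
  using near_constant(1)[OF assms(1)] near_constant(2)[OF assms(2)] by linarith+

lemma derivative_decay:
  assumes "a \<le> x"
  shows "\<bar>F' x\<bar> \<le> B / 2 * x powr (- (r + 1))" "\<bar>G' x\<bar> \<le> B / 2 * x powr (- (r + 1))"
proof -
  have x: "x > 0" using assms a by simp
  define w where "w = x powr (r + 1)"
  have w: "0 < w" "x powr (- (r + 1)) = inverse w" using x by (simp_all add: w_def powr_minus[symmetric])
  have "w * (\<bar>F' x + G' x\<bar> + \<bar>F' x - G' x\<bar>) \<le> B"
    using bound[OF assms] unfolding w_def distrib_left by linarith
  hence "(\<bar>F' x + G' x\<bar> + \<bar>F' x - G' x\<bar>) \<le> B * x powr (- (r + 1))"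
    using w(1) unfolding w(2) by (simp add: field_simps)
  moreover have "2 * \<bar>F' x\<bar> \<le> \<bar>F' x + G' x\<bar> + \<bar>F' x - G' x\<bar>" "2 * \<bar>G' x\<bar> \<le> \<bar>F' x + G' x\<bar> + \<bar>F' x - G' x\<bar>"
    by linarith+
  ultimately show "\<bar>F' x\<bar> \<le> B / 2 * x powr (- (r + 1))" "\<bar>G' x\<bar> \<le> B / 2 * x powr (- (r + 1))" by linarith+
qed

lemma two_B: "2 * B < N\<^sub>1 - \<tau>"
  using small(1) by simp

lemma three_B: "3 * B \<le> (3 + \<sigma>\<^sub>1) * B"
  using B_nonneg \<sigma>\<^sub>1 by (intro mult_right_mono) auto

text \<open>The first entry of the margin is the distance of the tension from
  \<open>N\<^sub>1\<close>. The second is the distance of 2 F from \<open>N\<^sub>1\<close>, because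
  \<open>\<tau> + \<sigma>\<^sub>1 * (N\<^sub>1 - \<tau>)\<close> exceeds \<open>N\<^sub>1\<close>
  by \<open>(\<sigma>\<^sub>1 - 1) * (N\<^sub>1 - \<tau>)\<close>.\<close>

lemma front_data: "front_data P Q F G F' G' N\<^sub>1 \<eta> a (min (N\<^sub>1 - \<tau> - B) ((\<sigma>\<^sub>1 - 1) * (N\<^sub>1 - \<tau>) - B))"
proof unfold_locales
  show "0 < min (N\<^sub>1 - \<tau> - B) ((\<sigma>\<^sub>1 - 1) * (N\<^sub>1 - \<tau>) - B)"
    unfolding min_less_iff_conj
  proof
    show "0 < N\<^sub>1 - \<tau> - B" using two_B \<tau>(2) by linarith
    show "0 < (\<sigma>\<^sub>1 - 1) * (N\<^sub>1 - \<tau>) - B" using small(3) three_B B_nonneg by linarith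
  qed
  show "\<eta> < F x + G y" "F x + G y \<le> N\<^sub>1 - min (N\<^sub>1 - \<tau> - B) ((\<sigma>\<^sub>1 - 1) * (N\<^sub>1 - \<tau>) - B)" if "a \<le> x" "a \<le> y" for x y
    using near_sum(1)[OF that] small(2) by linarith+
  show "N\<^sub>1 + min (N\<^sub>1 - \<tau> - B) ((\<sigma>\<^sub>1 - 1) * (N\<^sub>1 - \<tau>) - B) \<le> 2 * F x" if "a \<le> x" for x
  proof -
    have "N\<^sub>1 + ((\<sigma>\<^sub>1 - 1) * (N\<^sub>1 - \<tau>) - B) = \<tau> + \<sigma>\<^sub>1 * (N\<^sub>1 - \<tau>) - B" by (simp add: algebra_simps)
    thus ?thesis using near_constant(1)[OF that] by linarith
  qed
qed (use a start in auto)

text \<open>In the worst case the denominator is \<open>N\<^sub>1 - \<tau> + B\<close> and the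
  numerator \<open>\<sigma>\<^sub>1 * (N\<^sub>1 - \<tau>) - B\<close>. That their quotient is at
  least the midpoint \<open>b\<close> of 1 and \<open>\<sigma>\<^sub>1\<close> is, after clearing
  denominators, the third smallness condition.\<close>

lemma speed_ge_b:
  assumes "a \<le> x" "a \<le> y"
  shows "b \<le> (F x - G y) / (N\<^sub>1 - (F x + G y))"
proof -
  have pos: "0 < N\<^sub>1 - (F x + G y)" using abs_le_D1[OF near_sum(1)[OF assms]] two_B \<tau>(2) by linarith
  have "b * (N\<^sub>1 - (F x + G y)) \<le> b * (N\<^sub>1 - \<tau> + B)"
    using near_sum(1)[OF assms] b_gt_1 by (intro mult_left_mono) auto
  also have "\<dots> \<le> \<sigma>\<^sub>1 * (N\<^sub>1 - \<tau>) - B" using small(3) by (simp add: b_def field_simps)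
  also have "\<dots> \<le> F x - G y" using near_sum(2)[OF assms] by linarith
  finally show ?thesis using pos by (simp add: pos_le_divide_eq)
qed

abbreviation C :: real where "C \<equiv> decay_constant N\<^sub>1 \<tau> a b r"

lemma second_derivative_estimate:
  assumes "0 \<le> t" "a + b * t \<le> s"
  shows "s powr (r + 1) * (\<bar>F' (s + t) + G' (s - t)\<bar> + \<bar>F' (s + t) - G' (s - t)\<bar>)
      \<le> 2 * (1 - 1 / b) powr (- (r + 1)) * B"
proof -
  \<comment> \<open>Beyond the line a + b t one has t \<le> s / b, hence s - t \<ge> l s: decay in s
    - t becomes decay in s.\<close>
  define l where "l = 1 - 1 / b"
  have l: "0 < l" using b_gt_1 by (simp add: l_def)
  have bt: "t \<le> b * t" using mult_right_mono[of 1 b t] b_gt_1 assms(1) by simp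
  have s: "0 < s" "a \<le> s + t" "a \<le> s - t" using assms a bt by auto
  have "t \<le> s / b" using assms a b_gt_1 by (simp add: field_simps)
  moreover have "l * s = s - s / b" by (simp add: l_def left_diff_distrib)
  ultimately have ls: "0 < l * s" "l * s \<le> s - t" "l * s \<le> s + t"
    using mult_pos_pos[OF l s(1)] assms(1) by auto
  have "\<bar>F' (s + t)\<bar> \<le> B / 2 * (l * s) powr (- (r + 1))"
    using order_trans[OF derivative_decay(1)[OF s(2)] mult_left_mono[OF powr_mono2'[OF _ ls(1,3), of "- (r + 1)"]]]
      r B_nonneg by simp
  moreover have "\<bar>G' (s - t)\<bar> \<le> B / 2 * (l * s) powr (- (r + 1))"
    using order_trans[OF derivative_decay(2)[OF s(3)] mult_left_mono[OF powr_mono2'[OF _ ls(1,2), of "- (r + 1)"]]]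
      r B_nonneg by simp
  ultimately have "\<bar>F' (s + t) + G' (s - t)\<bar> + \<bar>F' (s + t) - G' (s - t)\<bar> \<le> 2 * B * (l * s) powr (- (r + 1))"
    by linarith
  hence "s powr (r + 1) * (\<bar>F' (s + t) + G' (s - t)\<bar> + \<bar>F' (s + t) - G' (s - t)\<bar>)
      \<le> s powr (r + 1) * (2 * B * (l * s) powr (- (r + 1)))"
    by (intro mult_left_mono) auto
  also have "\<dots> = 2 * l powr (- (r + 1)) * B * (s powr (r + 1) * s powr (- (r + 1)))"
    using l s by (simp add: powr_mult)
  also have "s powr (r + 1) * s powr (- (r + 1)) = 1"
    using s by (simp add: powr_add[symmetric])
  finally show ?thesis by (simp add: l_def)
qed

text \<open>The summands of \<open>decay_constant\<close> in order: the loss from s - t to s in the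
  second derivatives; the relative error of the asymptotic speed; and the constant in the decay of
  the state, once for the state itself and once amplified by 27 /
  (\<open>N\<^sub>1 - \<tau>\<close>) for the stress, which also covers the factor 2 /
  (\<open>N\<^sub>1 - \<tau>\<close>) of the front speed.\<close>

lemma C_bounds: "2 * (1 - 1 / b) powr (- (r + 1)) \<le> C" "1 / (N\<^sub>1 - \<tau>) \<le> C"
  "2 / r * min a (b - 1) powr (- r) \<le> C" "27 / (N\<^sub>1 - \<tau>) * (2 / r * min a (b - 1) powr (- r)) \<le> C"
  "2 / (N\<^sub>1 - \<tau>) * (2 / r * min a (b - 1) powr (- r)) \<le> C"
proof -
  define c1 c2 c3 where "c1 = 2 * (1 - 1 / b) powr (- (r + 1))" and "c2 = 1 / (N\<^sub>1 - \<tau>)"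
    and "c3 = 2 / r * min a (b - 1) powr (- r)"
  have nn: "0 \<le> c1" "0 \<le> c2" "0 \<le> c3" "0 \<le> c2 * c3" using \<tau> r by (auto simp: c1_def c2_def c3_def)
  have "C = c1 + c2 + (1 + 27 / (N\<^sub>1 - \<tau>)) * c3" by (simp only: decay_constant_def c1_def c2_def c3_def)
  moreover have eq: "27 / (N\<^sub>1 - \<tau>) = 27 * c2" "2 / (N\<^sub>1 - \<tau>) = 2 * c2" by (simp_all add: c2_def)
  ultimately have "C = c1 + c2 + c3 + 27 * (c2 * c3)" by (simp add: algebra_simps)
  hence "c1 \<le> C" "c2 \<le> C" "c3 \<le> C" "27 * (c2 * c3) \<le> C" "2 * (c2 * c3) \<le> C" using nn by linarith+
  thus "2 * (1 - 1 / b) powr (- (r + 1)) \<le> C" "1 / (N\<^sub>1 - \<tau>) \<le> C"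
    "2 / r * min a (b - 1) powr (- r) \<le> C" "27 / (N\<^sub>1 - \<tau>) * (2 / r * min a (b - 1) powr (- r)) \<le> C"
    "2 / (N\<^sub>1 - \<tau>) * (2 / r * min a (b - 1) powr (- r)) \<le> C"
    unfolding eq c1_def[symmetric] c2_def[symmetric] c3_def[symmetric] by (simp_all only: mult.assoc)
qed

text \<open>Here \<open>q\<close> is the limit of F - G, the asymptotic value of chi_t. The bound
  \<open>N\<^sub>1 - \<tau> < q\<close> says that the asymptotic speed q /
  (\<open>N\<^sub>1 - \<tau>\<close>) exceeds 1.\<close>

lemma asymptotic_state:
  obtains q where "N\<^sub>1 - \<tau> < q" "\<bar>q - \<sigma>\<^sub>1 * (N\<^sub>1 - \<tau>)\<bar> \<le> B"
    "\<And>s t. 0 \<le> t \<Longrightarrow> a + b * t \<le> s \<Longrightarrow>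
       \<bar>F (s + t) + G (s - t) - \<tau>\<bar> + \<bar>F (s + t) - G (s - t) - q\<bar>
         \<le> 2 / r * min a (b - 1) powr (- r) * B * (1 + t) powr (- r)"
proof -
  obtain Fi where Fi: "(F \<longlongrightarrow> Fi) at_top" "\<And>x. a \<le> x \<Longrightarrow> \<bar>F x - Fi\<bar> \<le> B / 2 / r * x powr (- r)"
    using limit_of_powr_decay[OF F derivative_decay(1) a r] by metis
  obtain Gi where Gi: "(G \<longlongrightarrow> Gi) at_top" "\<And>x. a \<le> x \<Longrightarrow> \<bar>G x - Gi\<bar> \<le> B / 2 / r * x powr (- r)"
    using limit_of_powr_decay[OF G derivative_decay(2) a r] by metis
  have sum: "Fi + Gi = \<tau>"
    using tendsto_unique[OF _ tendsto_add[OF Fi(1) Gi(1)] lim] by simp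
  have "((\<lambda>x. \<bar>F x - G x - \<sigma>\<^sub>1 * (N\<^sub>1 - \<tau>)\<bar>) \<longlongrightarrow> \<bar>Fi - Gi - \<sigma>\<^sub>1 * (N\<^sub>1 - \<tau>)\<bar>) at_top"
    by (intro tendsto_intros Fi(1) Gi(1))
  moreover have "\<forall>\<^sub>F x in at_top. \<bar>F x - G x - \<sigma>\<^sub>1 * (N\<^sub>1 - \<tau>)\<bar> \<le> B"
    using eventually_ge_at_top[of a] by eventually_elim (simp add: near_sum(2))
  ultimately have q: "\<bar>Fi - Gi - \<sigma>\<^sub>1 * (N\<^sub>1 - \<tau>)\<bar> \<le> B"
    by (rule tendsto_upperbound) simp
  have "B < \<sigma>\<^sub>1 * (N\<^sub>1 - \<tau>) - (N\<^sub>1 - \<tau>)" using small(3) three_B B_nonneg by (simp add: algebra_simps)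
  hence gt: "N\<^sub>1 - \<tau> < Fi - Gi" using q by linarith
  show ?thesis
  proof (rule that[OF gt q])
    fix s t :: real assume t: "0 \<le> t" and s: "a + b * t \<le> s"
    \<comment> \<open>Chosen such that s - t \<ge> a + (b - 1) t \<ge> l (1 + t).\<close>
    define l where "l = min a (b - 1)"
    have l: "0 < l" using a b_gt_1 by (simp add: l_def)
    have "l * 1 \<le> a * 1" "l * t \<le> (b - 1) * t" using t by (intro mult_right_mono; simp add: l_def)+
    moreover have "0 < l * (1 + t)" using l t by (intro mult_pos_pos) auto
    ultimately have ls: "0 < l * (1 + t)" "l * (1 + t) \<le> s - t" "l * (1 + t) \<le> s + t"
      using s t by (auto simp: algebra_simps)
    have "0 \<le> (b - 1) * t" using b_gt_1 t by simp
    hence as: "a \<le> s + t" "a \<le> s - t" using s t by (auto simp: algebra_simps)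
    \<comment> \<open>Each of the two errors is at most |F - Fi| + |G - Gi|, so four terms with the
      factor B / 2 / r add up to 2 / r times B.\<close>
    have double_double: "z \<le> 4 * D" if "x \<le> D" "y \<le> D" "z \<le> 2 * x + 2 * y" for x y z D :: real
      using that by linarith
    have k: "0 \<le> B / 2 / r" using B_nonneg r by simp
    have "\<bar>F (s + t) - Fi\<bar> \<le> B / 2 / r * (l * (1 + t)) powr (- r)"
      using order_trans[OF Fi(2)[OF as(1)] mult_left_mono[OF powr_mono2'[OF _ ls(1,3), of "- r"] k]] r by simp
    moreover have "\<bar>G (s - t) - Gi\<bar> \<le> B / 2 / r * (l * (1 + t)) powr (- r)"
      using order_trans[OF Gi(2)[OF as(2)] mult_left_mono[OF powr_mono2'[OF _ ls(1,2), of "- r"] k]] r by simp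
    moreover have "\<bar>F (s + t) + G (s - t) - \<tau>\<bar> + \<bar>F (s + t) - G (s - t) - (Fi - Gi)\<bar>
        \<le> 2 * \<bar>F (s + t) - Fi\<bar> + 2 * \<bar>G (s - t) - Gi\<bar>"
    proof -
      have "F (s + t) + G (s - t) - \<tau> = (F (s + t) - Fi) + (G (s - t) - Gi)"
        "F (s + t) - G (s - t) - (Fi - Gi) = (F (s + t) - Fi) - (G (s - t) - Gi)"
        using sum by simp_all
      hence "\<bar>F (s + t) + G (s - t) - \<tau>\<bar> + \<bar>F (s + t) - G (s - t) - (Fi - Gi)\<bar>
        \<le> (\<bar>F (s + t) - Fi\<bar> + \<bar>G (s - t) - Gi\<bar>) + (\<bar>F (s + t) - Fi\<bar> + \<bar>G (s - t) - Gi\<bar>)"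
        by (simp only: add_mono abs_triangle_ineq abs_triangle_ineq4)
      thus ?thesis by simp
    qed
    ultimately have "\<bar>F (s + t) + G (s - t) - \<tau>\<bar> + \<bar>F (s + t) - G (s - t) - (Fi - Gi)\<bar>
        \<le> 4 * (B / 2 / r * (l * (1 + t)) powr (- r))" by (rule double_double)
    also have "\<dots> = 2 / r * l powr (- r) * B * (1 + t) powr (- r)"
      using l t by (simp add: powr_mult)
    finally show "\<bar>F (s + t) + G (s - t) - \<tau>\<bar> + \<bar>F (s + t) - G (s - t) - (Fi - Gi)\<bar>
        \<le> 2 / r * min a (b - 1) powr (- r) * B * (1 + t) powr (- r)" by (simp add: l_def)
  qed
qed

end

section \<open>Estimates for an arbitrary solution\<close>

context small_data
begin

text \<open>The data give the limit of F + G at a common argument only. Decay supplies separate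
  limits of F and G, which are insensitive to the shifts by t and -t.\<close>

lemma wave_limit: "((\<lambda>s. F (s + t) + G (s - t)) \<longlongrightarrow> \<tau>) at_top"
proof -
  obtain Fi where Fi: "(F \<longlongrightarrow> Fi) at_top"
    using limit_of_powr_decay[OF F derivative_decay(1) a r] by metis
  obtain Gi where Gi: "(G \<longlongrightarrow> Gi) at_top"
    using limit_of_powr_decay[OF G derivative_decay(2) a r] by metis
  have "Fi + Gi = \<tau>" using tendsto_unique[OF _ tendsto_add[OF Fi Gi] lim] by simp
  moreover have "filterlim (\<lambda>s::real. c + s) at_top at_top" for c
    by (rule filterlim_tendsto_add_at_top[OF tendsto_const filterlim_ident])
  from filterlim_compose[OF Fi this[of t]] filterlim_compose[OF Gi this[of "- t"]]
  have "((\<lambda>s. F (t + s) + G (- t + s)) \<longlongrightarrow> Fi + Gi) at_top" by (rule tendsto_add)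
  ultimately show ?thesis by (simp add: add.commute)
qed

text \<open>Speed above 1 places the front at or beyond a + t, so \<open>speed_ge_b\<close> applies
  on it; integrating the improved speed gives the line a + b t.\<close>

lemma front_estimate:
  assumes front: "shock_front N\<^sub>1 \<eta> \<tau> \<zeta> chi\<^sub>0 chi\<^sub>1 N\<^sub>0 T chi N \<sigma>" and T: "T > 0" and \<sigma>0: "\<sigma> 0 = a"
    and init: "\<And>x. a \<le> x \<Longrightarrow> chi\<^sub>0 x = P x + Q x"
      "\<And>x. a \<le> x \<Longrightarrow> region_value {a..} chi\<^sub>1 x = F x - G x"
    and t: "t \<in> {0..T}"
  shows "a + b * t \<le> \<sigma> t"
    and "region_value (region_E {0..T} \<sigma>) N (\<sigma> t, t) = F (\<sigma> t + t) + G (\<sigma> t - t)"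
    and "region_value {0..T} (deriv \<sigma>) t =
      (F (\<sigma> t + t) - G (\<sigma> t - t)) / (N\<^sub>1 - (F (\<sigma> t + t) + G (\<sigma> t - t)))"
proof -
  note * = shock_frontD[OF front]
  have on: "(\<sigma> u, u) \<in> region_E {0..T} \<sigma>" if "u \<in> {0..T}" for u using that by (simp add: region_E_def)
  note val = solution_is_dalembert(1,2)[OF front T, unfolded \<sigma>0, OF init on]
  have N: "region_value (region_E {0..T} \<sigma>) N (\<sigma> u, u) = F (\<sigma> u + u) + G (\<sigma> u - u)" if "u \<in> {0..T}" for u
    using *(6)[OF on[OF that]] val(1)[OF _ _ that] by simp
  have speed: "region_value {0..T} (deriv \<sigma>) u =
      (F (\<sigma> u + u) - G (\<sigma> u - u)) / (N\<^sub>1 - (F (\<sigma> u + u) + G (\<sigma> u - u)))" if "u \<in> {0..T}" for u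
    using *(8)[OF that] N[OF that] val(2)[OF _ _ that] by simp
  have "u \<le> \<sigma> u - a" if "u \<in> {0..T}" for u
    using front_growth[OF *(2,3) less_imp_le[OF *(9)], of 0 u] that \<sigma>0 by simp
  hence "b \<le> region_value {0..T} (deriv \<sigma>) u" if "u \<in> {0..T}" for u
    unfolding speed[OF that] using that by (intro speed_ge_b) force+
  from front_growth[OF *(2,3) this, of 0 t] show "a + b * t \<le> \<sigma> t" using t \<sigma>0 by simp
  show "region_value (region_E {0..T} \<sigma>) N (\<sigma> t, t) = F (\<sigma> t + t) + G (\<sigma> t - t)"
    "region_value {0..T} (deriv \<sigma>) t =
      (F (\<sigma> t + t) - G (\<sigma> t - t)) / (N\<^sub>1 - (F (\<sigma> t + t) + G (\<sigma> t - t)))"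
    by (rule N[OF t] speed[OF t])+
qed

lemma solution_estimates:
  assumes sol: "\<And>T. T > 0 \<Longrightarrow> shock_front N\<^sub>1 \<eta> \<tau> \<zeta> chi\<^sub>0 chi\<^sub>1 N\<^sub>0 T chi N \<sigma>" and \<sigma>0: "\<sigma> 0 = a"
    and init: "\<And>x. a \<le> x \<Longrightarrow> chi\<^sub>0 x = P x + Q x"
      "\<And>x. a \<le> x \<Longrightarrow> region_value {a..} chi\<^sub>1 x = F x - G x"
    and \<epsilon>: "B < \<epsilon>"
  defines "E \<equiv> region_E {0..} \<sigma>" and "I \<equiv> region_I {0..} \<sigma>"
  shows "\<exists>\<sigma>inf>1. \<bar>\<sigma>inf / \<sigma>\<^sub>1 - 1\<bar> \<le> C * \<epsilon> \<and> (\<forall>t\<ge>0.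
      (SUP s\<in>{\<sigma> t..}. ereal (s powr (r + 1) *
          (\<bar>region_value E (partial_s (partial_s chi)) (s, t)\<bar>
         + \<bar>region_value E (partial_t (partial_s chi)) (s, t)\<bar>)))
        \<le> ereal (C * B) \<and>
      (SUP s\<in>{\<sigma> t..}. ereal (
          \<bar>region_value E (partial_s chi) (s, t) - \<tau>\<bar>
        + \<bar>region_value E (partial_t chi) (s, t) - \<sigma>inf * (N\<^sub>1 - \<tau>)\<bar>))
        \<le> ereal (C * B * (1 + t) powr (- r)) \<and>
      \<bar>region_value {0..} (deriv \<sigma>) t / \<sigma>inf - 1\<bar> \<le> C * B * (1 + t) powr (- r) \<and>
      (SUP s\<in>{0..\<sigma> t}. ereal
          \<bar>region_value I N (s, t) * inverse (\<tau> + \<sigma>inf\<^sup>2 * (N\<^sub>1 - \<tau>)) - 1\<bar>)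
        \<le> ereal (C * B * (1 + t) powr (- r)))"
proof -
  define d where "d = N\<^sub>1 - \<tau>"
  have d: "d > 0" "N\<^sub>1 - d = \<tau>" using \<tau> by (auto simp: d_def)
  obtain q where q: "d < q" "\<bar>q - \<sigma>\<^sub>1 * d\<bar> \<le> B"
    and state: "\<And>s t. 0 \<le> t \<Longrightarrow> a + b * t \<le> s \<Longrightarrow>
       \<bar>F (s + t) + G (s - t) - \<tau>\<bar> + \<bar>F (s + t) - G (s - t) - q\<bar>
         \<le> 2 / r * min a (b - 1) powr (- r) * B * (1 + t) powr (- r)"
    using asymptotic_state unfolding d_def by metis
  define K where "K = 2 / r * min a (b - 1) powr (- r)"
  note C = C_bounds[folded K_def d_def]
  have qd: "q / d * d = q" using d by simp
  have \<sigma>inf: "1 < q / d" using q(1) d by (simp add: field_simps)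
  have C_nonneg: "0 \<le> C" using C(2) d by (smt (verit) divide_nonneg_pos)
  have "\<bar>q / d / \<sigma>\<^sub>1 - 1\<bar> = \<bar>q - \<sigma>\<^sub>1 * d\<bar> / (\<sigma>\<^sub>1 * d)"
  proof -
    have "q / d / \<sigma>\<^sub>1 - 1 = (q - \<sigma>\<^sub>1 * d) / (\<sigma>\<^sub>1 * d)" using d \<sigma>\<^sub>1 by (simp add: field_simps)
    thus ?thesis using d \<sigma>\<^sub>1 by (simp add: abs_mult)
  qed
  also have "\<dots> \<le> B / (1 * d)"
    using q(2) B_nonneg d \<sigma>\<^sub>1 by (intro frac_le mult_right_mono) auto
  also have "\<dots> = 1 / d * B" by simp
  also have "\<dots> \<le> C * B" using C(2) B_nonneg by (rule mult_right_mono)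
  also have "\<dots> \<le> C * \<epsilon>" using C_nonneg \<epsilon> by (intro mult_left_mono) auto
  finally have speed_close: "\<bar>q / d / \<sigma>\<^sub>1 - 1\<bar> \<le> C * \<epsilon>" .
  show ?thesis
  proof (intro exI[of _ "q / d"] conjI allI impI)
    fix t :: real assume t: "0 \<le> t"
    \<comment> \<open>As \<open>T\<close> lies strictly beyond t, the regions over
      \<open>{0..T}\<close> and \<open>{0..}\<close> coincide near time t, and so do the values
      taken from them.\<close>
    define T where "T = t + 1"
    have T: "T > 0" "t \<in> {0..T}" using t by (auto simp: T_def)
    note front = sol[OF T(1)] and * = shock_frontD[OF sol[OF T(1)]]
    have est: "a + b * t \<le> \<sigma> t"
      "region_value (region_E {0..T} \<sigma>) N (\<sigma> t, t) = F (\<sigma> t + t) + G (\<sigma> t - t)"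
      "region_value {0..T} (deriv \<sigma>) t =
        (F (\<sigma> t + t) - G (\<sigma> t - t)) / (N\<^sub>1 - (F (\<sigma> t + t) + G (\<sigma> t - t)))"
      by (rule front_estimate[OF front T(1) \<sigma>0 init T(2)]; assumption)+
    define U :: "(real \<times> real) set" where "U = UNIV \<times> {..<T}"
    have U: "open U" "(s, t) \<in> U" for s by (auto simp: U_def T_def intro!: open_Times)
    have "E \<inter> U = region_E {0..T} \<sigma> \<inter> U" "I \<inter> U = region_I {0..T} \<sigma> \<inter> U"
      by (auto simp: E_def I_def U_def region_E_def region_I_def)
    note E = region_value_local[OF U this(1)] and I = region_value_local[OF U this(2)]
    have J: "region_value {0..} f t = region_value {0..T} f t" for f
      by (rule region_value_local[of "{..<T}"]) (auto simp: T_def)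
    have in_E: "(s, t) \<in> region_E {0..T} \<sigma>" if "\<sigma> t \<le> s" for s using that T by (simp add: region_E_def)
    have val: "region_value E (partial_s chi) (s, t) = F (s + t) + G (s - t)"
      "region_value E (partial_t chi) (s, t) = F (s + t) - G (s - t)"
      "region_value E (partial_s (partial_s chi)) (s, t) = F' (s + t) + G' (s - t)"
      "region_value E (partial_t (partial_s chi)) (s, t) = F' (s + t) - G' (s - t)" if "\<sigma> t \<le> s" for s
      unfolding E using solution_is_dalembert[OF front T(1), unfolded \<sigma>0, OF init in_E[OF that]] by auto
    have ahead: "a + b * t \<le> s" if "\<sigma> t \<le> s" for s using est(1) that by linarith
    have Bt: "0 \<le> B * (1 + t) powr (- r)" using B_nonneg by simp
    have up: "c * (B * (1 + t) powr (- r)) \<le> C * B * (1 + t) powr (- r)" if "c \<le> C" for c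
      using mult_right_mono[OF that Bt] by (simp add: mult.assoc)
    define S V where "S = F (\<sigma> t + t) + G (\<sigma> t - t)" and "V = F (\<sigma> t + t) - G (\<sigma> t - t)"
    have "1 * t \<le> b * t" using b_gt_1 t by (intro mult_right_mono) auto
    hence "a \<le> \<sigma> t + t" "a \<le> \<sigma> t - t" using est(1) t by auto
    hence near: "\<bar>S - \<tau>\<bar> \<le> B" "\<bar>V - \<sigma>\<^sub>1 * d\<bar> \<le> B" using near_sum by (simp_all add: S_def V_def d_def)
    have "B \<le> d / 2" using two_B by (simp add: d_def)
    \<comment> \<open>V and q are both within B of \<open>\<sigma>\<^sub>1 * d\<close>, so |V - q|
      \<le> 2 B < d.\<close>
    hence SV: "\<bar>S - (N\<^sub>1 - d)\<bar> \<le> d / 2" "\<bar>V - q\<bar> \<le> d"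
      using near q(2) two_B[folded d_def] unfolding d(2) by linarith+
    have total: "\<bar>S - (N\<^sub>1 - d)\<bar> + \<bar>V - q\<bar> \<le> K * (B * (1 + t) powr (- r))"
      using state[OF t est(1)] by (simp add: S_def V_def K_def d(2) mult.assoc)
    have scaled: "c / d * (\<bar>S - (N\<^sub>1 - d)\<bar> + \<bar>V - q\<bar>) \<le> c / d * K * (B * (1 + t) powr (- r))" if "0 \<le> c" for c
      unfolding mult.assoc[of "c / d" K] using total that d by (intro mult_left_mono) auto
    show "(SUP s\<in>{\<sigma> t..}. ereal (s powr (r + 1) *
          (\<bar>region_value E (partial_s (partial_s chi)) (s, t)\<bar>
         + \<bar>region_value E (partial_t (partial_s chi)) (s, t)\<bar>))) \<le> ereal (C * B)"
    proof (rule SUP_least)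
      fix s assume "s \<in> {\<sigma> t..}"
      hence s: "\<sigma> t \<le> s" by simp
      show "ereal (s powr (r + 1) * (\<bar>region_value E (partial_s (partial_s chi)) (s, t)\<bar>
         + \<bar>region_value E (partial_t (partial_s chi)) (s, t)\<bar>)) \<le> ereal (C * B)"
        unfolding val[OF s] ereal_less_eq
        by (rule order_trans[OF second_derivative_estimate[OF t ahead[OF s]] mult_right_mono[OF C(1) B_nonneg]])
    qed
    show "(SUP s\<in>{\<sigma> t..}. ereal (
          \<bar>region_value E (partial_s chi) (s, t) - \<tau>\<bar>
        + \<bar>region_value E (partial_t chi) (s, t) - q / d * (N\<^sub>1 - \<tau>)\<bar>))
        \<le> ereal (C * B * (1 + t) powr (- r))"
    proof (rule SUP_least)
      fix s assume "s \<in> {\<sigma> t..}"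
      hence s: "\<sigma> t \<le> s" by simp
      show "ereal (\<bar>region_value E (partial_s chi) (s, t) - \<tau>\<bar>
        + \<bar>region_value E (partial_t chi) (s, t) - q / d * (N\<^sub>1 - \<tau>)\<bar>) \<le> ereal (C * B * (1 + t) powr (- r))"
        unfolding val[OF s] ereal_less_eq d_def[symmetric] qd
        using order_trans[OF state[OF t ahead[OF s]]] up[OF C(3)] by (simp add: K_def mult.assoc)
    qed
    have speed: "region_value {0..} (deriv \<sigma>) t = V / (N\<^sub>1 - S)"
      unfolding J S_def V_def by (rule est(3))
    show "\<bar>region_value {0..} (deriv \<sigma>) t / (q / d) - 1\<bar> \<le> C * B * (1 + t) powr (- r)"
      unfolding speed
      by (rule order_trans[OF speed_error[OF d(1) less_imp_le[OF q(1)] SV(1)] order_trans[OF scaled up[OF C(5)]]]) simp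
    show "(SUP s\<in>{0..\<sigma> t}. ereal
          \<bar>region_value I N (s, t) * inverse (\<tau> + (q / d)\<^sup>2 * (N\<^sub>1 - \<tau>)) - 1\<bar>)
        \<le> ereal (C * B * (1 + t) powr (- r))"
    proof (rule SUP_least)
      fix s assume "s \<in> {0..\<sigma> t}"
      hence s: "(s, t) \<in> region_I {0..T} \<sigma>" using T by (simp add: region_I_def)
      have "region_value I N (s, t) = S + (V / (N\<^sub>1 - S))\<^sup>2 * (N\<^sub>1 - S)"
        unfolding I *(10)[OF s] est(2,3) S_def V_def ..
      thus "ereal \<bar>region_value I N (s, t) * inverse (\<tau> + (q / d)\<^sup>2 * (N\<^sub>1 - \<tau>)) - 1\<bar>
        \<le> ereal (C * B * (1 + t) powr (- r))"
        using order_trans[OF stress_error[OF d(1) less_imp_le[OF q(1)] SV] order_trans[OF scaled[of 27] up[OF C(4)]]]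
        unfolding ereal_less_eq d_def[symmetric] d(2) using \<tau>(1) by simp
    qed
  qed (use \<sigma>inf speed_close in auto)
qed

end

text \<open>The constant is a function of r because r is chosen after it. Suprema are taken in
  \<open>ereal\<close>, where an unbounded family has supremum \<infinity>; equating the supremum
  with \<open>ereal B\<close> thus makes it finite. As \<open>chi\<close> and \<open>N\<close> are
  total functions, with arbitrary values for negative s or t, "the" solution is rendered by
  existence together with a claim about every maximal solution.\<close>

theorem theorem4p2:
  fixes N\<^sub>1 \<eta> \<tau> \<zeta> \<sigma>\<^sub>0 \<sigma>\<^sub>1 :: real
  assumes "N\<^sub>1 > 1" "0 < \<eta>" "\<eta> < N\<^sub>1" "\<eta> < \<tau>" "\<tau> < N\<^sub>1" "\<zeta> = 0"
    and "\<sigma>\<^sub>0 > 0" "\<sigma>\<^sub>1 > 1"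
  shows "\<exists>\<epsilon>\<^sub>0>0. \<exists>C :: real \<Rightarrow> real. (\<forall>r>0. C r > 0) \<and>
    (\<forall>\<epsilon><\<epsilon>\<^sub>0. \<forall>chi\<^sub>0 chi\<^sub>1 N\<^sub>0. \<forall>r>0. \<forall>B :: real.
      classical_shock_data N\<^sub>1 \<eta> \<tau> \<zeta> chi\<^sub>0 chi\<^sub>1 N\<^sub>0 \<and>
      initial_shock_front N\<^sub>1 \<eta> \<tau> \<zeta> chi\<^sub>0 chi\<^sub>1 N\<^sub>0 \<sigma>\<^sub>0 \<and>
      ereal B = (SUP s\<in>{\<sigma>\<^sub>0..}. ereal (
          \<bar>region_value {\<sigma>\<^sub>0..} (deriv chi\<^sub>0) s - \<tau>\<bar>
        + s powr (r + 1) * \<bar>region_value {\<sigma>\<^sub>0..} (deriv (deriv chi\<^sub>0)) s\<bar>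
        + \<bar>region_value {\<sigma>\<^sub>0..} chi\<^sub>1 s - \<sigma>\<^sub>1 * (N\<^sub>1 - \<tau>)\<bar>
        + s powr (r + 1) * \<bar>region_value {\<sigma>\<^sub>0..} (deriv chi\<^sub>1) s\<bar>)) \<and>
      B < \<epsilon>
      \<longrightarrow>
      (\<exists>T chi N \<sigma>. maximal_shock_solution N\<^sub>1 \<eta> \<tau> \<zeta> chi\<^sub>0 chi\<^sub>1 N\<^sub>0 T chi N \<sigma>) \<and>
      (\<forall>T chi N \<sigma>. maximal_shock_solution N\<^sub>1 \<eta> \<tau> \<zeta> chi\<^sub>0 chi\<^sub>1 N\<^sub>0 T chi N \<sigma> \<longrightarrow>
        T = \<infinity> \<and>
        (\<exists>\<sigma>inf>1. \<bar>\<sigma>inf / \<sigma>\<^sub>1 - 1\<bar> \<le> C r * \<epsilon> \<and>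
          (let E = region_E {0..} \<sigma>; I = region_I {0..} \<sigma> in
           \<forall>t\<ge>0.
            (SUP s\<in>{\<sigma> t..}. ereal (s powr (r + 1) *
                (\<bar>region_value E (partial_s (partial_s chi)) (s, t)\<bar>
               + \<bar>region_value E (partial_t (partial_s chi)) (s, t)\<bar>)))
              \<le> ereal (C r * B) \<and>
            (SUP s\<in>{\<sigma> t..}. ereal (
                \<bar>region_value E (partial_s chi) (s, t) - \<tau>\<bar>
              + \<bar>region_value E (partial_t chi) (s, t) - \<sigma>inf * (N\<^sub>1 - \<tau>)\<bar>))
              \<le> ereal (C r * B * (1 + t) powr (- r)) \<and>
            \<bar>region_value {0..} (deriv \<sigma>) t / \<sigma>inf - 1\<bar> \<le> C r * B * (1 + t) powr (- r) \<and>
            (SUP s\<in>{0..\<sigma> t}. ereal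
                \<bar>region_value I N (s, t) * inverse (\<tau> + \<sigma>inf\<^sup>2 * (N\<^sub>1 - \<tau>)) - 1\<bar>)
              \<le> ereal (C r * B * (1 + t) powr (- r))))))"
proof -
  \<comment> \<open>The three entries are the smallness conditions of \<open>small_data\<close>,
    solved for B.\<close>
  define \<epsilon>\<^sub>0 where "\<epsilon>\<^sub>0 = min ((N\<^sub>1 - \<tau>) / 2) (min (\<tau> - \<eta>) ((\<sigma>\<^sub>1 - 1) * (N\<^sub>1 - \<tau>) / (3 + \<sigma>\<^sub>1)))"
  define C where "C = decay_constant N\<^sub>1 \<tau> \<sigma>\<^sub>0 ((1 + \<sigma>\<^sub>1) / 2)"
  have \<epsilon>\<^sub>0: "\<epsilon>\<^sub>0 > 0" using assms by (simp add: \<epsilon>\<^sub>0_def)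
  have C: "\<forall>r>0. C r > 0" using assms by (simp add: C_def decay_constant_pos)
  show ?thesis
  proof (rule exI[of _ \<epsilon>\<^sub>0], rule conjI[OF \<epsilon>\<^sub>0], rule exI[of _ C], rule conjI[OF C],
      intro conjI allI impI; elim conjE)
    fix \<epsilon> :: real and chi\<^sub>0 chi\<^sub>1 N\<^sub>0 :: "real \<Rightarrow> real" and r B :: real
    assume \<epsilon>: "\<epsilon> < \<epsilon>\<^sub>0" and r: "0 < r" and data: "classical_shock_data N\<^sub>1 \<eta> \<tau> \<zeta> chi\<^sub>0 chi\<^sub>1 N\<^sub>0"
      and init: "initial_shock_front N\<^sub>1 \<eta> \<tau> \<zeta> chi\<^sub>0 chi\<^sub>1 N\<^sub>0 \<sigma>\<^sub>0"
      and B: "ereal B = (SUP s\<in>{\<sigma>\<^sub>0..}. ereal (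
          \<bar>region_value {\<sigma>\<^sub>0..} (deriv chi\<^sub>0) s - \<tau>\<bar>
        + s powr (r + 1) * \<bar>region_value {\<sigma>\<^sub>0..} (deriv (deriv chi\<^sub>0)) s\<bar>
        + \<bar>region_value {\<sigma>\<^sub>0..} chi\<^sub>1 s - \<sigma>\<^sub>1 * (N\<^sub>1 - \<tau>)\<bar>
        + s powr (r + 1) * \<bar>region_value {\<sigma>\<^sub>0..} (deriv chi\<^sub>1) s\<bar>))"
      and B\<epsilon>: "B < \<epsilon>"
    have cont: "continuous_on {0..} chi\<^sub>0" using data by (simp add: classical_shock_data_def)
    obtain P Q F G F' G' where waves: "dalembert P Q F G F' G'"
      and chi0: "\<And>x. \<sigma>\<^sub>0 \<le> x \<Longrightarrow> chi\<^sub>0 x = P x + Q x"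
      and dchi0: "\<And>x. \<sigma>\<^sub>0 \<le> x \<Longrightarrow> region_value {\<sigma>\<^sub>0..} (deriv chi\<^sub>0) x = F x + G x"
        "\<And>x. \<sigma>\<^sub>0 \<le> x \<Longrightarrow> region_value {\<sigma>\<^sub>0..} (deriv (deriv chi\<^sub>0)) x = F' x + G' x"
      and chi1: "\<And>x. \<sigma>\<^sub>0 \<le> x \<Longrightarrow> region_value {\<sigma>\<^sub>0..} chi\<^sub>1 x = F x - G x"
      and dchi1: "\<And>x. \<sigma>\<^sub>0 \<le> x \<Longrightarrow> region_value {\<sigma>\<^sub>0..} (deriv chi\<^sub>1) x = F' x - G' x"
      and lim: "((\<lambda>x. F x + G x) \<longlongrightarrow> \<tau>) at_top" and start: "P \<sigma>\<^sub>0 + Q \<sigma>\<^sub>0 = N\<^sub>1 * \<sigma>\<^sub>0"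
      by (fact initial_data_decomposition[OF cont init])
    have bound: "\<bar>F x + G x - \<tau>\<bar> + x powr (r + 1) * \<bar>F' x + G' x\<bar>
      + \<bar>F x - G x - \<sigma>\<^sub>1 * (N\<^sub>1 - \<tau>)\<bar> + x powr (r + 1) * \<bar>F' x - G' x\<bar> \<le> B" if x: "\<sigma>\<^sub>0 \<le> x" for x
    proof -
      have "ereal (\<bar>region_value {\<sigma>\<^sub>0..} (deriv chi\<^sub>0) x - \<tau>\<bar>
        + x powr (r + 1) * \<bar>region_value {\<sigma>\<^sub>0..} (deriv (deriv chi\<^sub>0)) x\<bar>
        + \<bar>region_value {\<sigma>\<^sub>0..} chi\<^sub>1 x - \<sigma>\<^sub>1 * (N\<^sub>1 - \<tau>)\<bar>
        + x powr (r + 1) * \<bar>region_value {\<sigma>\<^sub>0..} (deriv chi\<^sub>1) x\<bar>) \<le> ereal B"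
        unfolding B using x by (intro SUP_upper) simp
      thus ?thesis unfolding dchi0[OF x] chi1[OF x] dchi1[OF x] ereal_less_eq .
    qed
    have B\<^sub>0: "B < \<epsilon>\<^sub>0" using B\<epsilon> \<epsilon> by simp
    interpret small_data P Q F G F' G' N\<^sub>1 \<eta> \<tau> \<sigma>\<^sub>1 \<sigma>\<^sub>0 r B
    proof (intro small_data.intro waves small_data_axioms.intro bound start lim r)
      show "(3 + \<sigma>\<^sub>1) * B < (\<sigma>\<^sub>1 - 1) * (N\<^sub>1 - \<tau>)"
        using B\<^sub>0 assms by (simp add: \<epsilon>\<^sub>0_def field_simps)
    qed (use assms B\<^sub>0 in \<open>auto simp: \<epsilon>\<^sub>0_def\<close>)
    have "maximal_shock_solution N\<^sub>1 \<eta> \<tau> 0 chi\<^sub>0 chi\<^sub>1 N\<^sub>0 \<infinity>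
        (front_data.motion P Q N\<^sub>1 \<sigma>\<^sub>0) (front_data.stress P Q F G N\<^sub>1 \<sigma>\<^sub>0) (front_data.front P Q N\<^sub>1 \<sigma>\<^sub>0)"
      using init assms(6) by (intro front_data.maximal_shock_solution_motion[OF front_data] chi0 chi1 wave_limit) auto
    hence ex: "\<exists>chi N \<sigma>. maximal_shock_solution N\<^sub>1 \<eta> \<tau> \<zeta> chi\<^sub>0 chi\<^sub>1 N\<^sub>0 \<infinity> chi N \<sigma>" using assms(6) by blast
    thus "\<exists>T chi N \<sigma>. maximal_shock_solution N\<^sub>1 \<eta> \<tau> \<zeta> chi\<^sub>0 chi\<^sub>1 N\<^sub>0 T chi N \<sigma>" by blast
    \<comment> \<open>From here on the maximal solution is arbitrary. Maximality against the
      constructed one forces its final time to be infinite.\<close>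
    fix T chi N \<sigma> assume sol: "maximal_shock_solution N\<^sub>1 \<eta> \<tau> \<zeta> chi\<^sub>0 chi\<^sub>1 N\<^sub>0 T chi N \<sigma>"
    have "\<infinity> \<le> T" using sol ex unfolding maximal_shock_solution_def by blast
    thus T: "T = \<infinity>" by simp
    have front: "shock_front N\<^sub>1 \<eta> \<tau> \<zeta> chi\<^sub>0 chi\<^sub>1 N\<^sub>0 T' chi N \<sigma>" if "T' > 0" for T'
      using sol that unfolding maximal_shock_solution_def shock_solution_before_def T by simp
    have "initial_shock_front N\<^sub>1 \<eta> \<tau> \<zeta> chi\<^sub>0 chi\<^sub>1 N\<^sub>0 (\<sigma> 0)" using shock_frontD(1)[OF front[of 1]] by simp
    \<comment> \<open>The definition of a solution requires only that \<open>\<sigma> 0\<close> is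
      some initial front of the data; the data have just one.\<close>
    hence \<sigma>0: "\<sigma> 0 = \<sigma>\<^sub>0" using init data unfolding classical_shock_data_def by blast
    have C_r: "C r = decay_constant N\<^sub>1 \<tau> \<sigma>\<^sub>0 b r" by (simp add: C_def b_def)
    show "\<exists>\<sigma>inf>1. \<bar>\<sigma>inf / \<sigma>\<^sub>1 - 1\<bar> \<le> C r * \<epsilon> \<and>
          (let E = region_E {0..} \<sigma>; I = region_I {0..} \<sigma> in
           \<forall>t\<ge>0.
            (SUP s\<in>{\<sigma> t..}. ereal (s powr (r + 1) *
                (\<bar>region_value E (partial_s (partial_s chi)) (s, t)\<bar>
               + \<bar>region_value E (partial_t (partial_s chi)) (s, t)\<bar>)))
              \<le> ereal (C r * B) \<and>
            (SUP s\<in>{\<sigma> t..}. ereal (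
                \<bar>region_value E (partial_s chi) (s, t) - \<tau>\<bar>
              + \<bar>region_value E (partial_t chi) (s, t) - \<sigma>inf * (N\<^sub>1 - \<tau>)\<bar>))
              \<le> ereal (C r * B * (1 + t) powr (- r)) \<and>
            \<bar>region_value {0..} (deriv \<sigma>) t / \<sigma>inf - 1\<bar> \<le> C r * B * (1 + t) powr (- r) \<and>
            (SUP s\<in>{0..\<sigma> t}. ereal
                \<bar>region_value I N (s, t) * inverse (\<tau> + \<sigma>inf\<^sup>2 * (N\<^sub>1 - \<tau>)) - 1\<bar>)
              \<le> ereal (C r * B * (1 + t) powr (- r)))"
      unfolding Let_def C_r by (rule solution_estimates[OF front \<sigma>0 chi0 chi1 B\<epsilon>]; assumption)
  qed
qed

end
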